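(* There exists an algorithm which, given an instance of \textsc{DPVC} on a graph $G=(V,E)$ with $n=|V|$, a tree decomposition of $G$ of width $t$, and any $\epsilon>0$, produces a $(1+\epsilon)$-approximation of the optimal solution in time $\left(O\!\left(\frac{\log n}{\epsilon}\right)\right)^{t} n^{O(1)}$. Therefore, \textsc{DPVC} admits an FPT approximation scheme parameterized by treewidth.
   Context: \textsc{Directed Power Vertex Cover (DPVC)}: the input is a finite simple undirected graph $G=(V,E)$ together with, for each edge $(u,v)\in E$, two positive integers $w_{u,v}$ and $w_{v,u}$. A feasible solution assigns to each $v\in V$ a value $p_v\ge 0$ such that for every edge $(u,v)\in E$ we have $p_u\ge w_{u,v}$ or $p_v\ge w_{v,u}$. The goal is to minimize $\sum_{v\in V}p_v$. A $(1+\epsilon)$-approximation is a feasible solution of total value at most $(1+\epsilon)$ times the optimal value. An FPT approximation scheme parameterized by treewidth $t$ is an algorithm which, for any $\epsilon>0$, returns a $(1+\epsilon)$-approximate solution in time FPT in $t$ and $1/\epsilon$, i.e. in time $f(t,1/\epsilon)\,n^{O(1)}$ for some function $f$. Convention: as is standard, the supplied tree decomposition may be assumed to be a nice tree decomposition (rooted binary, with leaf, introduce, forget and join nodes).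
   Formalization: The base O(log n/ε) is read as O(max(1, log n/ε)), since for ε far above log n the stated bound falls below one step; the polynomial factor is in n plus the number of nodes of the supplied decomposition; ε is given as a positive rational. *)

theory Defs
  imports Complex_Main
begin

section \<open>Graphs, tree decompositions, treewidth\<close>

definition simple_graph :: "'a set \<Rightarrow> 'a set set \<Rightarrow> bool" where
  "simple_graph V E \<longleftrightarrow>
     finite V \<and> (\<forall>e\<in>E. \<exists>u v. u \<in> V \<and> v \<in> V \<and> u \<noteq> v \<and> e = {u, v})"

definition connected_on :: "'a set set \<Rightarrow> 'a set \<Rightarrow> bool" where
  "connected_on E X \<longleftrightarrow>
     (\<forall>x\<in>X. \<forall>y\<in>X. (x, y) \<in> {(u, v). u \<in> X \<and> v \<in> X \<and> {u, v} \<in> E}\<^sup>*)"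

definition acyclic_graph :: "'a set set \<Rightarrow> bool" where
  "acyclic_graph E \<longleftrightarrow>
     \<not> (\<exists>xs. length xs \<ge> 3 \<and> distinct xs \<and>
          (\<forall>i<length xs. {xs ! i, xs ! ((i + 1) mod length xs)} \<in> E))"

definition tree_graph :: "'i set \<Rightarrow> 'i set set \<Rightarrow> bool" where
  "tree_graph I F \<longleftrightarrow>
     simple_graph I F \<and> I \<noteq> {} \<and> connected_on F I \<and> acyclic_graph F"

definition tree_decomposition ::
  "'a set \<Rightarrow> 'a set set \<Rightarrow> 'i set \<Rightarrow> 'i set set \<Rightarrow> ('i \<Rightarrow> 'a set) \<Rightarrow> bool" where
  "tree_decomposition V E I F B \<longleftrightarrow>
     tree_graph I F \<and>
     (\<Union>i\<in>I. B i) = V \<and>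
     (\<forall>e\<in>E. \<exists>i\<in>I. e \<subseteq> B i) \<and>
     (\<forall>v\<in>V. connected_on F {i \<in> I. v \<in> B i})"

definition td_width :: "'i set \<Rightarrow> ('i \<Rightarrow> 'a set) \<Rightarrow> nat" where
  "td_width I B = Max ((\<lambda>i. card (B i)) ` I) - 1"

text \<open>Tree nodes are taken to be natural numbers here; this loses nothing, as trees are finite.\<close>

definition treewidth :: "'a set \<Rightarrow> 'a set set \<Rightarrow> nat" where
  "treewidth V E =
     (LEAST t. \<exists>(I :: nat set) F B. tree_decomposition V E I F B \<and> td_width I B = t)"

section \<open>Nice tree decompositions\<close>

text \<open>
  The conventions on leaf bags (empty, or a single vertex) and on the root bag (empty, or not) vary;
  no restriction is imposed on either, so that all of them are covered.
\<close>

datatype ntd =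
    Leaf "nat list"
  | Introduce nat ntd
  | Forget nat ntd
  | Join ntd ntd

fun root_bag :: "ntd \<Rightarrow> nat set" where
  "root_bag (Leaf xs) = set xs"
| "root_bag (Introduce v T) = insert v (root_bag T)"
| "root_bag (Forget v T) = root_bag T - {v}"
| "root_bag (Join S T) = root_bag S"

fun nice :: "ntd \<Rightarrow> bool" where
  "nice (Leaf xs) \<longleftrightarrow> distinct xs"
| "nice (Introduce v T) \<longleftrightarrow> nice T \<and> v \<notin> root_bag T"
| "nice (Forget v T) \<longleftrightarrow> nice T \<and> v \<in> root_bag T"
| "nice (Join S T) \<longleftrightarrow> nice S \<and> nice T \<and> root_bag S = root_bag T"

text \<open>The nodes of the underlying rooted tree are addressed by their paths from the root.\<close>

fun ntd_nodes :: "ntd \<Rightarrow> bool list set" where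
  "ntd_nodes (Leaf xs) = {[]}"
| "ntd_nodes (Introduce v T) = insert [] (Cons False ` ntd_nodes T)"
| "ntd_nodes (Forget v T) = insert [] (Cons False ` ntd_nodes T)"
| "ntd_nodes (Join S T) = insert [] (Cons False ` ntd_nodes S \<union> Cons True ` ntd_nodes T)"

definition ntd_edges :: "ntd \<Rightarrow> bool list set set" where
  "ntd_edges T = {{q, q @ [d]} | q d. q @ [d] \<in> ntd_nodes T}"

text \<open>Only the values at \<open>ntd_nodes T\<close> are relevant.\<close>

fun ntd_bag :: "ntd \<Rightarrow> bool list \<Rightarrow> nat set" where
  "ntd_bag T [] = root_bag T"
| "ntd_bag (Introduce v T) (d # q) = ntd_bag T q"
| "ntd_bag (Forget v T) (d # q) = ntd_bag T q"
| "ntd_bag (Join S T) (d # q) = (if d then ntd_bag T q else ntd_bag S q)"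
| "ntd_bag (Leaf xs) (d # q) = {}"

definition nice_tree_decomposition :: "nat set \<Rightarrow> nat set set \<Rightarrow> ntd \<Rightarrow> bool" where
  "nice_tree_decomposition V E T \<longleftrightarrow>
     nice T \<and> tree_decomposition V E (ntd_nodes T) (ntd_edges T) (ntd_bag T)"

definition ntd_width :: "ntd \<Rightarrow> nat" where
  "ntd_width T = td_width (ntd_nodes T) (ntd_bag T)"

section \<open>Directed Power Vertex Cover\<close>

definition dpvc_instance :: "'a set \<Rightarrow> 'a set set \<Rightarrow> ('a \<Rightarrow> 'a \<Rightarrow> nat) \<Rightarrow> bool" where
  "dpvc_instance V E w \<longleftrightarrow>
     simple_graph V E \<and> (\<forall>u v. {u, v} \<in> E \<longrightarrow> w u v > 0)"

definition dpvc_feasible ::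
  "'a set \<Rightarrow> 'a set set \<Rightarrow> ('a \<Rightarrow> 'a \<Rightarrow> nat) \<Rightarrow> ('a \<Rightarrow> real) \<Rightarrow> bool" where
  "dpvc_feasible V E w p \<longleftrightarrow>
     (\<forall>v\<in>V. p v \<ge> 0) \<and>
     (\<forall>u v. {u, v} \<in> E \<longrightarrow> p u \<ge> real (w u v) \<or> p v \<ge> real (w v u))"

definition dpvc_opt :: "'a set \<Rightarrow> 'a set set \<Rightarrow> ('a \<Rightarrow> 'a \<Rightarrow> nat) \<Rightarrow> real" where
  "dpvc_opt V E w = Inf {(\<Sum>v\<in>V. p v) | p. dpvc_feasible V E w p}"

definition dpvc_approx ::
  "'a set \<Rightarrow> 'a set set \<Rightarrow> ('a \<Rightarrow> 'a \<Rightarrow> nat) \<Rightarrow> real \<Rightarrow> ('a \<Rightarrow> real) \<Rightarrow> bool" where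
  "dpvc_approx V E w r p \<longleftrightarrow>
     dpvc_feasible V E w p \<and> (\<Sum>v\<in>V. p v) \<le> r * dpvc_opt V E w"

section \<open>Model of computation\<close>

text \<open>
  Programs are finite lists of mutually recursive first-order functions over machine words and
  immutable two-field cells (pointers to cells are implicit), evaluated call-by-value. Evaluating
  one expression node costs one time unit. Local variables are de Bruijn indices into an
  environment whose length is bounded by a constant of the program, words can be compared and
  combined arithmetically, but there is no structural equality of cells and no array; so each unit is
  a constant number of steps of a word RAM whose words can hold the numbers and the addresses
  in use.

  No number larger than the parameter \<open>W\<close> may be produced: a computation that would exceed
  it has no result. Unit-cost arithmetic thus cannot be abused on long numbers.
\<close>

datatype val = Num nat | Cell val val

datatype binop = Plus | Minus | Times | Quot | Less | Equal

fun binop_apply :: "binop \<Rightarrow> nat \<Rightarrow> nat \<Rightarrow> nat" where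
  "binop_apply Plus x y = x + y"
| "binop_apply Minus x y = x - y"
| "binop_apply Times x y = x * y"
| "binop_apply Quot x y = x div y"
| "binop_apply Less x y = (if x < y then 1 else 0)"
| "binop_apply Equal x y = (if x = y then 1 else 0)"

datatype expr =
    Var nat
  | Const nat
  | Op binop expr expr
  | Cons2 expr expr
  | First expr
  | Second expr
  | IsCell expr
  | Cond expr expr expr
  | Bind expr expr
  | Call nat "expr list"

type_synonym prog = "expr list"

text \<open>\<open>eval P W \<rho> e v t\<close>: in environment \<open>\<rho>\<close>, \<open>e\<close> evaluates to \<open>v\<close> in time \<open>t\<close>.\<close>

inductive eval :: "prog \<Rightarrow> nat \<Rightarrow> val list \<Rightarrow> expr \<Rightarrow> val \<Rightarrow> nat \<Rightarrow> bool"
  and evals :: "prog \<Rightarrow> nat \<Rightarrow> val list \<Rightarrow> expr list \<Rightarrow> val list \<Rightarrow> nat \<Rightarrow> bool"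
  for P :: prog and W :: nat
where
  Var: "i < length \<rho> \<Longrightarrow> eval P W \<rho> (Var i) (\<rho> ! i) 1"
| Const: "k \<le> W \<Longrightarrow> eval P W \<rho> (Const k) (Num k) 1"
| Op: "eval P W \<rho> e1 (Num x) t1 \<Longrightarrow> eval P W \<rho> e2 (Num y) t2 \<Longrightarrow> binop_apply f x y \<le> W \<Longrightarrow>
    eval P W \<rho> (Op f e1 e2) (Num (binop_apply f x y)) (t1 + t2 + 1)"
| Cons2: "eval P W \<rho> e1 x t1 \<Longrightarrow> eval P W \<rho> e2 y t2 \<Longrightarrow>
    eval P W \<rho> (Cons2 e1 e2) (Cell x y) (t1 + t2 + 1)"
| First: "eval P W \<rho> e (Cell x y) t \<Longrightarrow> eval P W \<rho> (First e) x (t + 1)"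
| Second: "eval P W \<rho> e (Cell x y) t \<Longrightarrow> eval P W \<rho> (Second e) y (t + 1)"
| IsCell_True: "eval P W \<rho> e (Cell x y) t \<Longrightarrow> 1 \<le> W \<Longrightarrow> eval P W \<rho> (IsCell e) (Num 1) (t + 1)"
| IsCell_False: "eval P W \<rho> e (Num x) t \<Longrightarrow> eval P W \<rho> (IsCell e) (Num 0) (t + 1)"
| Cond_True: "eval P W \<rho> e (Num x) t1 \<Longrightarrow> x \<noteq> 0 \<Longrightarrow> eval P W \<rho> e1 v t2 \<Longrightarrow>
    eval P W \<rho> (Cond e e1 e2) v (t1 + t2 + 1)"
| Cond_False: "eval P W \<rho> e (Num 0) t1 \<Longrightarrow> eval P W \<rho> e2 v t2 \<Longrightarrow>
    eval P W \<rho> (Cond e e1 e2) v (t1 + t2 + 1)"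
| Bind: "eval P W \<rho> e1 x t1 \<Longrightarrow> eval P W (x # \<rho>) e2 v t2 \<Longrightarrow>
    eval P W \<rho> (Bind e1 e2) v (t1 + t2 + 1)"
| Call: "f < length P \<Longrightarrow> evals P W \<rho> es vs t1 \<Longrightarrow> eval P W vs (P ! f) v t2 \<Longrightarrow>
    eval P W \<rho> (Call f es) v (t1 + t2 + 1)"
| Nil: "evals P W \<rho> [] [] 0"
| Cons: "eval P W \<rho> e v t1 \<Longrightarrow> evals P W \<rho> es vs t2 \<Longrightarrow> evals P W \<rho> (e # es) (v # vs) (t1 + t2)"

text \<open>Evaluation is deterministic, so result and running time are functions of the input.\<close>

inductive_cases eval_elims:
  "eval P W \<rho> (Var i) v t"
  "eval P W \<rho> (Const k) v t"
  "eval P W \<rho> (Op f e1 e2) v t"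
  "eval P W \<rho> (Cons2 e1 e2) v t"
  "eval P W \<rho> (First e) v t"
  "eval P W \<rho> (Second e) v t"
  "eval P W \<rho> (IsCell e) v t"
  "eval P W \<rho> (Cond e e1 e2) v t"
  "eval P W \<rho> (Bind e1 e2) v t"
  "eval P W \<rho> (Call f es) v t"

inductive_cases evals_elims:
  "evals P W \<rho> [] vs t"
  "evals P W \<rho> (e # es) vs t"

lemma eval_deterministic:
  "eval P W \<rho> e v t \<Longrightarrow> (\<And>v' t'. eval P W \<rho> e v' t' \<Longrightarrow> v' = v \<and> t' = t)"
  "evals P W \<rho> es vs t \<Longrightarrow> (\<And>vs' t'. evals P W \<rho> es vs' t' \<Longrightarrow> vs' = vs \<and> t' = t)"
proof (induction rule: eval_evals.inducts)
  case Var
  from Var.prems show ?case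
    by (elim eval_elims) auto
next
  case Const
  from Const.prems show ?case
    by (elim eval_elims) auto
next
  case Op
  from Op.prems show ?case
    by (elim eval_elims) (fastforce dest: Op.IH(2,4))+
next
  case Cons2
  from Cons2.prems show ?case
    by (elim eval_elims) (fastforce dest: Cons2.IH(2,4))+
next
  case First
  from First.prems show ?case
    by (elim eval_elims) (fastforce dest: First.IH(2))+
next
  case Second
  from Second.prems show ?case
    by (elim eval_elims) (fastforce dest: Second.IH(2))+
next
  case IsCell_True
  from IsCell_True.prems show ?case
    by (elim eval_elims) (fastforce dest: IsCell_True.IH(2))+
next
  case IsCell_False
  from IsCell_False.prems show ?case
    by (elim eval_elims) (fastforce dest: IsCell_False.IH(2))+
next
  case Cond_True
  from Cond_True.prems show ?case
    by (elim eval_elims) (fastforce dest: Cond_True.IH(2,4) simp: Cond_True.hyps)+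
next
  case Cond_False
  from Cond_False.prems show ?case
    by (elim eval_elims) (fastforce dest: Cond_False.IH(2,4))+
next
  case Bind
  from Bind.prems show ?case
    by (elim eval_elims) (fastforce dest: Bind.IH(2,4))+
next
  case Call
  from Call.prems show ?case
    by (elim eval_elims) (fastforce dest: Call.IH(3,5))+
next
  case Nil
  from Nil.prems show ?case
    by (elim evals_elims) auto
next
  case Cons
  from Cons.prems show ?case
    by (elim evals_elims) (fastforce dest: Cons.IH(2,4))+
qed

fun max_num :: "val \<Rightarrow> nat" where
  "max_num (Num k) = k"
| "max_num (Cell x y) = max (max_num x) (max_num y)"

text \<open>
  Words of \<open>O(log M)\<close> bits, where \<open>M\<close> is the largest number in the input: the exponent \<open>k\<close> is
  the constant in the word length.
\<close>

definition computes_within :: "prog \<Rightarrow> nat \<Rightarrow> val \<Rightarrow> val \<Rightarrow> real \<Rightarrow> bool" where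
  "computes_within P k x y B \<longleftrightarrow>
     (\<exists>t. eval P ((2 + max_num x) ^ k) [x] (Call 0 [Var 0]) y t \<and> real t \<le> B)"

section \<open>Encoding of inputs and outputs\<close>

fun enc_list :: "('b \<Rightarrow> val) \<Rightarrow> 'b list \<Rightarrow> val" where
  "enc_list f [] = Num 0"
| "enc_list f (x # xs) = Cell (f x) (enc_list f xs)"

text \<open>An entry \<open>(u, v, a, b)\<close> of the edge list is an edge \<open>{u, v}\<close> with \<open>w u v = a\<close>, \<open>w v u = b\<close>.\<close>

type_synonym edge_entry = "nat \<times> nat \<times> nat \<times> nat"

definition edge_list :: "nat set set \<Rightarrow> (nat \<Rightarrow> nat \<Rightarrow> nat) \<Rightarrow> edge_entry list \<Rightarrow> bool" where
  "edge_list E w es \<longleftrightarrow>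
     distinct (map (\<lambda>(u, v, a, b). {u, v}) es) \<and>
     (\<lambda>(u, v, a, b). {u, v}) ` set es = E \<and>
     (\<forall>(u, v, a, b)\<in>set es. a = w u v \<and> b = w v u)"

fun enc_edge :: "edge_entry \<Rightarrow> val" where
  "enc_edge (u, v, a, b) = Cell (Num u) (Cell (Num v) (Cell (Num a) (Num b)))"

definition enc_instance :: "nat \<Rightarrow> edge_entry list \<Rightarrow> val" where
  "enc_instance n es = Cell (Num n) (enc_list enc_edge es)"

fun enc_ntd :: "ntd \<Rightarrow> val" where
  "enc_ntd (Leaf xs) = Cell (Num 0) (enc_list Num xs)"
| "enc_ntd (Introduce v T) = Cell (Num 1) (Cell (Num v) (enc_ntd T))"
| "enc_ntd (Forget v T) = Cell (Num 2) (Cell (Num v) (enc_ntd T))"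
| "enc_ntd (Join S T) = Cell (Num 3) (Cell (enc_ntd S) (enc_ntd T))"

text \<open>The accuracy is the positive rational \<open>\<epsilon> = a / b\<close>, given by \<open>a\<close> and \<open>b\<close>.\<close>

definition enc_ratio :: "nat \<Rightarrow> nat \<Rightarrow> val" where
  "enc_ratio a b = Cell (Num a) (Num b)"

text \<open>The output lists the values of the vertices \<open>0, \<dots>, n - 1\<close>.\<close>

definition approx_output ::
  "nat \<Rightarrow> nat set set \<Rightarrow> (nat \<Rightarrow> nat \<Rightarrow> nat) \<Rightarrow> real \<Rightarrow> val \<Rightarrow> bool" where
  "approx_output n E w r y \<longleftrightarrow>
     (\<exists>ps. length ps = n \<and> y = enc_list Num ps \<and> dpvc_approx {..<n} E w r (\<lambda>v. real (ps ! v)))"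

section \<open>FPT approximation schemes\<close>

text \<open>The input is only the instance and the accuracy: no tree decomposition is supplied.\<close>

definition dpvc_fpt_approximation_scheme_treewidth :: "prog \<Rightarrow> bool" where
  "dpvc_fpt_approximation_scheme_treewidth P \<longleftrightarrow>
     (\<exists>(f :: nat \<Rightarrow> real \<Rightarrow> real) (c :: nat) (k :: nat).
        \<forall>n E w es a b \<epsilon>.
          dpvc_instance {..<n} E w \<longrightarrow> edge_list E w es \<longrightarrow>
          0 < a \<longrightarrow> 0 < b \<longrightarrow> \<epsilon> = real a / real b \<longrightarrow>
          (\<exists>y. computes_within P k (Cell (enc_instance n es) (enc_ratio a b)) y
                 (f (treewidth {..<n} E) (1 / \<epsilon>) * real (n + 1) ^ c) \<and>
               approx_output n E w (1 + \<epsilon>) y))"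

end

theory Submission
  imports Defs
begin

text \<open>
  For \<open>\<epsilon> \<ge> 1\<close> the local ratio method gives a 2-approximation, of value \<open>A\<close> say. Otherwise it suffices to
  assign to a vertex one of its weights from a geometric progression with ratio \<open>1 + \<epsilon> / 2\<close> that starts at
  the largest weight up to \<open>A\<close> and is cut off below \<open>\<epsilon> A / (4 n)\<close>; since \<open>A\<close> is at most twice the optimum,
  this costs a factor \<open>1 + \<epsilon>\<close>. There are \<open>O (log n / \<epsilon>)\<close> such values, also for \<open>\<epsilon> < 1 / n\<^sup>2\<close>, as a vertex
  has fewer than \<open>n\<close> weights. Dynamic programming finds the best assignment. Tables are built at forget nodes
  only, for the bag without the forgotten vertex, so that the number of values enters with the width as the
  exponent; the further factor for the forgotten vertex is polynomial in \<open>n\<close>.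

  If no decomposition is given, the vertices are added one at a time. Adding the new vertex to all bags of a
  decomposition that has been found for the others gives one that is slightly too wide. The same dynamic
  program on it, with the labels 0 and 1 for the two sides of a cut and an expensive third label for the cut
  vertices, computes the minimum separators that are needed to build a new decomposition of bounded width by
  the recursive method of Robertson and Seymour.
\<close>

section \<open>Verification of programs\<close>

text \<open>Two obstacles shape the development. The scheme needs a bound that separates the
  treewidth from n, although the dynamic program costs a power of log n / \<epsilon> whose exponent
  grows with the treewidth. For y about ln n, the inequality y^j \<le> j! exp y trades this power
  for j! times a factor linear in n. Secondly, minimum separators must be found by a verified
  program. Reusing the dynamic program avoids a flow algorithm, but it needs some decomposition to
  run on, which is why the vertices arrive one at a time. If bags of size s suffice, the recursion
  maintains an interface of at most B = 3s + 2 vertices. One more vertex makes it at most 3(s + 1).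
  A balanced separation leaves at most 2(s + 1) of them on a side, and s separator vertices bring
  this to B again. The bag of a join unites the interfaces of both sides and has at most 2B = 6s + 4
  vertices; adding a vertex to all bags gives 6s + 5, and the recursion restores 6s + 4.\<close>

lemma ex3I: "R x y z \<Longrightarrow> \<exists>x y z. R x y z"
  by blast

text \<open>The times are put into the successor form in which the simplifier leaves
  \<open>t + 1\<close>, so that the rules match simplified goals.\<close>

lemmas eval_intros = eval_evals.intros[unfolded One_nat_def add_Suc_right add_0_right]

fun esize :: "expr \<Rightarrow> nat" and esizes :: "expr list \<Rightarrow> nat" where
  "esize (Var i) = 1"
| "esize (Const k) = 1"
| "esize (Op f e1 e2) = esize e1 + esize e2 + 1"
| "esize (Cons2 e1 e2) = esize e1 + esize e2 + 1"
| "esize (First e) = esize e + 1"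
| "esize (Second e) = esize e + 1"
| "esize (IsCell e) = esize e + 1"
| "esize (Cond e e1 e2) = esize e + esize e1 + esize e2 + 1"
| "esize (Bind e1 e2) = esize e1 + esize e2 + 1"
| "esize (Call f es) = esizes es + 1"
| "esizes [] = 0"
| "esizes (e # es) = esize e + esizes es"

text \<open>A value of the wrong shape yields \<open>False\<close>, so an evaluation that gets stuck
  can never be verified.\<close>

fun on_num :: "val \<Rightarrow> (nat \<Rightarrow> bool) \<Rightarrow> bool" where
  "on_num (Num m) f = f m"
| "on_num (Cell _ _) f = False"

fun on_cell :: "val \<Rightarrow> (val \<Rightarrow> val \<Rightarrow> bool) \<Rightarrow> bool" where
  "on_cell (Num _) f = False"
| "on_cell (Cell x y) f = f x y"

fun is_cell :: "val \<Rightarrow> nat" where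
  "is_cell (Num _) = 0"
| "is_cell (Cell _ _) = 1"

lemma on_num_iff: "on_num x f \<longleftrightarrow> (\<exists>m. x = Num m \<and> f m)"
  by (cases x) auto

lemma on_cell_iff: "on_cell x f \<longleftrightarrow> (\<exists>y z. x = Cell y z \<and> f y z)"
  by (cases x) auto

text \<open>
  A body evaluates each of its nodes at most once, so it suffices to count calls: the running time
  is at most the number of calls times the maximal size \<open>S\<close> of a body.
\<close>

locale machine =
  fixes P :: prog and W S :: nat
  assumes esize_le: "f < length P \<Longrightarrow> esize (P ! f) < S"
    and W_pos: "1 \<le> W"
begin

definition ret :: "nat \<Rightarrow> val list \<Rightarrow> val \<Rightarrow> nat \<Rightarrow> bool" where
  "ret f vs v c \<longleftrightarrow> f < length P \<and> (\<exists>t. eval P W vs (P ! f) v t \<and> t < S * c)"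

definition call :: "nat \<Rightarrow> val list \<Rightarrow> (val \<Rightarrow> nat \<Rightarrow> bool) \<Rightarrow> bool" where
  "call f vs Q \<longleftrightarrow> (\<exists>v c. ret f vs v c \<and> Q v c)"

text \<open>A weakest precondition whose postcondition also receives a cost. Only calls contribute
  to the cost; the time of all other nodes is covered by \<open>esize\<close> of the body. On a
  concrete body the simplifier computes it completely, up to the \<open>call\<close> goals.\<close>

fun wp :: "val list \<Rightarrow> expr \<Rightarrow> (val \<Rightarrow> nat \<Rightarrow> bool) \<Rightarrow> bool"
  and wps :: "val list \<Rightarrow> expr list \<Rightarrow> (val list \<Rightarrow> nat \<Rightarrow> bool) \<Rightarrow> bool" where
  "wp \<rho> (Var i) Q \<longleftrightarrow> i < length \<rho> \<and> Q (\<rho> ! i) 0"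
| "wp \<rho> (Const k) Q \<longleftrightarrow> k \<le> W \<and> Q (Num k) 0"
| "wp \<rho> (Op f e1 e2) Q \<longleftrightarrow> wp \<rho> e1 (\<lambda>x c. wp \<rho> e2 (\<lambda>y d. on_num x (\<lambda>m. on_num y (\<lambda>n.
     binop_apply f m n \<le> W \<and> Q (Num (binop_apply f m n)) (c + d)))))"
| "wp \<rho> (Cons2 e1 e2) Q \<longleftrightarrow> wp \<rho> e1 (\<lambda>x c. wp \<rho> e2 (\<lambda>y d. Q (Cell x y) (c + d)))"
| "wp \<rho> (First e) Q \<longleftrightarrow> wp \<rho> e (\<lambda>x c. on_cell x (\<lambda>y z. Q y c))"
| "wp \<rho> (Second e) Q \<longleftrightarrow> wp \<rho> e (\<lambda>x c. on_cell x (\<lambda>y z. Q z c))"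
| "wp \<rho> (IsCell e) Q \<longleftrightarrow> wp \<rho> e (\<lambda>x c. Q (Num (is_cell x)) c)"
| "wp \<rho> (Cond e e1 e2) Q \<longleftrightarrow> wp \<rho> e (\<lambda>x c. on_num x (\<lambda>m.
     if m \<noteq> 0 then wp \<rho> e1 (\<lambda>v d. Q v (c + d)) else wp \<rho> e2 (\<lambda>v d. Q v (c + d))))"
| "wp \<rho> (Bind e1 e2) Q \<longleftrightarrow> wp \<rho> e1 (\<lambda>x c. wp (x # \<rho>) e2 (\<lambda>v d. Q v (c + d)))"
| "wp \<rho> (Call f es) Q \<longleftrightarrow> wps \<rho> es (\<lambda>vs c. call f vs (\<lambda>v d. Q v (c + d)))"
| "wps \<rho> [] Q \<longleftrightarrow> Q [] 0"
| "wps \<rho> (e # es) Q \<longleftrightarrow> wp \<rho> e (\<lambda>v c. wps \<rho> es (\<lambda>vs d. Q (v # vs) (c + d)))"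

lemma wp_sound:
  "wp \<rho> e Q \<Longrightarrow> \<exists>v c t. eval P W \<rho> e v t \<and> t \<le> esize e + S * c \<and> Q v c"
  "wps \<rho> es R \<Longrightarrow> \<exists>vs c t. evals P W \<rho> es vs t \<and> t \<le> esizes es + S * c \<and> R vs c"
proof (induction \<rho> e Q and \<rho> es R rule: wp_wps.induct)
  case (1 \<rho> i Q)
  then show ?case by (intro ex3I[of _ "\<rho> ! i" 0 1]) (auto intro: eval_intros)
next
  case (2 \<rho> k Q)
  then show ?case by (intro ex3I[of _ "Num k" 0 1]) (auto intro: eval_intros)
next
  case (3 \<rho> f e1 e2 Q)
  obtain x c t where 1: "eval P W \<rho> e1 x t" "t \<le> esize e1 + S * c"
    and "wp \<rho> e2 (\<lambda>y d. on_num x (\<lambda>m. on_num y (\<lambda>n.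
     binop_apply f m n \<le> W \<and> Q (Num (binop_apply f m n)) (c + d))))"
    using "3.IH"(2)[OF "3.prems"[unfolded wp.simps]] by blast
  from "3.IH"(1)[OF this(3)] obtain m n d u where "x = Num m" "eval P W \<rho> e2 (Num n) u" "u \<le> esize e2 + S * d"
    "binop_apply f m n \<le> W" "Q (Num (binop_apply f m n)) (c + d)" unfolding on_num_iff by blast
  with 1 show ?case
    by (intro ex3I[of _ "Num (binop_apply f m n)" "c + d" "t + u + 1"])
      (auto intro: eval_intros simp: distrib_left)
next
  case (4 \<rho> e1 e2 Q)
  obtain x c t where 1: "eval P W \<rho> e1 x t" "t \<le> esize e1 + S * c"
    and "wp \<rho> e2 (\<lambda>y d. Q (Cell x y) (c + d))"
    using "4.IH"(2)[OF "4.prems"[unfolded wp.simps wps.simps on_num_iff]] by blast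
  with "4.IH"(1) obtain y d u where "eval P W \<rho> e2 y u" "u \<le> esize e2 + S * d"
    "Q (Cell x y) (c + d)" by blast
  with 1 show ?case
    by (intro ex3I[of _ "Cell x y" "c + d" "t + u + 1"])
      (auto intro: eval_intros simp: distrib_left)
next
  case (5 \<rho> e Q)
  from "5.IH"[OF "5.prems"[unfolded wp.simps]] obtain y z c t where "eval P W \<rho> e (Cell y z) t" "t \<le> esize e + S * c" "Q y c" unfolding on_cell_iff by blast
  then show ?case
    by (intro ex3I[of _ y c "t + 1"]) (auto intro: eval_intros)
next
  case (6 \<rho> e Q)
  from "6.IH"[OF "6.prems"[unfolded wp.simps]] obtain y z c t where "eval P W \<rho> e (Cell y z) t" "t \<le> esize e + S * c" "Q z c" unfolding on_cell_iff by blast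
  then show ?case
    by (intro ex3I[of _ z c "t + 1"]) (auto intro: eval_intros)
next
  case (7 \<rho> e Q)
  then obtain x c t where *: "eval P W \<rho> e x t" "t \<le> esize e + S * c"
    "Q (Num (is_cell x)) c" by auto
  then have "eval P W \<rho> (IsCell e) (Num (is_cell x)) (t + 1)"
    using W_pos by (cases x) (auto intro: eval_intros)
  with * show ?case by fastforce
next
  case (8 \<rho> e e1 e2 Q)
  obtain m c t where 1: "eval P W \<rho> e (Num m) t" "t \<le> esize e + S * c"
    and 2: "if m \<noteq> 0 then wp \<rho> e1 (\<lambda>v d. Q v (c + d)) else wp \<rho> e2 (\<lambda>v d. Q v (c + d))"
    using "8.IH"(3)[OF "8.prems"[unfolded wp.simps]] unfolding on_num_iff by blast
  show ?case
  proof (cases "m = 0")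
    case True
    with 2 "8.IH"(2) obtain v d u where "eval P W \<rho> e2 v u" "u \<le> esize e2 + S * d" "Q v (c + d)"
      by fastforce
    with 1 True show ?thesis
      by (intro ex3I[of _ v "c + d" "t + u + 1"])
        (auto intro: eval_intros simp: distrib_left)
  next
    case False
    with 2 "8.IH"(1) obtain v d u where "eval P W \<rho> e1 v u" "u \<le> esize e1 + S * d" "Q v (c + d)"
      by fastforce
    with 1 False show ?thesis
      by (intro ex3I[of _ v "c + d" "t + u + 1"])
        (auto intro: eval_intros simp: distrib_left)
  qed
next
  case (9 \<rho> e1 e2 Q)
  obtain x c t where 1: "eval P W \<rho> e1 x t" "t \<le> esize e1 + S * c"
    and "wp (x # \<rho>) e2 (\<lambda>v d. Q v (c + d))"
    using "9.IH"(2)[OF "9.prems"[unfolded wp.simps wps.simps on_num_iff]] by blast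
  with "9.IH"(1) obtain v d u where "eval P W (x # \<rho>) e2 v u" "u \<le> esize e2 + S * d" "Q v (c + d)"
    by blast
  with 1 show ?case
    by (intro ex3I[of _ v "c + d" "t + u + 1"])
      (auto intro: eval_intros simp: distrib_left)
next
  case (10 \<rho> f es Q)
  obtain vs c t where 1: "evals P W \<rho> es vs t" "t \<le> esizes es + S * c"
    and "call f vs (\<lambda>v d. Q v (c + d))"
    using "10.IH"[OF "10.prems"[unfolded wp.simps wps.simps on_num_iff]] by blast
  then obtain v d u where "f < length P" "eval P W vs (P ! f) v u" "u < S * d" "Q v (c + d)"
    unfolding call_def ret_def by blast
  with 1 show ?case
    by (intro ex3I[of _ v "c + d" "t + u + 1"])
      (auto intro: eval_intros simp: distrib_left)
next
  case (11 \<rho> Q)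
  then show ?case by (intro ex3I[of _ "[]" 0 0]) (auto intro: eval_intros)
next
  case (12 \<rho> e es Q)
  obtain x c t where 1: "eval P W \<rho> e x t" "t \<le> esize e + S * c"
    and "wps \<rho> es (\<lambda>vs d. Q (x # vs) (c + d))"
    using "12.IH"(2)[OF "12.prems"[unfolded wp.simps wps.simps on_num_iff]] by blast
  with "12.IH"(1) obtain vs d u where "evals P W \<rho> es vs u" "u \<le> esizes es + S * d" "Q (x # vs) (c + d)"
    by blast
  with 1 show ?case
    by (intro ex3I[of _ "x # vs" "c + d" "t + u"])
      (auto intro: eval_intros simp: distrib_left)
qed

text \<open>The nodes of the body itself take less than \<open>S\<close> steps and the calls in it
  at most \<open>S * c'\<close>, hence together less than \<open>S * (c' + 1)\<close>. Every routine
  below is verified through this rule, with \<open>callI\<close> for its calls.\<close>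

lemma retI:
  assumes "f < length P" and "wp vs (P ! f) (\<lambda>v' c'. v' = v \<and> c' < c)"
  shows "ret f vs v c"
proof -
  obtain c' t where t: "eval P W vs (P ! f) v t" "t \<le> esize (P ! f) + S * c'" "c' < c"
    using wp_sound(1)[OF assms(2)] by auto
  have "t < S * Suc c'"
    using t(2) esize_le[OF assms(1)] by simp
  also have "\<dots> \<le> S * c"
    using t(3) by (intro mult_le_mono2) simp
  finally show ?thesis
    using assms(1) t(1) unfolding ret_def by blast
qed

lemma callI: "ret f vs v c \<Longrightarrow> Q v c \<Longrightarrow> call f vs Q"
  unfolding call_def by blast

lemma ret_mono: "ret f vs v c \<Longrightarrow> c \<le> d \<Longrightarrow> ret f vs v d"
  unfolding ret_def using mult_le_mono2 order_less_le_trans by blast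

lemma W_ge [simp]: "0 < W" "Suc 0 \<le> W"
  using W_pos by auto

end

section \<open>Association lists and elementary list routines\<close>

definition enc_assoc :: "('b \<Rightarrow> val) \<Rightarrow> (nat \<times> 'b) list \<Rightarrow> val" where
  "enc_assoc g = enc_list (\<lambda>(k, y). Cell (Num k) (g y))"

lemma enc_assoc_simps [simp]:
  "enc_assoc g [] = Num 0"
  "enc_assoc g ((k, y) # al) = Cell (Cell (Num k) (g y)) (enc_assoc g al)"
  by (simp_all add: enc_assoc_def)

text \<open>The default \<open>Num 0\<close> encodes both the number 0 and the empty list, so a
  missing key reads as label 0 or as an empty domain.\<close>

definition lookup :: "('b \<Rightarrow> val) \<Rightarrow> (nat \<times> 'b) list \<Rightarrow> nat \<Rightarrow> val" where
  "lookup g al k = (case map_of al k of None \<Rightarrow> Num 0 | Some y \<Rightarrow> g y)"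

lemma lookup_simps [simp]:
  "lookup g [] k = Num 0"
  "lookup g ((j, y) # al) k = (if j = k then g y else lookup g al k)"
  by (simp_all add: lookup_def)

fun look :: "(nat \<times> nat) list \<Rightarrow> nat \<Rightarrow> nat" where
  "look [] k = 0"
| "look ((j, y) # al) k = (if j = k then y else look al k)"

lemma lookup_Num [simp]: "lookup Num al k = Num (look al k)"
  by (induction al k rule: look.induct) auto

lemma look_Cons_fun: "look ((j, y) # al) = (look al)(j := y)"
  by (auto simp: fun_eq_iff)

lemma look_map_of: "map_of al k = Some y \<Longrightarrow> look al k = y"
  by (induction al k rule: look.induct) (auto split: if_splits)

abbreviation "F_look \<equiv> 2 :: nat"
abbreviation "F_mem \<equiv> 3 :: nat"
abbreviation "F_append \<equiv> 4 :: nat"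

definition "body_look = Cond (IsCell (Var 0))
   (Cond (Op Equal (First (First (Var 0))) (Var 1)) (Second (First (Var 0)))
     (Call F_look [Second (Var 0), Var 1]))
   (Const 0)"

definition "body_mem = Cond (IsCell (Var 0))
   (Cond (Op Equal (First (Var 0)) (Var 1)) (Const 1) (Call F_mem [Second (Var 0), Var 1]))
   (Const 0)"

definition "body_append = Cond (IsCell (Var 0))
   (Cons2 (First (Var 0)) (Call F_append [Second (Var 0), Var 1])) (Var 1)"

text \<open>Such locales fix only the positions of the bodies, so no lemma depends on the rest of
  the program; the concrete list of bodies is supplied at the end.\<close>

locale prog_lists = machine +
  assumes length_lists: "4 < length P"
    and body_lists: "P ! F_look = body_look" "P ! F_mem = body_mem" "P ! F_append = body_append"
begin

lemma ret_look: "ret F_look [enc_assoc g al, Num k] (lookup g al k) (length al + 1)"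
proof (induction al)
  case Nil
  show ?case
    by (rule retI) (use length_lists in \<open>simp_all add: body_lists body_look_def\<close>)
next
  case (Cons a al)
  show ?case
    by (rule retI, use length_lists in \<open>simp\<close>, cases a)
      (auto simp: body_lists body_look_def intro!: callI[OF Cons.IH])
qed

lemma ret_mem: "ret F_mem [enc_list Num xs, Num k] (Num (of_bool (k \<in> set xs))) (length xs + 1)"
proof (induction xs)
  case Nil
  show ?case
    by (rule retI) (use length_lists in \<open>simp_all add: body_lists body_mem_def\<close>)
next
  case (Cons a xs)
  show ?case
    by (rule retI, use length_lists in \<open>simp\<close>)
      (auto simp: body_lists body_mem_def intro!: callI[OF Cons.IH])
qed

lemma ret_append: "ret F_append [enc_list g xs, enc_list g ys] (enc_list g (xs @ ys)) (length xs + 1)"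
proof (induction xs)
  case Nil
  show ?case
    by (rule retI) (use length_lists in \<open>simp_all add: body_lists body_append_def\<close>)
next
  case (Cons a xs)
  show ?case
    by (rule retI, use length_lists in \<open>simp\<close>)
      (auto simp: body_lists body_append_def intro!: callI[OF Cons.IH])
qed

end

section \<open>Dynamic programming over nice tree decompositions\<close>

fun forg :: "ntd \<Rightarrow> nat set" where
  "forg (Leaf xs) = {}"
| "forg (Introduce v T) = forg T"
| "forg (Forget v T) = insert v (forg T)"
| "forg (Join S T) = forg S \<union> forg T"

text \<open>This replaces the connectedness condition by what the recursion uses: a forgotten vertex
  is not introduced again further up, and the two sides of a join forget different vertices.\<close>

fun good :: "ntd \<Rightarrow> bool" where
  "good (Leaf xs) \<longleftrightarrow> distinct xs"
| "good (Introduce v T) \<longleftrightarrow> good T \<and> v \<notin> root_bag T \<and> v \<notin> forg T"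
| "good (Forget v T) \<longleftrightarrow> good T \<and> v \<in> root_bag T"
| "good (Join S T) \<longleftrightarrow> good S \<and> good T \<and> root_bag S = root_bag T \<and> forg S \<inter> forg T = {}"

fun bags :: "ntd \<Rightarrow> nat set set" where
  "bags (Leaf xs) = {set xs}"
| "bags (Introduce v T) = insert (insert v (root_bag T)) (bags T)"
| "bags (Forget v T) = insert (root_bag T - {v}) (bags T)"
| "bags (Join S T) = bags S \<union> bags T"

fun fbags :: "ntd \<Rightarrow> nat set set" where
  "fbags (Leaf xs) = {}"
| "fbags (Introduce v T) = fbags T"
| "fbags (Forget v T) = insert (root_bag T) (fbags T)"
| "fbags (Join S T) = fbags S \<union> fbags T"

fun nsize :: "ntd \<Rightarrow> nat" where
  "nsize (Leaf xs) = 1"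
| "nsize (Introduce v T) = nsize T + 1"
| "nsize (Forget v T) = nsize T + 1"
| "nsize (Join S T) = nsize S + nsize T + 1"

lemma finite_root_bag [simp]: "finite (root_bag T)"
  by (induction T) auto

lemma finite_forg [simp]: "finite (forg T)"
  by (induction T) auto

lemma nsize_pos [simp]: "0 < nsize T" "Suc 0 \<le> nsize T"
  by (cases T; simp)+

lemma root_bag_in_bags: "root_bag T \<in> bags T"
  by (induction T) auto

lemma good_disjoint: "good T \<Longrightarrow> root_bag T \<inter> forg T = {}"
  by (induction T) auto

lemma bags_subset: "good T \<Longrightarrow> X \<in> bags T \<Longrightarrow> X \<subseteq> root_bag T \<union> forg T"
  by (induction T) auto

lemma fbags_subset: "good T \<Longrightarrow> X \<in> fbags T \<Longrightarrow> X \<subseteq> root_bag T \<union> forg T"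
  by (induction T) auto

text \<open>On the way to the root a bag loses vertices only at forget nodes, so it is contained in
  the bag below the first forget node that removes something from it. Testing the edges below forget
  nodes therefore reaches every edge.\<close>

lemma bags_fbags: "X \<in> bags T \<Longrightarrow> good T \<Longrightarrow> X \<subseteq> root_bag T \<or> (\<exists>Y\<in>fbags T. X \<subseteq> Y)"
  by (induction T) auto

type_synonym entry = "(nat \<times> (nat \<times> nat) list) option"

text \<open>Entries with first weight 0 are edges of a cut problem: their end points must not be on the
  sides 0 and 1.\<close>

definition edge_ok :: "nat \<Rightarrow> nat \<Rightarrow> nat \<Rightarrow> nat \<Rightarrow> bool" where
  "edge_ok a b x y \<longleftrightarrow> (if a = 0 then x + y \<noteq> 1 else a \<le> x \<or> b \<le> y)"

definition check :: "edge_entry list \<Rightarrow> nat set \<Rightarrow> (nat \<Rightarrow> nat) \<Rightarrow> bool" where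
  "check es X p \<longleftrightarrow> (\<forall>(u, v, a, b) \<in> set es. u \<in> X \<longrightarrow> v \<in> X \<longrightarrow> edge_ok a b (p u) (p v))"

fun join_entry :: "entry \<Rightarrow> entry \<Rightarrow> entry" where
  "join_entry (Some (c, s)) (Some (d, t)) = Some (c + d, s @ t)"
| "join_entry _ _ = None"

fun add_entry :: "nat \<Rightarrow> nat \<Rightarrow> entry \<Rightarrow> entry" where
  "add_entry x v (Some (c, s)) = Some (x + c, (v, x) # s)"
| "add_entry x v None = None"

fun min_entry :: "entry \<Rightarrow> entry \<Rightarrow> entry" where
  "min_entry None e = e"
| "min_entry e None = e"
| "min_entry (Some e) (Some f) = Some (if fst f < fst e then f else e)"

fun best :: "(nat \<Rightarrow> entry) \<Rightarrow> nat list \<Rightarrow> entry" where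
  "best f [] = None"
| "best f (x # xs) = min_entry (f x) (best f xs)"

text \<open>Only forgotten vertices are paid for. The costs of the two sides of a join hence add up
  without a correction for the common bag, and introduce nodes change nothing.\<close>

fun ent :: "edge_entry list \<Rightarrow> (nat \<Rightarrow> nat list) \<Rightarrow> ntd \<Rightarrow> (nat \<Rightarrow> nat) \<Rightarrow> entry" where
  "ent es D (Leaf xs) p = Some (0, [])"
| "ent es D (Introduce v T) p = ent es D T p"
| "ent es D (Forget v T) p = best (\<lambda>x. if check es (root_bag T) (p(v := x))
     then add_entry x v (ent es D T (p(v := x))) else None) (D v)"
| "ent es D (Join S T) p = join_entry (ent es D S p) (ent es D T p)"

lemma check_cong: "(\<And>v. v \<in> X \<Longrightarrow> p v = q v) \<Longrightarrow> check es X p \<longleftrightarrow> check es X q"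
  by (force simp: check_def)

lemma best_SomeD: "best f xs = Some e \<Longrightarrow> \<exists>x\<in>set xs. f x = Some e"
proof (induction xs)
  case (Cons x xs)
  then show ?case
    by (cases "f x"; cases "best f xs") (auto split: if_splits)
qed simp

lemma best_le: "x \<in> set xs \<Longrightarrow> f x = Some (c, s) \<Longrightarrow> \<exists>c' s'. best f xs = Some (c', s') \<and> c' \<le> c"
proof (induction xs)
  case (Cons y xs)
  show ?case
  proof (cases "x = y")
    case True
    then show ?thesis
      using Cons.prems by (cases "best f xs") auto
  next
    case False
    then obtain c' s' where "best f xs = Some (c', s')" "c' \<le> c"
      using Cons by auto
    then show ?thesis
      by (cases "f y") auto
  qed
qed simp

lemma ent_cong:
  "good T \<Longrightarrow> (\<And>v. v \<in> root_bag T \<Longrightarrow> p v = q v) \<Longrightarrow> ent es D T p = ent es D T q"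
proof (induction T arbitrary: p q)
  case (Forget v T)
  have "check es (root_bag T) (p(v := x)) = check es (root_bag T) (q(v := x))" for x
    using Forget.prems by (intro check_cong) auto
  moreover have "ent es D T (p(v := x)) = ent es D T (q(v := x))" for x
    using Forget.prems by (intro Forget.IH) auto
  ultimately have "(\<lambda>x. if check es (root_bag T) (p(v := x)) then add_entry x v (ent es D T (p(v := x))) else None) =
    (\<lambda>x. if check es (root_bag T) (q(v := x)) then add_entry x v (ent es D T (q(v := x))) else None)"
    by metis
  then show ?case
    unfolding ent.simps by (rule arg_cong[where f = "\<lambda>h. best h (D v)"])
next
  case (Introduce v T)
  show ?case
    using Introduce.prems by (auto intro!: Introduce.IH)
next
  case (Join S T)
  have "ent es D S p = ent es D S q" "ent es D T p = ent es D T q"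
    using Join.prems by (auto intro!: Join.IH)
  then show ?case
    by simp
qed simp

text \<open>The assignment \<open>q\<close> extends \<open>p\<close> to the forgotten vertices. It
  is followed along with the stored list \<open>s\<close>, from which the program reads off the
  solution in the end.\<close>

lemma ent_sound:
  "good T \<Longrightarrow> ent es D T p = Some (c, s) \<Longrightarrow>
   \<exists>q. (\<forall>v. v \<notin> forg T \<longrightarrow> q v = p v) \<and> (\<forall>v\<in>forg T. q v \<in> set (D v)) \<and>
       map_of s = (\<lambda>v. if v \<in> forg T then Some (q v) else None) \<and> length s = card (forg T) \<and>
       c = (\<Sum>v\<in>forg T. q v) \<and> (\<forall>X\<in>fbags T. check es X q)"
proof (induction T arbitrary: p c s)
  case (Leaf xs)
  then show ?case by (intro exI[of _ p]) auto
next
  case (Introduce v T)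
  then show ?case by simp
next
  case (Forget v T)
  from best_SomeD[OF Forget.prems(2)[unfolded ent.simps]]
  obtain x where x: "x \<in> set (D v)" "check es (root_bag T) (p(v := x))"
    "add_entry x v (ent es D T (p(v := x))) = Some (c, s)"
    by (auto split: if_splits)
  then obtain c' s' where e: "ent es D T (p(v := x)) = Some (c', s')" "c = x + c'" "s = (v, x) # s'"
    by (cases "ent es D T (p(v := x))") auto
  from Forget.IH[OF _ e(1)] Forget.prems(1)
  obtain q where q: "\<forall>u. u \<notin> forg T \<longrightarrow> q u = (p(v := x)) u" "\<forall>u\<in>forg T. q u \<in> set (D u)"
    "map_of s' = (\<lambda>v. if v \<in> forg T then Some (q v) else None)" "length s' = card (forg T)"
    "c' = (\<Sum>v\<in>forg T. q v)" "\<forall>X\<in>fbags T. check es X q"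
    by auto
  have v: "v \<notin> forg T"
    using Forget.prems(1) good_disjoint[of T] by auto
  then have qv: "q v = x"
    using q(1) by simp
  have "check es (root_bag T) q = check es (root_bag T) (p(v := x))"
    using q(1) Forget.prems(1) good_disjoint[of T] by (intro check_cong) auto
  then show ?case
    using q x(1,2) e(2,3) v qv by (intro exI[of _ q]) (auto simp: fun_eq_iff)
next
  case (Join S T)
  from Join.prems(2) obtain c1 s1 c2 s2 where e: "ent es D S p = Some (c1, s1)"
    "ent es D T p = Some (c2, s2)" "c = c1 + c2" "s = s1 @ s2"
    by (cases "ent es D S p"; cases "ent es D T p") auto
  from Join.IH(1)[OF _ e(1)] Join.prems(1)
  obtain q where q: "\<forall>u. u \<notin> forg S \<longrightarrow> q u = p u" "\<forall>u\<in>forg S. q u \<in> set (D u)"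
    "map_of s1 = (\<lambda>v. if v \<in> forg S then Some (q v) else None)" "length s1 = card (forg S)"
    "c1 = (\<Sum>v\<in>forg S. q v)" "\<forall>X\<in>fbags S. check es X q"
    by auto
  from Join.IH(2)[OF _ e(2)] Join.prems(1)
  obtain r where r: "\<forall>u. u \<notin> forg T \<longrightarrow> r u = p u" "\<forall>u\<in>forg T. r u \<in> set (D u)"
    "map_of s2 = (\<lambda>v. if v \<in> forg T then Some (r v) else None)" "length s2 = card (forg T)"
    "c2 = (\<Sum>v\<in>forg T. r v)" "\<forall>X\<in>fbags T. check es X r"
    by auto
  \<comment> \<open>The two extensions agree on the bag, where both equal \<open>p\<close>, and
    forget disjoint sets, so they can be glued.\<close>
  define z where "z = (\<lambda>v. if v \<in> forg S then q v else r v)"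
  have dj: "forg S \<inter> forg T = {}" "root_bag S = root_bag T" "root_bag S \<inter> forg S = {}"
    "root_bag T \<inter> forg T = {}"
    using Join.prems(1) good_disjoint by auto
  have "check es X z = check es X q" if "X \<in> fbags S" for X
    using fbags_subset[OF _ that] Join.prems(1) dj q(1) r(1)
    by (intro check_cong) (force simp: z_def)
  moreover have "check es X z = check es X r" if "X \<in> fbags T" for X
    using fbags_subset[OF _ that] Join.prems(1) dj q(1) r(1)
    by (intro check_cong) (force simp: z_def)
  moreover have "(\<Sum>v\<in>forg S \<union> forg T. z v) = c1 + c2"
  proof -
    have "(\<Sum>v\<in>forg S \<union> forg T. z v) = (\<Sum>v\<in>forg S. z v) + (\<Sum>v\<in>forg T. z v)"
      using dj by (intro sum.union_disjoint) auto
    also have "(\<Sum>v\<in>forg S. z v) = (\<Sum>v\<in>forg S. q v)"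
      by (intro sum.cong) (auto simp: z_def)
    also have "(\<Sum>v\<in>forg T. z v) = (\<Sum>v\<in>forg T. r v)"
      using dj by (intro sum.cong) (auto simp: z_def)
    finally show ?thesis
      using q r by simp
  qed
  moreover have "map_of s = (\<lambda>v. if v \<in> forg S \<union> forg T then Some (z v) else None)"
    using e(4) q(3) r(3) dj by (auto simp: fun_eq_iff z_def map_add_def)
  ultimately show ?case
    using q r e dj by (intro exI[of _ z]) (auto simp: z_def card_Un_disjoint)
qed

text \<open>The assignment \<open>q\<close> serves as its own bag assignment: at a forget node the
  candidate \<open>q v\<close> leaves \<open>q\<close> unchanged, and the minimum is no larger than
  what this candidate gives.\<close>

lemma ent_opt:
  "good T \<Longrightarrow> \<forall>v\<in>forg T. q v \<in> set (D v) \<Longrightarrow> \<forall>X\<in>fbags T. check es X q \<Longrightarrow>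
   \<exists>c s. ent es D T q = Some (c, s) \<and> c \<le> (\<Sum>v\<in>forg T. q v)"
proof (induction T)
  case (Forget v T)
  then obtain c s where "ent es D T q = Some (c, s)" "c \<le> (\<Sum>v\<in>forg T. q v)"
    by auto
  moreover have "v \<notin> forg T"
    using Forget.prems(1) good_disjoint[of T] by auto
  ultimately show ?case
    using best_le[of "q v" "D v" "\<lambda>x. if check es (root_bag T) (q(v := x))
     then add_entry x v (ent es D T (q(v := x))) else None" "q v + c" "(v, q v) # s"] Forget.prems
    by fastforce
next
  case (Join S T)
  then obtain c s c' s' where "ent es D S q = Some (c, s)" "c \<le> (\<Sum>v\<in>forg S. q v)"
    "ent es D T q = Some (c', s')" "c' \<le> (\<Sum>v\<in>forg T. q v)"
    by auto
  moreover have "(\<Sum>v\<in>forg S \<union> forg T. q v) = (\<Sum>v\<in>forg S. q v) + (\<Sum>v\<in>forg T. q v)"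
    using Join.prems(1) by (intro sum.union_disjoint) auto
  ultimately show ?case
    by auto
qed auto

text \<open>The first bound keeps all costs within the word length, the second bounds the time for
  appending solutions at joins.\<close>

lemma ent_bound:
  assumes "good T" "ent es D T p = Some (c, s)" "\<And>v x. v \<in> forg T \<Longrightarrow> x \<in> set (D v) \<Longrightarrow> x \<le> M"
  shows "c \<le> card (forg T) * M" "length s = card (forg T)"
proof -
  obtain q where q: "\<forall>v\<in>forg T. q v \<in> set (D v)" "c = (\<Sum>v\<in>forg T. q v)" "length s = card (forg T)"
    using ent_sound[OF assms(1,2)] by auto
  have "(\<Sum>v\<in>forg T. q v) \<le> (\<Sum>v\<in>forg T. M)"
    using q(1) assms(3) by (intro sum_mono) auto
  then show "c \<le> card (forg T) * M" "length s = card (forg T)"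
    using q by auto
qed

fun enc_entry :: "entry \<Rightarrow> val" where
  "enc_entry None = Num 0"
| "enc_entry (Some (c, s)) = Cell (Num c) (enc_assoc Num s)"

definition doms :: "(nat \<times> nat list) list \<Rightarrow> nat \<Rightarrow> nat list" where
  "doms Dl v = (case map_of Dl v of None \<Rightarrow> [] | Some xs \<Rightarrow> xs)"

lemma lookup_doms: "lookup (enc_list Num) Dl v = enc_list Num (doms Dl v)"
  by (simp add: lookup_def doms_def split: option.split)

fun bag_list :: "ntd \<Rightarrow> nat list" where
  "bag_list (Leaf xs) = xs"
| "bag_list (Introduce v T) = v # bag_list T"
| "bag_list (Forget v T) = removeAll v (bag_list T)"
| "bag_list (Join S T) = bag_list S"

lemma set_bag_list: "set (bag_list T) = root_bag T"
  by (induction T) auto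

lemma distinct_bag_list: "good T \<Longrightarrow> distinct (bag_list T)"
  by (induction T) (auto simp: set_bag_list distinct_removeAll)

lemma length_bag_list: "good T \<Longrightarrow> length (bag_list T) = card (root_bag T)"
  using distinct_card[OF distinct_bag_list] by (simp add: set_bag_list)

section \<open>The program for the tables\<close>

abbreviation "F_check \<equiv> 5 :: nat"
abbreviation "F_ok \<equiv> 6 :: nat"
abbreviation "F_walk \<equiv> 7 :: nat"
abbreviation "F_ent \<equiv> 8 :: nat"
abbreviation "F_join \<equiv> 9 :: nat"
abbreviation "F_best \<equiv> 10 :: nat"
abbreviation "F_cand \<equiv> 11 :: nat"
abbreviation "F_add \<equiv> 12 :: nat"
abbreviation "F_min \<equiv> 13 :: nat"
abbreviation "F_tab \<equiv> 14 :: nat"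
abbreviation "F_rows \<equiv> 15 :: nat"
abbreviation "F_remove \<equiv> 16 :: nat"
abbreviation "F_bag \<equiv> 17 :: nat"
abbreviation "F_comp \<equiv> 18 :: nat"

abbreviation "e_u e \<equiv> First e"
abbreviation "e_v e \<equiv> First (Second e)"
abbreviation "e_a e \<equiv> First (Second (Second e))"
abbreviation "e_b e \<equiv> Second (Second (Second e))"

text \<open>In all bodies \<open>Var i\<close> is the argument number i, counted from 0 and shifted
  by one inside each \<open>Bind\<close>. The arguments here are the edge list, the bag and the
  assignment.\<close>

definition "body_check = Cond (IsCell (Var 0))
  (Cond
    (Cond (Call F_mem [Var 1, e_u (First (Var 0))])
      (Cond (Call F_mem [Var 1, e_v (First (Var 0))])
        (Call F_ok [e_a (First (Var 0)), e_b (First (Var 0)),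
          Call F_look [Var 2, e_u (First (Var 0))], Call F_look [Var 2, e_v (First (Var 0))]])
        (Const 1))
      (Const 1))
    (Call F_check [Second (Var 0), Var 1, Var 2])
    (Const 0))
  (Const 1)"

definition "body_ok = Cond (Var 0)
  (Cond (Op Less (Var 2) (Var 0)) (Cond (Op Less (Var 3) (Var 1)) (Const 0) (Const 1)) (Const 1))
  (Cond (Op Equal (Op Plus (Var 2) (Var 3)) (Const 1)) (Const 0) (Const 1))"

definition "body_walk = Cond (IsCell (Var 1))
  (Call F_walk [Call F_look [Var 0, Call F_look [Var 2, First (Var 1)]], Second (Var 1), Var 2])
  (Var 0)"

text \<open>The table of a tree is \<open>Num 0\<close> for a leaf, the pair of the two tables with tag 0 for a join,
  and the list of bag vertices and a trie with tag 1 for a forget node.\<close>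

definition "body_ent = Cond (IsCell (Var 0))
  (Cond (First (Var 0))
    (Call F_walk [Second (Second (Var 0)), First (Second (Var 0)), Var 1])
    (Call F_join [Call F_ent [First (Second (Var 0)), Var 1],
      Call F_ent [Second (Second (Var 0)), Var 1]]))
  (Cons2 (Const 0) (Const 0))"

definition "body_join = Cond (IsCell (Var 0))
  (Cond (IsCell (Var 1))
    (Cons2 (Op Plus (First (Var 0)) (First (Var 1)))
      (Call F_append [Second (Var 0), Second (Var 1)]))
    (Const 0))
  (Const 0)"

definition "body_best = Cond (IsCell (Var 0))
  (Call F_min [Call F_cand [First (Var 0), Var 1, Var 2, Var 3, Var 4,
      Cons2 (Cons2 (Var 1) (First (Var 0))) (Var 5)],
    Call F_best [Second (Var 0), Var 1, Var 2, Var 3, Var 4, Var 5]])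
  (Const 0)"

definition "body_cand = Cond (Call F_check [Var 3, Var 4, Var 5])
  (Call F_add [Var 0, Var 1, Call F_ent [Var 2, Var 5]]) (Const 0)"

definition "body_add = Cond (IsCell (Var 2))
  (Cons2 (Op Plus (Var 0) (First (Var 2))) (Cons2 (Cons2 (Var 1) (Var 0)) (Second (Var 2))))
  (Const 0)"

definition "body_min = Cond (IsCell (Var 0))
  (Cond (IsCell (Var 1))
    (Cond (Op Less (First (Var 1)) (First (Var 0))) (Var 1) (Var 0)) (Var 0))
  (Var 1)"

definition "body_tab = Cond (IsCell (Var 0))
  (Call F_rows [Call F_look [Var 6, First (Var 0)], First (Var 0), Second (Var 0), Var 1,
    Var 2, Var 3, Var 4, Var 5, Var 6])
  (Call F_best [Call F_look [Var 6, Var 2], Var 2, Var 3, Var 4, Var 5, Var 1])"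

definition "body_rows = Cond (IsCell (Var 0))
  (Cons2 (Cons2 (First (Var 0)) (Call F_tab [Var 2, Cons2 (Cons2 (Var 1) (First (Var 0))) (Var 3),
      Var 4, Var 5, Var 6, Var 7, Var 8]))
    (Call F_rows [Second (Var 0), Var 1, Var 2, Var 3, Var 4, Var 5, Var 6, Var 7, Var 8]))
  (Const 0)"

definition "body_remove = Cond (IsCell (Var 0))
  (Cond (Op Equal (First (Var 0)) (Var 1))
    (Call F_remove [Second (Var 0), Var 1])
    (Cons2 (First (Var 0)) (Call F_remove [Second (Var 0), Var 1])))
  (Const 0)"

text \<open>The tags 0 to 3 of \<open>enc_ntd\<close> are told apart by truncated subtraction and
  tests for zero.\<close>

definition "tag_cases x l i f j =
  Cond (First x) (Cond (Op Minus (First x) (Const 1)) (Cond (Op Minus (First x) (Const 2)) j f) i) l"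

definition "body_bag = tag_cases (Var 0)
  (Second (Var 0))
  (Cons2 (First (Second (Var 0))) (Call F_bag [Second (Second (Var 0))]))
  (Call F_remove [Call F_bag [Second (Second (Var 0))], First (Second (Var 0))])
  (Call F_bag [First (Second (Var 0))])"

text \<open>An introduce node passes on the table below it, and a join keeps both tables side by
  side. A table of a join would be indexed by a full bag and cost one more factor in the number of
  values; instead \<open>F_ent\<close> combines the two answers on demand.\<close>

definition "body_comp = tag_cases (Var 0)
  (Const 0)
  (Call F_comp [Second (Second (Var 0)), Var 1, Var 2])
  (Bind (Call F_remove [Call F_bag [Second (Second (Var 0))], First (Second (Var 0))])
    (Cons2 (Const 1) (Cons2 (Var 0) (Call F_tab [Var 0, Const 0, First (Second (Var 1)),
      Call F_comp [Second (Second (Var 1)), Var 2, Var 3], Var 2,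
      Cons2 (First (Second (Var 1))) (Var 0), Var 3]))))
  (Cons2 (Const 0) (Cons2 (Call F_comp [First (Second (Var 0)), Var 1, Var 2])
    (Call F_comp [Second (Second (Var 0)), Var 1, Var 2])))"

locale prog_dp = prog_lists +
  assumes length_dp: "18 < length P"
    and body_dp: "P ! F_check = body_check" "P ! F_ok = body_ok" "P ! F_walk = body_walk"
      "P ! F_ent = body_ent" "P ! F_join = body_join" "P ! F_best = body_best"
      "P ! F_cand = body_cand" "P ! F_add = body_add" "P ! F_min = body_min"
      "P ! F_tab = body_tab" "P ! F_rows = body_rows" "P ! F_remove = body_remove"
      "P ! F_bag = body_bag" "P ! F_comp = body_comp"
    and W_ge_3: "3 \<le> W"
begin

lemma index_dp [simp]: "k \<le> 18 \<Longrightarrow> k < length P"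
  using length_dp by simp

lemma const_le_W [simp]: "2 \<le> W" "3 \<le> W" "Suc (Suc 0) \<le> W"
  using W_ge_3 by auto

lemma ret_append_assoc:
  "ret F_append [enc_assoc g xs, enc_assoc g ys] (enc_assoc g (xs @ ys)) (length xs + 1)"
  unfolding enc_assoc_def by (rule ret_append)

lemma ret_ok:
  "x + y \<le> W \<Longrightarrow> ret F_ok [Num a, Num b, Num x, Num y] (Num (of_bool (edge_ok a b x y))) 1"
  by (rule retI) (simp, auto simp: body_dp body_ok_def edge_ok_def)

lemma ret_check:
  assumes "length X \<le> N" "length \<sigma> \<le> N" "\<And>u v. u \<in> set X \<Longrightarrow> v \<in> set X \<Longrightarrow> look \<sigma> u + look \<sigma> v \<le> W"
  shows "ret F_check [enc_list enc_edge es, enc_list Num X, enc_assoc Num \<sigma>]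
    (Num (of_bool (check es (set X) (look \<sigma>)))) (length es * (4 * N + 6) + 1)"
proof (induction es)
  case Nil
  show ?case
    by (rule retI) (simp_all add: body_dp body_check_def check_def)
next
  case (Cons e es)
  obtain u v a b where e: "e = (u, v, a, b)"
    by (cases e)
  have check: "check (e # es) (set X) (look \<sigma>) \<longleftrightarrow>
    (u \<in> set X \<longrightarrow> v \<in> set X \<longrightarrow> edge_ok a b (look \<sigma> u) (look \<sigma> v)) \<and> check es (set X) (look \<sigma>)"
    by (auto simp: check_def e)
  show ?case
    using assms unfolding check
    by (cases "u \<in> set X"; cases "v \<in> set X"; cases "edge_ok a b (look \<sigma> u) (look \<sigma> v)"; intro retI, simp)
      (auto simp: body_dp body_check_def e
        intro!: callI[OF ret_mem] callI[OF ret_look] callI[OF ret_ok] callI[OF Cons.IH])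
qed

lemma ret_add:
  "(\<And>c s. e = Some (c, s) \<Longrightarrow> x + c \<le> W) \<Longrightarrow>
   ret F_add [Num x, Num v, enc_entry e] (enc_entry (add_entry x v e)) 1"
  by (rule retI, simp, cases e) (auto simp: body_dp body_add_def)

lemma ret_min: "ret F_min [enc_entry e, enc_entry f] (enc_entry (min_entry e f)) 1"
  by (rule retI, simp, cases e; cases f) (auto simp: body_dp body_min_def)

lemma ret_join:
  "(\<And>c s d t. e = Some (c, s) \<Longrightarrow> f = Some (d, t) \<Longrightarrow> c + d \<le> W) \<Longrightarrow>
   (\<And>c s. e = Some (c, s) \<Longrightarrow> length s \<le> N) \<Longrightarrow>
   ret F_join [enc_entry e, enc_entry f] (enc_entry (join_entry e f)) (N + 2)"
  by (rule retI, simp, cases e; cases f)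
    (auto simp: body_dp body_join_def intro!: callI[OF ret_append_assoc])

lemma ret_remove: "ret F_remove [enc_list Num xs, Num v] (enc_list Num (removeAll v xs)) (length xs + 1)"
proof (induction xs)
  case Nil
  show ?case
    by (rule retI) (simp_all add: body_dp body_remove_def)
next
  case (Cons x xs)
  show ?case
    by (rule retI, simp) (auto simp: body_dp body_remove_def intro!: callI[OF Cons.IH])
qed

lemma length_bag_list_le: "good T \<Longrightarrow> root_bag T \<union> forg T \<subseteq> {..<N} \<Longrightarrow> length (bag_list T) \<le> N"
  using card_mono[of "{..<N}" "root_bag T"] by (simp add: length_bag_list)

lemma ret_bag:
  "good T \<Longrightarrow> root_bag T \<union> forg T \<subseteq> {..<N} \<Longrightarrow>
   ret F_bag [enc_ntd T] (enc_list Num (bag_list T)) (nsize T * (N + 2))"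
proof (induction T)
  case (Leaf xs)
  show ?case
    by (rule retI) (simp_all add: body_dp body_bag_def tag_cases_def)
next
  case (Introduce v T)
  then show ?case
    by (intro retI, simp)
      (auto simp: body_dp body_bag_def tag_cases_def intro!: callI[OF Introduce.IH])
next
  case (Forget v T)
  then have "root_bag T \<union> forg T \<subseteq> {..<N}"
    by auto
  with Forget show ?case
    using length_bag_list_le[of T N]
    by (intro retI, simp)
      (auto simp: body_dp body_bag_def tag_cases_def intro!: callI[OF Forget.IH] callI[OF ret_remove])
next
  case (Join S T)
  then show ?case
    by (intro retI, simp)
      (auto simp: body_dp body_bag_def tag_cases_def algebra_simps intro!: callI[OF Join.IH(1)])
qed

end

section \<open>Cost functions and correctness of the tables\<close>

definition check_cost :: "nat \<Rightarrow> nat" where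
  "check_cost N = N * (4 * N + 6) + 1"

definition ent_cost :: "nat \<Rightarrow> nat \<Rightarrow> nat" where
  "ent_cost N \<Delta> = N * (\<Delta> + N + 3) + N + 3"

definition cand_cost :: "nat \<Rightarrow> nat \<Rightarrow> nat" where
  "cand_cost N \<Delta> = check_cost N + N * ent_cost N \<Delta> + 5"

definition leaf_cost :: "nat \<Rightarrow> nat \<Rightarrow> nat" where
  "leaf_cost N \<Delta> = \<Delta> * cand_cost N \<Delta> + 1 + N + 4"

text \<open>A bag below a forget node has at most \<open>w\<close> vertices. All but the forgotten
  one are keys of the trie, which explains the exponent; the candidates for the forgotten one
  contribute the factor \<open>\<Delta>\<close> inside \<open>leaf_cost\<close>.\<close>

definition node_cost :: "nat \<Rightarrow> nat \<Rightarrow> nat \<Rightarrow> nat" where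
  "node_cost N \<Delta> w = N + 2 + N * (N + 2) + \<Delta> ^ (w - 1) * N * leaf_cost N \<Delta>"

text \<open>\<open>N\<close> is a common bound for lengths and sizes. The word length must admit
  \<open>2 * M\<close>, because the test of an edge may add two labels, and \<open>n * M\<close>,
  because entries add up at most n values.\<close>

locale dp_run = prog_dp +
  fixes es :: "edge_entry list" and Dl :: "(nat \<times> nat list) list" and n N M \<Delta> :: nat
  assumes length_es: "length es \<le> N"
    and length_Dl: "length Dl \<le> N"
    and length_doms: "length (doms Dl v) \<le> \<Delta>"
    and \<Delta>_pos: "1 \<le> \<Delta>"
    and doms_le: "x \<in> set (doms Dl v) \<Longrightarrow> x \<le> M"
    and M_le: "2 * M \<le> W" "n * M \<le> W"
    and n_le_N: "n \<le> N"
begin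

abbreviation "entry_of \<equiv> ent es (doms Dl)"

abbreviation "c_check \<equiv> check_cost N"
abbreviation "c_ent \<equiv> ent_cost N \<Delta>"
abbreviation "c_cand \<equiv> cand_cost N \<Delta>"
abbreviation "c_tab \<equiv> leaf_cost N \<Delta>"
abbreviation "c_comp \<equiv> node_cost N \<Delta>"

text \<open>A table is specified only by its answers, so that tries, pairs of tables and the trivial
  table of a leaf are treated alike.\<close>

definition table_ok :: "val \<Rightarrow> ntd \<Rightarrow> bool" where
  "table_ok r T \<longleftrightarrow> (\<forall>\<sigma>. length \<sigma> \<le> N \<longrightarrow> (\<forall>b\<in>root_bag T. look \<sigma> b \<in> set (doms Dl b)) \<longrightarrow>
     ret F_ent [r, enc_assoc Num \<sigma>] (enc_entry (entry_of T (look \<sigma>))) (nsize T * c_ent))"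

lemma entry_le:
  assumes "good T" "entry_of T p = Some (c, s)" "forg T \<subseteq> {..<n}"
  shows "c \<le> card (forg T) * M" "c \<le> W" "length s \<le> N"
proof -
  have "c \<le> card (forg T) * M" "length s = card (forg T)"
    using ent_bound[OF assms(1,2), of M] doms_le by blast+
  moreover have "card (forg T) \<le> n" "n \<le> N"
    using card_mono[OF _ assms(3)] n_le_N by auto
  moreover from this have "card (forg T) * M \<le> W"
    using M_le(2) mult_le_mono1 order.trans by blast
  ultimately show "c \<le> card (forg T) * M" "c \<le> W" "length s \<le> N"
    by auto
qed

lemma look_add_le: "(\<And>u. u \<in> X \<Longrightarrow> look \<sigma> u \<in> set (doms Dl u)) \<Longrightarrow> u \<in> X \<Longrightarrow> v \<in> X \<Longrightarrow>
  look \<sigma> u + look \<sigma> v \<le> W"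
  using doms_le[of "look \<sigma> u" u] doms_le[of "look \<sigma> v" v] M_le(1) by force

definition step :: "ntd \<Rightarrow> nat \<Rightarrow> (nat \<Rightarrow> nat) \<Rightarrow> nat \<Rightarrow> entry" where
  "step T v p x = (if check es (root_bag T) (p(v := x)) then add_entry x v (entry_of T (p(v := x))) else None)"

fun tab_cost :: "nat \<Rightarrow> nat" where
  "tab_cost 0 = \<Delta> * c_cand + 1 + N + 2"
| "tab_cost (Suc k) = N + 3 + \<Delta> * (tab_cost k + 1)"

text \<open>Each level of the trie adds an overhead of at most one \<open>leaf_cost\<close> per node
  of the level below it; summing the levels gives the factor \<open>k + 1\<close>.\<close>

lemma tab_cost_le: "tab_cost k \<le> \<Delta> ^ k * (k + 1) * c_tab"
proof (induction k)
  case (Suc k)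
  have 1: "1 \<le> \<Delta> ^ k"
    using \<Delta>_pos by simp
  have "tab_cost (Suc k) \<le> N + 3 + \<Delta> + \<Delta> * (\<Delta> ^ k * (k + 1) * c_tab)"
    using mult_le_mono2[OF Suc.IH, of \<Delta>] by (simp add: algebra_simps)
  also have "N + 3 + \<Delta> \<le> \<Delta> * (N + 4)"
    using \<Delta>_pos by (cases \<Delta>) (auto simp: algebra_simps)
  also have "\<dots> \<le> \<Delta> * (\<Delta> ^ k * c_tab)"
    using mult_le_mono[OF 1, of "N + 4" c_tab] by (intro mult_le_mono2) (simp add: leaf_cost_def)
  finally show ?case
    by (simp add: algebra_simps)
qed (simp add: leaf_cost_def)

lemma ret_walk_Nil: "ret F_walk [t, Num 0, s] t 1"
  by (rule retI) (simp_all add: body_dp body_walk_def)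

lemma ret_walk_Cons:
  assumes "length rows \<le> \<Delta>" "length \<sigma> \<le> N" "lookup (\<lambda>x. x) rows (look \<sigma> b) = t"
    "ret F_walk [t, enc_list Num bs, enc_assoc Num \<sigma>] e c"
  shows "ret F_walk [enc_assoc (\<lambda>x. x) rows, enc_list Num (b # bs), enc_assoc Num \<sigma>] e (c + (\<Delta> + N + 3))"
  by (intro retI, simp)
    (use assms(1,2) in \<open>auto simp: body_dp body_walk_def
       intro!: callI[OF assms(4)[folded assms(3)]] callI[OF ret_look]\<close>)

text \<open>\<open>\<sigma>0\<close> holds the values fixed on the path from the root of the trie
  and \<open>bs\<close> the keys still to come, for which the queried assignment takes over.\<close>

definition trie_ok :: "ntd \<Rightarrow> nat \<Rightarrow> val \<Rightarrow> nat list \<Rightarrow> (nat \<times> nat) list \<Rightarrow> bool" where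
  "trie_ok T v t bs \<sigma>0 \<longleftrightarrow> (\<forall>\<sigma>. length \<sigma> \<le> N \<longrightarrow> (\<forall>b\<in>set bs. look \<sigma> b \<in> set (doms Dl b)) \<longrightarrow>
     ret F_walk [t, enc_list Num bs, enc_assoc Num \<sigma>]
       (enc_entry (entry_of (Forget v T) (override_on (look \<sigma>0) (look \<sigma>) (set bs))))
       (length bs * (\<Delta> + N + 3) + 1))"

text \<open>The local situation at a forget node: \<open>X\<close> lists the bag below it and \<open>r\<close> is the table
  of the tree below it.\<close>

context
  fixes T v r X
  assumes good: "good (Forget v T)"
    and verts: "root_bag T \<union> forg T \<subseteq> {..<n}"
    and size: "nsize T \<le> N"
    and r: "table_ok r T"
    and X: "set X = root_bag T" "length X \<le> N"
begin

lemma forg_facts: "v \<notin> forg T" "forg T \<subseteq> {..<n}" "v < n" "card (insert v (forg T)) \<le> n"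
proof -
  show "v \<notin> forg T" "forg T \<subseteq> {..<n}" "v < n"
    using good verts good_disjoint[of T] by auto
  then show "card (insert v (forg T)) \<le> n"
    using card_mono[of "{..<n}" "insert v (forg T)"] by auto
qed

lemma ret_cand:
  assumes "length \<sigma> < N" "x \<in> set (doms Dl v)" "\<And>b. b \<in> root_bag T - {v} \<Longrightarrow> look \<sigma> b \<in> set (doms Dl b)"
  shows "ret F_cand [Num x, Num v, r, enc_list enc_edge es, enc_list Num X, enc_assoc Num ((v, x) # \<sigma>)]
    (enc_entry (step T v (look \<sigma>) x)) (c_check + N * c_ent + 2)"
proof -
  have dom: "look ((v, x) # \<sigma>) b \<in> set (doms Dl b)" if "b \<in> root_bag T" for b
    using that assms by auto
  have "ret F_check [enc_list enc_edge es, enc_list Num X, enc_assoc Num ((v, x) # \<sigma>)]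
    (Num (of_bool (check es (set X) (look ((v, x) # \<sigma>))))) (length es * (4 * N + 6) + 1)"
    using X assms look_add_le[of "root_bag T" "(v, x) # \<sigma>", OF dom] by (intro ret_check) auto
  then have check: "ret F_check [enc_list enc_edge es, enc_list Num X, enc_assoc Num ((v, x) # \<sigma>)]
    (Num (of_bool (check es (root_bag T) ((look \<sigma>)(v := x))))) c_check"
    unfolding X look_Cons_fun
    by (rule ret_mono) (use length_es in \<open>simp add: check_cost_def\<close>)
  have ent: "ret F_ent [r, enc_assoc Num ((v, x) # \<sigma>)] (enc_entry (entry_of T ((look \<sigma>)(v := x)))) (N * c_ent)"
    using r[unfolded table_ok_def, rule_format, of "(v, x) # \<sigma>"] dom assms(1) size
    by (auto simp: look_Cons_fun intro: ret_mono)
  have add: "ret F_add [Num x, Num v, enc_entry (entry_of T ((look \<sigma>)(v := x)))]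
    (enc_entry (add_entry x v (entry_of T ((look \<sigma>)(v := x))))) 1"
  proof (rule ret_add)
    fix c s assume "entry_of T ((look \<sigma>)(v := x)) = Some (c, s)"
    then have "c \<le> card (forg T) * M"
      using entry_le(1) good forg_facts(2) by auto
    \<comment> \<open>The vertex \<open>v\<close> is not among the forgotten ones, so together they
      are still at most n.\<close>
    moreover have "(card (forg T) + 1) * M \<le> W"
      using forg_facts M_le(2) mult_le_mono1[of "card (forg T) + 1" n M] by simp
    ultimately show "x + c \<le> W"
      using doms_le[OF assms(2)] by (simp add: algebra_simps)
  qed
  show ?thesis
    by (intro retI, simp)
      (auto simp: body_dp body_cand_def step_def
        intro!: callI[OF check, simplified] callI[OF ent, simplified] callI[OF add])
qed

lemma ret_best:
  assumes "length \<sigma> < N" "\<And>b. b \<in> root_bag T - {v} \<Longrightarrow> look \<sigma> b \<in> set (doms Dl b)"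
  shows "set xs \<subseteq> set (doms Dl v) \<Longrightarrow>
    ret F_best [enc_list Num xs, Num v, r, enc_list enc_edge es, enc_list Num X, enc_assoc Num \<sigma>]
    (enc_entry (best (step T v (look \<sigma>)) xs)) (length xs * c_cand + 1)"
proof (induction xs)
  case Nil
  show ?case
    by (rule retI) (simp_all add: body_dp body_best_def)
next
  case (Cons x xs)
  note c = ret_cand[OF assms(1) _ assms(2), of x, simplified]
  show ?case
    using Cons.prems
    by (intro retI, simp)
      (auto simp: body_dp body_best_def cand_cost_def intro!: callI[OF c] callI[OF Cons.IH] callI[OF ret_min])
qed

lemma ret_tab:
  "length \<sigma>0 + length bs < N \<Longrightarrow>
   (\<And>b. b \<in> root_bag T - {v} - set bs \<Longrightarrow> look \<sigma>0 b \<in> set (doms Dl b)) \<Longrightarrow>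
   \<exists>t. ret F_tab [enc_list Num bs, enc_assoc Num \<sigma>0, Num v, r, enc_list enc_edge es,
        enc_list Num X, enc_assoc (enc_list Num) Dl] t (tab_cost (length bs)) \<and> trie_ok T v t bs \<sigma>0"
proof (induction bs arbitrary: \<sigma>0)
  case Nil
  have b: "ret F_best [enc_list Num (doms Dl v), Num v, r, enc_list enc_edge es, enc_list Num X, enc_assoc Num \<sigma>0]
    (enc_entry (best (step T v (look \<sigma>0)) (doms Dl v))) (length (doms Dl v) * c_cand + 1)"
    using Nil by (intro ret_best) auto
  have le: "length Dl + length (doms Dl v) * c_cand < Suc (\<Delta> * c_cand + N)"
    using mult_le_mono1[OF length_doms, of v c_cand] length_Dl by linarith
  have "ret F_tab [enc_list Num [], enc_assoc Num \<sigma>0, Num v, r, enc_list enc_edge es,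
        enc_list Num X, enc_assoc (enc_list Num) Dl] (enc_entry (best (step T v (look \<sigma>0)) (doms Dl v)))
        (tab_cost (length ([] :: nat list)))"
    using length_Dl le
    by (intro retI, simp) (auto simp: body_dp body_tab_def lookup_doms intro!: callI[OF ret_look] callI[OF b])
  moreover have "trie_ok T v (enc_entry (best (step T v (look \<sigma>0)) (doms Dl v))) [] \<sigma>0"
    unfolding trie_ok_def by (auto simp: step_def[abs_def] intro: ret_walk_Nil[simplified])
  ultimately show ?case
    by blast
next
  case (Cons b bs)
  define w where "w = (\<lambda>\<sigma>0 t. ret F_tab [enc_list Num bs, enc_assoc Num \<sigma>0, Num v, r, enc_list enc_edge es,
        enc_list Num X, enc_assoc (enc_list Num) Dl] t (tab_cost (length bs)) \<and> trie_ok T v t bs \<sigma>0)"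
  \<comment> \<open>The induction hypothesis only asserts that some subtrie is returned for each
    value \<open>x\<close>; a choice function collects these results in one list of rows.\<close>
  define f where "f = (\<lambda>x. SOME t. w ((b, x) # \<sigma>0) t)"
  have f: "w ((b, x) # \<sigma>0) (f x)" if "x \<in> set (doms Dl b)" for x
    unfolding f_def w_def
    by (rule someI_ex, rule Cons.IH) (use that Cons.prems in \<open>auto\<close>)
  have rows: "set xs \<subseteq> set (doms Dl b) \<Longrightarrow>
    ret F_rows [enc_list Num xs, Num b, enc_list Num bs, enc_assoc Num \<sigma>0, Num v, r, enc_list enc_edge es,
        enc_list Num X, enc_assoc (enc_list Num) Dl] (enc_assoc (\<lambda>x. x) (map (\<lambda>x. (x, f x)) xs))
        (length xs * (tab_cost (length bs) + 1) + 1)" for xs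
  proof (induction xs)
    case Nil
    show ?case
      by (rule retI) (simp_all add: body_dp body_rows_def)
  next
    case (Cons x xs)
    have t: "ret F_tab [enc_list Num bs, enc_assoc Num ((b, x) # \<sigma>0), Num v, r, enc_list enc_edge es,
        enc_list Num X, enc_assoc (enc_list Num) Dl] (f x) (tab_cost (length bs))"
      using f[of x] Cons.prems by (simp add: w_def)
    show ?case
      using Cons.prems
      by (intro retI, simp) (auto simp: body_dp body_rows_def
        intro!: callI[OF t, simplified] callI[OF Cons.IH])
  qed
  let ?t = "enc_assoc (\<lambda>x. x) (map (\<lambda>x. (x, f x)) (doms Dl b))"
  have le: "length (doms Dl b) * (tab_cost (length bs) + 1) \<le> \<Delta> * (tab_cost (length bs) + 1)"
    using length_doms by (rule mult_le_mono1)
  have "ret F_tab [enc_list Num (b # bs), enc_assoc Num \<sigma>0, Num v, r, enc_list enc_edge es,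
        enc_list Num X, enc_assoc (enc_list Num) Dl] ?t (tab_cost (length (b # bs)))"
    using length_Dl le
    by (intro retI, simp)
      (auto simp: body_dp body_tab_def lookup_doms intro!: callI[OF ret_look] callI[OF rows])
  moreover have "trie_ok T v ?t (b # bs) \<sigma>0"
    unfolding trie_ok_def
  proof (intro allI impI)
    fix \<sigma> :: "(nat \<times> nat) list"
    assume \<sigma>: "length \<sigma> \<le> N" "\<forall>b'\<in>set (b # bs). look \<sigma> b' \<in> set (doms Dl b')"
    let ?x = "look \<sigma> b"
    have "lookup (\<lambda>x. x) (map (\<lambda>x. (x, f x)) xs) ?x = f ?x" if "?x \<in> set xs" for xs
      using that by (induction xs) auto
    then have l: "lookup (\<lambda>x. x) (map (\<lambda>x. (x, f x)) (doms Dl b)) ?x = f ?x"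
      using \<sigma> by simp
    have "trie_ok T v (f ?x) bs ((b, ?x) # \<sigma>0)"
      using f[of ?x] \<sigma> by (simp add: w_def)
    then have "ret F_walk [f ?x, enc_list Num bs, enc_assoc Num \<sigma>]
       (enc_entry (entry_of (Forget v T) (override_on (look ((b, ?x) # \<sigma>0)) (look \<sigma>) (set bs))))
       (length bs * (\<Delta> + N + 3) + 1)"
      using \<sigma> unfolding trie_ok_def by auto
    moreover have "override_on (look ((b, ?x) # \<sigma>0)) (look \<sigma>) (set bs) =
      override_on (look \<sigma>0) (look \<sigma>) (set (b # bs))"
      by (auto simp: fun_eq_iff override_on_def)
    ultimately have "ret F_walk [f ?x, enc_list Num bs, enc_assoc Num \<sigma>]
       (enc_entry (entry_of (Forget v T) (override_on (look \<sigma>0) (look \<sigma>) (set (b # bs)))))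
       (length bs * (\<Delta> + N + 3) + 1)"
      by simp
    from ret_walk_Cons[OF _ \<sigma>(1) l this]
    show "ret F_walk [?t, enc_list Num (b # bs), enc_assoc Num \<sigma>]
       (enc_entry (entry_of (Forget v T) (override_on (look \<sigma>0) (look \<sigma>) (set (b # bs)))))
       (length (b # bs) * (\<Delta> + N + 3) + 1)"
      using length_doms by (auto elim: ret_mono)
  qed
  ultimately show ?case
    by blast
qed

end

lemma table_ok_Forget:
  assumes "good (Forget v T)" "length bs \<le> N" "set bs = root_bag T - {v}" "trie_ok T v t bs []"
  shows "table_ok (Cell (Num 1) (Cell (enc_list Num bs) t)) (Forget v T)"
  unfolding table_ok_def
proof (intro allI impI)
  fix \<sigma> :: "(nat \<times> nat) list"
  assume \<sigma>: "length \<sigma> \<le> N" "\<forall>b\<in>root_bag (Forget v T). look \<sigma> b \<in> set (doms Dl b)"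
  \<comment> \<open>Starting from the empty path, every vertex of the bag is a key, and
    \<open>ent\<close> does not depend on values outside the bag.\<close>
  have "entry_of (Forget v T) (override_on (look []) (look \<sigma>) (set bs)) = entry_of (Forget v T) (look \<sigma>)"
    using assms by (intro ent_cong) auto
  then have w: "ret F_walk [t, enc_list Num bs, enc_assoc Num \<sigma>] (enc_entry (entry_of (Forget v T) (look \<sigma>)))
       (length bs * (\<Delta> + N + 3) + 1)"
    using assms(3,4) \<sigma> unfolding trie_ok_def by auto
  have "length bs * (\<Delta> + N + 3) + 1 < c_ent"
    using mult_le_mono1[OF assms(2), of "\<Delta> + N + 3"] unfolding ent_cost_def by linarith
  also have "c_ent \<le> nsize (Forget v T) * c_ent"
    by simp
  finally have "length bs * (\<Delta> + N + 3) + 1 < nsize (Forget v T) * c_ent" .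
  then show "ret F_ent [Cell (Num 1) (Cell (enc_list Num bs) t), enc_assoc Num \<sigma>]
     (enc_entry (entry_of (Forget v T) (look \<sigma>))) (nsize (Forget v T) * c_ent)"
    by (intro retI, simp)
     (auto simp: body_dp body_ent_def simp del: ent.simps nsize.simps intro!: callI[OF w])
qed


lemma c_comp_ge: "nsize T * c_comp w + N + 2 + N * (N + 2) + \<Delta> ^ (w - 1) * N * c_tab \<le> nsize (Forget v T) * c_comp w"
  by (simp add: node_cost_def)

lemma ret_comp:
  assumes "w \<le> N"
  shows "\<forall>X\<in>bags T. card X \<le> w \<Longrightarrow> good T \<Longrightarrow> root_bag T \<union> forg T \<subseteq> {..<n} \<Longrightarrow> nsize T \<le> N \<Longrightarrow>
    \<exists>r. ret F_comp [enc_ntd T, enc_list enc_edge es, enc_assoc (enc_list Num) Dl] r (nsize T * c_comp w)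
    \<and> table_ok r T"
proof (induction T)
  case (Leaf xs)
  have "table_ok (Num 0) (Leaf xs)"
    unfolding table_ok_def by (intro allI impI retI, simp) (simp add: body_dp body_ent_def ent_cost_def)
  moreover have "ret F_comp [enc_ntd (Leaf xs), enc_list enc_edge es, enc_assoc (enc_list Num) Dl] (Num 0)
    (nsize (Leaf xs) * c_comp w)"
    by (rule retI) (simp_all add: body_dp body_comp_def tag_cases_def node_cost_def)
  ultimately show ?case
    by blast
next
  case (Introduce v T)
  then obtain r where r: "ret F_comp [enc_ntd T, enc_list enc_edge es, enc_assoc (enc_list Num) Dl] r
    (nsize T * c_comp w)" "table_ok r T"
    by auto
  have "ret F_comp [enc_ntd (Introduce v T), enc_list enc_edge es, enc_assoc (enc_list Num) Dl] r
    (nsize (Introduce v T) * c_comp w)"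
    by (intro retI, simp) (auto simp: body_dp body_comp_def tag_cases_def node_cost_def intro!: callI[OF r(1)])
  moreover have "table_ok r (Introduce v T)"
    unfolding table_ok_def
  proof (intro allI impI)
    fix \<sigma> :: "(nat \<times> nat) list"
    assume "length \<sigma> \<le> N" "\<forall>b\<in>root_bag (Introduce v T). look \<sigma> b \<in> set (doms Dl b)"
    with r(2) have "ret F_ent [r, enc_assoc Num \<sigma>] (enc_entry (entry_of T (look \<sigma>))) (nsize T * c_ent)"
      unfolding table_ok_def by auto
    then show "ret F_ent [r, enc_assoc Num \<sigma>] (enc_entry (entry_of (Introduce v T) (look \<sigma>)))
      (nsize (Introduce v T) * c_ent)"
      unfolding ent.simps by (rule ret_mono) simp
  qed
  ultimately show ?case
    by blast
next
  case (Forget v T)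
  have verts: "root_bag T \<union> forg T \<subseteq> {..<n}"
    using Forget.prems(2,3) by auto
  with Forget obtain r where r: "ret F_comp [enc_ntd T, enc_list enc_edge es, enc_assoc (enc_list Num) Dl] r
    (nsize T * c_comp w)" "table_ok r T"
    by auto
  define bs where "bs = removeAll v (bag_list T)"
  have bs: "set bs = root_bag T - {v}" "set (v # bs) = root_bag T"
    using Forget.prems(2) by (auto simp: bs_def set_bag_list)
  have "distinct (v # bs)"
    using Forget.prems(2) by (auto simp: bs_def distinct_bag_list distinct_removeAll)
  then have len: "length (v # bs) = card (root_bag T)"
    using distinct_card bs(2) by metis
  moreover have "card (root_bag T) \<le> w"
    using Forget.prems(1) root_bag_in_bags[of T] by auto
  ultimately have len_w: "length bs + 1 \<le> w"
    by simp
  have size: "nsize T \<le> N"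
    using Forget.prems(4) by simp
  have X: "length (v # bs) \<le> N"
    using len_w assms by simp
  obtain t where t: "ret F_tab [enc_list Num bs, enc_assoc Num [], Num v, r, enc_list enc_edge es,
        enc_list Num (v # bs), enc_assoc (enc_list Num) Dl] t (tab_cost (length bs))" "trie_ok T v t bs []"
    using ret_tab[OF Forget.prems(2) verts size r(2) bs(2) X, of "[]" bs] bs X by auto
  \<comment> \<open>The forgotten vertex is not a key, so there are at most \<open>w - 1\<close>
    keys; \<open>N\<close> absorbs the factor \<open>length bs + 1\<close>.\<close>
  have "tab_cost (length bs) \<le> \<Delta> ^ (w - 1) * N * c_tab"
  proof -
    have "tab_cost (length bs) \<le> \<Delta> ^ length bs * (length bs + 1) * c_tab"
      by (rule tab_cost_le)
    also have "\<dots> \<le> \<Delta> ^ (w - 1) * N * c_tab"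
      using len_w assms \<Delta>_pos by (intro mult_le_mono power_increasing) auto
    finally show ?thesis .
  qed
  then have t': "ret F_tab [enc_list Num bs, Num 0, Num v, r, enc_list enc_edge es,
        Cell (Num v) (enc_list Num bs), enc_assoc (enc_list Num) Dl] t (\<Delta> ^ (w - 1) * N * c_tab)"
    using t(1) ret_mono by fastforce
  have b: "ret F_bag [enc_ntd T] (enc_list Num (bag_list T)) (N * (N + 2))"
  proof (rule ret_mono[OF ret_bag])
    show "nsize T * (n + 2) \<le> N * (N + 2)"
      using size n_le_N by (intro mult_le_mono) auto
  qed (use Forget.prems(2) verts in auto)
  have rm: "ret F_remove [enc_list Num (bag_list T), Num v] (enc_list Num bs) (N + 1)"
    using ret_mono[OF ret_remove[of "bag_list T" v]] length_bag_list_le[OF _ verts] Forget.prems(2) n_le_N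
    by (simp add: bs_def)
  have "ret F_comp [enc_ntd (Forget v T), enc_list enc_edge es, enc_assoc (enc_list Num) Dl]
    (Cell (Num 1) (Cell (enc_list Num bs) t)) (nsize (Forget v T) * c_comp w)"
    using c_comp_ge[of T w v]
    by (intro retI, simp) (auto simp: body_dp body_comp_def tag_cases_def simp del: nsize.simps
        intro!: callI[OF r(1)] callI[OF b] callI[OF rm] callI[OF t'])
  moreover have "table_ok (Cell (Num 1) (Cell (enc_list Num bs) t)) (Forget v T)"
    using Forget.prems(2) X bs(1) t(2) by (intro table_ok_Forget) auto
  ultimately show ?case
    by blast
next
  case (Join S T)
  have verts: "root_bag S \<union> forg S \<subseteq> {..<n}" "root_bag T \<union> forg T \<subseteq> {..<n}"
    using Join.prems(2,3) by auto
  with Join obtain r where r: "ret F_comp [enc_ntd S, enc_list enc_edge es, enc_assoc (enc_list Num) Dl] r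
    (nsize S * c_comp w)" "table_ok r S"
    by auto
  from verts Join obtain q where q: "ret F_comp [enc_ntd T, enc_list enc_edge es, enc_assoc (enc_list Num) Dl] q
    (nsize T * c_comp w)" "table_ok q T"
    by auto
  have "ret F_comp [enc_ntd (Join S T), enc_list enc_edge es, enc_assoc (enc_list Num) Dl] (Cell (Num 0) (Cell r q))
    (nsize (Join S T) * c_comp w)"
    by (intro retI, simp) (auto simp: body_dp body_comp_def tag_cases_def node_cost_def algebra_simps
      intro!: callI[OF r(1)] callI[OF q(1)])
  moreover have "table_ok (Cell (Num 0) (Cell r q)) (Join S T)"
    unfolding table_ok_def
  proof (intro allI impI)
    fix \<sigma> :: "(nat \<times> nat) list"
    assume \<sigma>: "length \<sigma> \<le> N" "\<forall>b\<in>root_bag (Join S T). look \<sigma> b \<in> set (doms Dl b)"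
    then have r': "ret F_ent [r, enc_assoc Num \<sigma>] (enc_entry (entry_of S (look \<sigma>))) (nsize S * c_ent)"
      and q': "ret F_ent [q, enc_assoc Num \<sigma>] (enc_entry (entry_of T (look \<sigma>))) (nsize T * c_ent)"
      using r(2) q(2) Join.prems(2) unfolding table_ok_def by auto
    have j: "ret F_join [enc_entry (entry_of S (look \<sigma>)), enc_entry (entry_of T (look \<sigma>))]
      (enc_entry (entry_of (Join S T) (look \<sigma>))) (N + 2)"
      unfolding ent.simps
    proof (rule ret_join)
      fix c s d t
      assume e: "entry_of S (look \<sigma>) = Some (c, s)" "entry_of T (look \<sigma>) = Some (d, t)"
      have "c + d \<le> (card (forg S) + card (forg T)) * M"
        using entry_le(1)[OF _ e(1)] entry_le(1)[OF _ e(2)] Join.prems(2) verts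
        by (simp add: algebra_simps add_mono)
      also have "card (forg S) + card (forg T) = card (forg S \<union> forg T)"
        using Join.prems(2) by (simp add: card_Un_disjoint)
      also have "\<dots> * M \<le> n * M"
        using verts card_mono[of "{..<n}" "forg S \<union> forg T"] by (intro mult_le_mono1) auto
      also note M_le(2)
      finally show "c + d \<le> W" .
    next
      fix c s
      assume "entry_of S (look \<sigma>) = Some (c, s)"
      then show "length s \<le> N"
        using entry_le(3) Join.prems(2) verts by auto
    qed
    have "nsize S * c_ent + nsize T * c_ent + N + 3 \<le> nsize (Join S T) * c_ent"
      by (simp add: ent_cost_def algebra_simps)
    then show "ret F_ent [Cell (Num 0) (Cell r q), enc_assoc Num \<sigma>]
      (enc_entry (entry_of (Join S T) (look \<sigma>))) (nsize (Join S T) * c_ent)"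
      by (intro retI, simp)
       (auto simp: body_dp body_ent_def simp del: ent.simps nsize.simps intro!: callI[OF r'] callI[OF q'] callI[OF j])
  qed
  ultimately show ?case
    by blast
qed

end

section \<open>A 2-approximation and the choice of the domains\<close>

definition edges_ok :: "nat \<Rightarrow> edge_entry list \<Rightarrow> bool" where
  "edges_ok n es \<longleftrightarrow> (\<forall>(u, v, a, b) \<in> set es. u < n \<and> v < n \<and> u \<noteq> v \<and> 0 < a \<and> 0 < b)"

definition feas :: "nat \<Rightarrow> edge_entry list \<Rightarrow> (nat \<Rightarrow> real) \<Rightarrow> bool" where
  "feas n es p \<longleftrightarrow> (\<forall>v<n. 0 \<le> p v) \<and> (\<forall>(u, v, a, b) \<in> set es. real a \<le> p u \<or> real b \<le> p v)"

lemma edges_ok_Cons [simp]: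
  "edges_ok n ((u, v, a, b) # es) \<longleftrightarrow> u < n \<and> v < n \<and> u \<noteq> v \<and> 0 < a \<and> 0 < b \<and> edges_ok n es"
  by (auto simp: edges_ok_def)

lemma feas_Cons [simp]:
  "feas n ((u, v, a, b) # es) p \<longleftrightarrow> (real a \<le> p u \<or> real b \<le> p v) \<and> feas n es p"
  by (auto simp: feas_def)

text \<open>The local ratio method, working from the end of the edge list. Because of truncated
  subtraction \<open>d\<close> is 0 for an edge that is already covered. The first component
  accumulates the total of all credits.\<close>

fun credits :: "edge_entry list \<Rightarrow> nat \<times> (nat \<times> nat) list" where
  "credits [] = (0, [])"
| "credits ((u, v, a, b) # es) = (let r = credits es; x = look (snd r) u; y = look (snd r) v; d = min (a - x) (b - y)
     in (fst r + (d + d), (u, x + d) # (v, y + d) # snd r))"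

definition "credit es = look (snd (credits es))"

lemma credit_Cons:
  "credit ((u, v, a, b) # es) = (let d = min (a - credit es u) (b - credit es v) in
     (credit es)(v := credit es v + d, u := credit es u + d))"
  by (auto simp: credit_def Let_def fun_eq_iff)

lemma sum_upd:
  fixes f :: "nat \<Rightarrow> 'a :: ab_group_add"
  assumes "u < n"
  shows "(\<Sum>i<n. (f(u := z)) i) = (\<Sum>i<n. f i) - f u + z"
proof -
  have "(\<Sum>i<n. (f(u := z)) i) = z + (\<Sum>i\<in>{..<n} - {u}. (f(u := z)) i)"
    using assms by (subst sum.remove[of _ u]) auto
  also have "(\<Sum>i\<in>{..<n} - {u}. (f(u := z)) i) = (\<Sum>i\<in>{..<n} - {u}. f i)"
    by (intro sum.cong) auto
  also have "\<dots> = (\<Sum>i<n. f i) - f u"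
    using assms by (subst sum.remove[of "{..<n}" u f]) auto
  finally show ?thesis
    by simp
qed

lemma sum_credit: "edges_ok n es \<Longrightarrow> (\<Sum>i<n. real (credit es i)) = real (fst (credits es))"
proof (induction es)
  case (Cons e es)
  obtain u v a b where e: "e = (u, v, a, b)"
    by (cases e)
  define d where "d = min (a - credit es u) (b - credit es v)"
  have "(\<lambda>i. real (credit (e # es) i)) =
    ((\<lambda>i. real (credit es i))(v := real (credit es v + d), u := real (credit es u + d)))"
    by (auto simp: e credit_Cons Let_def d_def fun_eq_iff)
  then have "(\<Sum>i<n. real (credit (e # es) i)) = (\<Sum>i<n. ((\<lambda>i. real (credit es i))
      (v := real (credit es v + d), u := real (credit es u + d))) i)"
    by (rule arg_cong)
  also have "\<dots> = (\<Sum>i<n. real (credit es i)) + real (d + d)"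
    using Cons.prems unfolding e by (simp add: sum_upd del: fun_upd_apply) simp
  finally have "(\<Sum>i<n. real (credit (e # es) i)) = (\<Sum>i<n. real (credit es i)) + real (d + d)" .
  then show ?case
    using Cons by (simp add: e Let_def d_def credit_def)
qed (simp add: credit_def)

lemma credit_le:
  "(\<And>u v a b. (u, v, a, b) \<in> set es \<Longrightarrow> a \<le> M \<and> b \<le> M) \<Longrightarrow> credit es i \<le> M"
proof (induction es arbitrary: i)
  case (Cons e es)
  obtain u v a b where e: "e = (u, v, a, b)"
    by (cases e)
  have c: "credit es i \<le> M" for i
    by (rule Cons.IH) (use Cons.prems in auto)
  have ab: "a \<le> M" "b \<le> M"
    using Cons.prems[of u v a b] by (auto simp: e)
  have "credit es u + min (a - credit es u) z \<le> M" "credit es v + min z (b - credit es v) \<le> M" for z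
    using c[of u] c[of v] ab by arith+
  then show ?case
    using c by (auto simp: e credit_Cons Let_def)
qed (simp add: credit_def)

text \<open>Increasing both ends by the smaller deficit brings one of them up to its weight, and
  later credits only increase.\<close>

lemma credit_feas: "edges_ok n es \<Longrightarrow> feas n es (\<lambda>i. real (credit es i))"
proof -
  have mono: "credit es i \<le> credit (e # es) i" for e es i
    by (cases e) (auto simp: credit_Cons Let_def)
  have "a \<le> credit es u \<or> b \<le> credit es v" if "edges_ok n es" "(u, v, a, b) \<in> set es" for u v a b
    using that
  proof (induction es)
    case (Cons e es)
    show ?case
    proof (cases "(u, v, a, b) = e")
      case True
      then have "u \<noteq> v"
        using Cons.prems by auto
      with True show ?thesis
        by (auto simp: credit_Cons Let_def min_def)
    next
      case False
      then have "a \<le> credit es u \<or> b \<le> credit es v"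
        using Cons by (cases e) auto
      then show ?thesis
        using mono[of es u e] mono[of es v e] by linarith
    qed
  qed simp
  then show "edges_ok n es \<Longrightarrow> feas n es (\<lambda>i. real (credit es i))"
    by (auto simp: feas_def)
qed

text \<open>The credit \<open>d\<close> given for an edge to both of its end points is paid by an end point at which
  \<open>p\<close> covers the edge, where the credit does not exceed the value of \<open>p\<close>.\<close>

lemma credits_le_min:
  "edges_ok n es \<Longrightarrow> feas n es p \<Longrightarrow> real (fst (credits es)) \<le> 2 * (\<Sum>i<n. min (real (credit es i)) (p i))"
proof (induction es)
  case Nil
  then show ?case
    by (auto simp: feas_def credit_def intro: sum_nonneg)
next
  case (Cons e es)
  obtain u v a b where e: "e = (u, v, a, b)"
    by (cases e)
  have uv: "u < n" "v < n" "u \<noteq> v"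
    using Cons.prems(1) by (auto simp: e)
  define d where "d = min (a - credit es u) (b - credit es v)"
  define g where "g = (\<lambda>i. min (real (credit es i)) (p i))"
  define g' where "g' = (\<lambda>i. min (real (credit (e # es) i)) (p i))"
  have cr: "credit (e # es) = (credit es)(v := credit es v + d, u := credit es u + d)"
    by (simp add: e credit_Cons Let_def d_def)
  have le: "g i \<le> g' i" for i
    by (auto simp: g_def g'_def cr min_def)
  have "(\<Sum>i<n. g i) + real d \<le> (\<Sum>i<n. g' i)"
  proof (cases "real a \<le> p u")
    case True
    \<comment> \<open>If the credit at \<open>u\<close> is at most \<open>a\<close>, it stays so
      after adding \<open>d\<close>, hence remains below \<open>p u\<close> and counts in full.
      Otherwise \<open>d\<close> is 0.\<close>
    have "g u + real d \<le> g' u"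
      using True by (cases "credit es u \<le> a") (auto simp: g_def g'_def cr d_def min_def)
    then have "(\<Sum>i<n. (g(u := g u + real d)) i) \<le> (\<Sum>i<n. g' i)"
      using le by (intro sum_mono) auto
    then show ?thesis
      using uv by (simp add: sum_upd del: fun_upd_apply)
  next
    case False
    then have "real b \<le> p v"
      using Cons.prems(2) by (simp add: e)
    then have "g v + real d \<le> g' v"
      using uv by (cases "credit es v \<le> b") (auto simp: g_def g'_def cr d_def min_def)
    then have "(\<Sum>i<n. (g(v := g v + real d)) i) \<le> (\<Sum>i<n. g' i)"
      using le by (intro sum_mono) auto
    then show ?thesis
      using uv by (simp add: sum_upd del: fun_upd_apply)
  qed
  moreover have "real (fst (credits es)) \<le> 2 * (\<Sum>i<n. g i)"
    using Cons by (simp add: e g_def)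
  moreover have "fst (credits (e # es)) = fst (credits es) + (d + d)"
    by (simp add: e Let_def d_def credit_def)
  ultimately show ?case
    by (simp add: g'_def)
qed

lemma credits_2_approx:
  assumes "edges_ok n es" "feas n es p"
  shows "real (fst (credits es)) \<le> 2 * (\<Sum>i<n. p i)"
proof -
  have "(\<Sum>i<n. min (real (credit es i)) (p i)) \<le> (\<Sum>i<n. p i)"
    by (intro sum_mono) auto
  then show ?thesis
    using credits_le_min[OF assms] by linarith
qed

section \<open>Chains of weights as domains\<close>

fun weight_at :: "edge_entry \<Rightarrow> nat \<Rightarrow> nat" where
  "weight_at (u, v, a, b) w = (if u = w then a else if v = w then b else 0)"

fun max_weight :: "edge_entry list \<Rightarrow> nat \<Rightarrow> nat \<Rightarrow> nat \<Rightarrow> nat" where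
  "max_weight [] v p q = 0"
| "max_weight (e # es) v p q = (let r = max_weight es v p q; m = weight_at e v in
     if m * p < q then if r < m then m else r else r)"

lemma max_weight_ge: "e \<in> set es \<Longrightarrow> weight_at e v * p < q \<Longrightarrow> weight_at e v \<le> max_weight es v p q"
  by (induction es) (auto simp: Let_def)

lemma max_weight_in: "max_weight es v p q = 0 \<or> (\<exists>e\<in>set es. max_weight es v p q = weight_at e v)"
  by (induction es) (auto simp: Let_def)

lemma max_weight_less: "0 < q \<Longrightarrow> max_weight es v p q * p < q"
  by (induction es) (auto simp: Let_def)

text \<open>A domain contains, from the largest relevant weight downwards, the largest weight that is smaller
  by at least the factor \<open>q / p < 1\<close>, until \<open>K1 * x \<le> K2\<close>. The test whether the next weight is smaller,
  which always succeeds, makes the termination evident.\<close>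

function chain :: "edge_entry list \<Rightarrow> nat \<Rightarrow> nat \<Rightarrow> nat \<Rightarrow> nat \<Rightarrow> nat \<Rightarrow> nat \<Rightarrow> nat list" where
  "chain es v K1 K2 p q x = (if K2 < K1 * x \<and> max_weight es v p (q * x) < x
     then x # chain es v K1 K2 p q (max_weight es v p (q * x)) else [x])"
  by pat_completeness auto
termination by (relation "measure (\<lambda>(es, v, K1, K2, p, q, x). x)") auto

declare chain.simps [simp del]

lemma max_weight_decr: "0 < q \<Longrightarrow> q < p \<Longrightarrow> K2 < K1 * x \<Longrightarrow> max_weight es v p (q * x) < x"
proof -
  assume "0 < q" "q < p" "K2 < K1 * x"
  then have "0 < x"
    by (cases x) auto
  then have "max_weight es v p (q * x) * p < q * x"
    using \<open>0 < q\<close> by (intro max_weight_less) simp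
  also have "\<dots> \<le> x * p"
    using \<open>q < p\<close> by (simp add: mult.commute)
  finally show ?thesis
    by simp
qed

lemma chain_simps:
  assumes "0 < q" "q < p"
  shows "chain es v K1 K2 p q x = (if K2 < K1 * x
     then x # chain es v K1 K2 p q (max_weight es v p (q * x)) else [x])"
  using max_weight_decr[OF assms] by (subst chain.simps) auto

lemma chain_le: "z \<in> set (chain es v K1 K2 p q x) \<Longrightarrow> z \<le> x"
proof (induction es v K1 K2 p q x rule: chain.induct)
  case (1 es v K1 K2 p q x)
  then show ?case
    by (subst (asm) (2) chain.simps) (auto split: if_splits dest: order.trans less_imp_le)
qed

text \<open>The chain is descended as long as all weights up to \<open>y\<close> still lie below the
  next bound. At the first \<open>x\<close> where some weight \<open>m \<le> y\<close> does not,
  \<open>q * x \<le> p * m \<le> p * y\<close> holds; if this never happens, the chain ends below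
  the cutoff.\<close>

lemma chain_dominates:
  assumes "0 < q" "q < p" "0 \<le> (y :: real)"
  shows "(\<And>e. e \<in> set es \<Longrightarrow> real (weight_at e v) \<le> y \<Longrightarrow> weight_at e v \<le> x) \<Longrightarrow>
    \<exists>z\<in>set (chain es v K1 K2 p q x). (\<forall>e\<in>set es. real (weight_at e v) \<le> y \<longrightarrow> weight_at e v \<le> z) \<and>
      (real q * real z \<le> real p * y \<or> K1 * z \<le> K2)"
proof (induction x rule: less_induct)
  case (less x)
  show ?case
  proof (cases "K2 < K1 * x")
    case False
    then show ?thesis
      using less.prems by (subst chain_simps[OF assms(1,2)]) auto
  next
    case True
    show ?thesis
    proof (cases "\<forall>e\<in>set es. real (weight_at e v) \<le> y \<longrightarrow> weight_at e v * p < q * x")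
      case *: True
      have "\<exists>z\<in>set (chain es v K1 K2 p q (max_weight es v p (q * x))).
        (\<forall>e\<in>set es. real (weight_at e v) \<le> y \<longrightarrow> weight_at e v \<le> z) \<and>
        (real q * real z \<le> real p * y \<or> K1 * z \<le> K2)"
        using * by (intro less.IH max_weight_decr[OF assms(1,2) True] max_weight_ge) auto
      then show ?thesis
        using True by (subst chain_simps[OF assms(1,2)]) auto
    next
      case False
      then obtain e where e: "e \<in> set es" "real (weight_at e v) \<le> y" "q * x \<le> weight_at e v * p"
        by auto
      have "real q * real x \<le> real (weight_at e v) * real p"
        using e(3) by (metis of_nat_le_iff of_nat_mult)
      also have "\<dots> \<le> real p * y"
        using e(2) by (subst mult.commute) (intro mult_left_mono, auto)
      finally show ?thesis
        using True less.prems by (subst chain_simps[OF assms(1,2)]) auto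
    qed
  qed
qed

text \<open>All elements but the last lie above the cutoff. Among these \<open>k + 1\<close>
  elements there are \<open>k\<close> steps, each of which shrinks the value by at least the factor
  \<open>q / p\<close>.\<close>

lemma chain_length_geometric:
  assumes "0 < q" "q < p"
  shows "length (chain es v K1 K2 p q x) = Suc (Suc k) \<Longrightarrow> K2 * p ^ k \<le> K1 * x * q ^ k"
proof (induction k arbitrary: x)
  case 0
  then show ?case
    by (subst (asm) chain_simps[OF assms]) (auto split: if_splits)
next
  case (Suc k)
  let ?y = "max_weight es v p (q * x)"
  have *: "K2 < K1 * x" "length (chain es v K1 K2 p q ?y) = Suc (Suc k)"
    using Suc.prems by (subst (asm) chain_simps[OF assms]; auto split: if_splits)+
  then have "0 < x"
    by (cases x) auto
  then have y: "?y * p \<le> q * x"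
    using max_weight_less[of "q * x" es v p] assms by simp
  have "K2 * p ^ Suc k \<le> K1 * ?y * q ^ k * p"
    using Suc.IH[OF *(2)] by (simp add: mult.commute mult.left_commute)
  also have "\<dots> = K1 * q ^ k * (?y * p)"
    by simp
  also have "\<dots> \<le> K1 * q ^ k * (q * x)"
    using y by (intro mult_le_mono2)
  finally show ?case
    by (simp add: mult_ac)
qed

text \<open>The chain is strictly decreasing and, apart from its start and possibly 0, consists of
  weights at \<open>v\<close>. Since this does not involve the ratio, it is the useful bound for
  tiny \<epsilon>.\<close>

lemma chain_length_le: "length (chain es v K1 K2 p q x) \<le> length es + 2"
proof -
  have "distinct (chain es v K1 K2 p q x) \<and>
    set (chain es v K1 K2 p q x) \<subseteq> insert x (insert 0 ((\<lambda>e. weight_at e v) ` set es))"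
  proof (induction es v K1 K2 p q x rule: chain.induct)
    case (1 es v K1 K2 p q x)
    let ?y = "max_weight es v p (q * x)"
    have in_y: "?y \<in> insert 0 ((\<lambda>e. weight_at e v) ` set es)"
      using max_weight_in[of es v p "q * x"] by auto
    show ?case
    proof (cases "K2 < K1 * x \<and> ?y < x")
      case True
      have "x \<notin> set (chain es v K1 K2 p q ?y)"
        using chain_le[of x es v K1 K2 p q ?y] True by auto
      then show ?thesis
        using 1[OF True] True in_y by (subst (1 2) chain.simps) auto
    next
      case False
      then have "chain es v K1 K2 p q x = [x]"
        by (subst chain.simps, subst if_not_P) auto
      then show ?thesis
        by simp
    qed
  qed
  then have "length (chain es v K1 K2 p q x) \<le> card (insert x (insert 0 ((\<lambda>e. weight_at e v) ` set es)))"
    by (metis (no_types, lifting) card_mono distinct_card finite_imageI finite_insert List.finite_set)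
  also have "\<dots> \<le> Suc (Suc (card ((\<lambda>e. weight_at e v) ` set es)))"
    by (simp add: card_insert_if)
  also have "\<dots> \<le> length es + 2"
    using card_image_le[of "set es" "\<lambda>e. weight_at e v"] card_length[of es] by simp
  finally show ?thesis .
qed

section \<open>Solving an instance along a nice tree decomposition\<close>

lemma foldr_Forget:
  "distinct vs \<Longrightarrow> set vs \<subseteq> root_bag T \<Longrightarrow> good T \<Longrightarrow> good (foldr Forget vs T) \<and>
   root_bag (foldr Forget vs T) = root_bag T - set vs \<and>
   forg (foldr Forget vs T) = forg T \<union> set vs \<and>
   (\<forall>X\<in>bags (foldr Forget vs T). X \<in> bags T \<or> X \<subseteq> root_bag T) \<and> bags T \<subseteq> bags (foldr Forget vs T) \<and>
   nsize (foldr Forget vs T) = nsize T + length vs"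
  by (induction vs) auto

lemma foldr_Introduce:
  "distinct vs \<Longrightarrow> set vs \<inter> (root_bag T \<union> forg T) = {} \<Longrightarrow> good T \<Longrightarrow> good (foldr Introduce vs T) \<and>
   root_bag (foldr Introduce vs T) = root_bag T \<union> set vs \<and>
   forg (foldr Introduce vs T) = forg T \<and>
   (\<forall>X\<in>bags (foldr Introduce vs T). X \<in> bags T \<or> X \<subseteq> root_bag T \<union> set vs) \<and>
   bags T \<subseteq> bags (foldr Introduce vs T) \<and>
   nsize (foldr Introduce vs T) = nsize T + length vs"
  by (induction vs) auto

definition covers :: "ntd \<Rightarrow> edge_entry list \<Rightarrow> bool" where
  "covers T es \<longleftrightarrow> (\<forall>(u, v, a, b) \<in> set es. \<exists>X\<in>bags T. u \<in> X \<and> v \<in> X)"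

text \<open>With an empty root bag every nonempty bag lies below a forget node, so the local tests
  together amount to all edge constraints.\<close>

lemma fbags_check_iff:
  assumes "good T" "root_bag T = {}" "covers T es"
  shows "(\<forall>X\<in>fbags T. check es X q) \<longleftrightarrow> (\<forall>(u, v, a, b) \<in> set es. edge_ok a b (q u) (q v))"
proof
  assume *: "\<forall>X\<in>fbags T. check es X q"
  show "\<forall>(u, v, a, b) \<in> set es. edge_ok a b (q u) (q v)"
  proof clarify
    fix u v a b assume e: "(u, v, a, b) \<in> set es"
    then obtain X where X: "X \<in> bags T" "u \<in> X" "v \<in> X"
      using assms(3) by (fastforce simp: covers_def)
    then obtain Y where "Y \<in> fbags T" "u \<in> Y" "v \<in> Y"
      using bags_fbags[OF X(1) assms(1)] assms(2) by blast
    with * e show "edge_ok a b (q u) (q v)"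
      by (fastforce simp: check_def)
  qed
qed (auto simp: check_def)

lemma ent_root_sound:
  assumes "good T" "root_bag T = {}" "covers T es" "ent es D T p = Some (c, s)"
  shows "(\<forall>v\<in>forg T. look s v \<in> set (D v)) \<and> c = (\<Sum>v\<in>forg T. look s v) \<and>
    (\<forall>(u, v, a, b) \<in> set es. edge_ok a b (look s u) (look s v)) \<and> length s = card (forg T)"
proof -
  obtain q where q: "\<forall>v\<in>forg T. q v \<in> set (D v)" "map_of s = (\<lambda>v. if v \<in> forg T then Some (q v) else None)"
    "length s = card (forg T)" "c = (\<Sum>v\<in>forg T. q v)" "\<forall>X\<in>fbags T. check es X q"
    using ent_sound[OF assms(1,4)] by blast
  have look: "look s v = q v" if "v \<in> forg T" for v
    using that q(2) by (intro look_map_of) auto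
  have "u \<in> forg T \<and> v \<in> forg T" if "(u, v, a, b) \<in> set es" for u v a b
    using that assms(2,3) bags_subset[OF assms(1)] by (fastforce simp: covers_def)
  then have "\<forall>(u, v, a, b) \<in> set es. edge_ok a b (look s u) (look s v)"
    using q(5) look unfolding fbags_check_iff[OF assms(1-3)] by fastforce
  with q look show ?thesis
    by auto
qed

lemma ent_root_opt:
  assumes "good T" "root_bag T = {}" "covers T es" "\<forall>v\<in>forg T. q v \<in> set (D v)"
    "\<forall>(u, v, a, b) \<in> set es. edge_ok a b (q u) (q v)"
  shows "\<exists>c s. ent es D T p = Some (c, s) \<and> c \<le> (\<Sum>v\<in>forg T. q v)"
  using ent_opt[of T q D es] fbags_check_iff[of T es q] ent_cong[of T p q es D] assms by auto

text \<open>No value of \<open>p\<close> exceeds \<open>A\<close>, so weights above \<open>A\<close>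
  cannot be what covers an edge. Each rounded value is within the factor 1 + \<epsilon>/2 of
  \<open>p v\<close> or at most \<epsilon>A/(4n). The latter add up to at most \<epsilon>A/4, which
  is at most \<epsilon>/2 times the total of \<open>p\<close> because the credits are a
  2-approximation.\<close>

lemma rounding:
  assumes es: "edges_ok n es" "feas n es p" and ab: "0 < a" "0 < b" and n: "0 < n"
    and A: "A = fst (credits es)" and le: "(\<Sum>v<n. p v) \<le> real A"
    and D: "\<And>v. v < n \<Longrightarrow> D v = chain es v (4 * n * b) (a * A) (2 * b + a) (2 * b) (max_weight es v 1 (A + 1))"
  shows "\<exists>q. (\<forall>v<n. q v \<in> set (D v)) \<and> (\<forall>(u, v, a, b) \<in> set es. edge_ok a b (q u) (q v)) \<and>
    (\<Sum>v<n. real (q v)) \<le> (1 + real a / real b) * (\<Sum>v<n. p v)"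
proof -
  define r where "r = real a / real b"
  have p: "0 \<le> p v" if "v < n" for v
    using es(2) that by (auto simp: feas_def)
  have pA: "p v \<le> real A" if "v < n" for v
  proof -
    have "p v \<le> (\<Sum>v<n. p v)"
      using p that by (intro member_le_sum) auto
    then show ?thesis
      using le by simp
  qed
  have "\<exists>z\<in>set (D v). (\<forall>e\<in>set es. real (weight_at e v) \<le> p v \<longrightarrow> weight_at e v \<le> z) \<and>
      (real (2 * b) * real z \<le> real (2 * b + a) * p v \<or> 4 * n * b * z \<le> a * A)" if v: "v < n" for v
    unfolding D[OF v]
  proof (rule chain_dominates)
    fix e assume "e \<in> set es" "real (weight_at e v) \<le> p v"
    then show "weight_at e v \<le> max_weight es v 1 (A + 1)"
      using pA[OF v] by (intro max_weight_ge) auto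
  qed (use ab p[OF v] in auto)
  then obtain q where q: "\<And>v. v < n \<Longrightarrow> q v \<in> set (D v)"
    "\<And>v e. v < n \<Longrightarrow> e \<in> set es \<Longrightarrow> real (weight_at e v) \<le> p v \<Longrightarrow> weight_at e v \<le> q v"
    "\<And>v. v < n \<Longrightarrow> real (2 * b) * real (q v) \<le> real (2 * b + a) * p v \<or> 4 * n * b * q v \<le> a * A"
    by metis
  have cost: "real (q v) \<le> (1 + r / 2) * p v + r * real A / (4 * real n)" if v: "v < n" for v
    using q(3)[OF v]
  proof
    assume "real (2 * b) * real (q v) \<le> real (2 * b + a) * p v"
    then have "real (q v) \<le> (1 + r / 2) * p v"
      using ab by (simp add: r_def field_simps)
    moreover have "0 \<le> r * real A / (4 * real n)"
      by (simp add: r_def)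
    ultimately show ?thesis
      by linarith
  next
    assume "4 * n * b * q v \<le> a * A"
    then have "real (4 * n * b * q v) \<le> real (a * A)"
      by (simp only: of_nat_le_iff)
    then have "real (q v) \<le> r * real A / (4 * real n)"
      using ab n by (simp add: r_def field_simps)
    moreover have "0 \<le> (1 + r / 2) * p v"
      using p[OF v] by (simp add: r_def)
    ultimately show ?thesis
      by linarith
  qed
  have "(\<Sum>v<n. real (q v)) \<le> (\<Sum>v<n. (1 + r / 2) * p v + r * real A / (4 * real n))"
    using cost by (intro sum_mono) auto
  also have "\<dots> = (1 + r / 2) * (\<Sum>v<n. p v) + r * real A / 4"
    using n by (simp add: sum.distrib sum_distrib_left)
  also have "r * real A / 4 \<le> r / 2 * (\<Sum>v<n. p v)"
    using mult_left_mono[OF credits_2_approx[OF es], of "r / 4"] by (simp add: r_def A)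
  finally have "(\<Sum>v<n. real (q v)) \<le> (1 + r) * (\<Sum>v<n. p v)"
    by (simp add: algebra_simps)
  moreover have "edge_ok x y (q u) (q v)" if e: "(u, v, x, y) \<in> set es" for u v x y
  proof -
    have uv: "u < n" "v < n" "u \<noteq> v" "0 < x"
      using e es(1) by (auto simp: edges_ok_def)
    have "real x \<le> p u \<or> real y \<le> p v"
      using e es(2) by (auto simp: feas_def)
    then show ?thesis
      using q(2)[OF uv(1) e] q(2)[OF uv(2) e] uv by (auto simp: edge_ok_def)
  qed
  ultimately show ?thesis
    using q(1) by (intro exI[of _ q]) (auto simp: r_def)
qed

section \<open>The program that solves an instance along a given tree\<close>

abbreviation "F_dp \<equiv> 19 :: nat"
abbreviation "F_forgets \<equiv> 20 :: nat"
abbreviation "F_introduces \<equiv> 21 :: nat"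
abbreviation "F_cred \<equiv> 22 :: nat"
abbreviation "F_step \<equiv> 23 :: nat"
abbreviation "F_min2 \<equiv> 24 :: nat"
abbreviation "F_out \<equiv> 25 :: nat"
abbreviation "F_maxw \<equiv> 26 :: nat"
abbreviation "F_wt \<equiv> 27 :: nat"
abbreviation "F_pick \<equiv> 28 :: nat"
abbreviation "F_chain \<equiv> 29 :: nat"
abbreviation "F_doms \<equiv> 30 :: nat"
abbreviation "F_solve \<equiv> 31 :: nat"
abbreviation "F_solve2 \<equiv> 32 :: nat"

definition "body_dp_root = Call F_ent [Call F_comp [Var 0, Var 1, Var 2], Const 0]"

definition "body_forgets = Cond (IsCell (Var 0))
  (Cons2 (Const 2) (Cons2 (First (Var 0)) (Call F_forgets [Second (Var 0), Var 1]))) (Var 1)"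

definition "body_introduces = Cond (IsCell (Var 0))
  (Cons2 (Const 1) (Cons2 (First (Var 0)) (Call F_introduces [Second (Var 0), Var 1]))) (Var 1)"

definition "body_cred = Cond (IsCell (Var 0))
  (Call F_step [First (Var 0), Call F_cred [Second (Var 0)]]) (Cons2 (Const 0) (Const 0))"

definition "body_step =
  Bind (Call F_look [Second (Var 1), e_u (Var 0)])
    (Bind (Call F_look [Second (Var 2), e_v (Var 1)])
      (Bind (Call F_min2 [Op Minus (e_a (Var 2)) (Var 1), Op Minus (e_b (Var 2)) (Var 0)])
        (Cons2 (Op Plus (First (Var 4)) (Op Plus (Var 0) (Var 0)))
          (Cons2 (Cons2 (e_u (Var 3)) (Op Plus (Var 2) (Var 0)))
            (Cons2 (Cons2 (e_v (Var 3)) (Op Plus (Var 1) (Var 0))) (Second (Var 4)))))))"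

definition "body_min2 = Cond (Op Less (Var 0) (Var 1)) (Var 0) (Var 1)"

definition "body_out = Cond (Var 0)
  (Call F_out [Op Minus (Var 0) (Const 1), Var 1,
    Cons2 (Call F_look [Var 1, Op Minus (Var 0) (Const 1)]) (Var 2)])
  (Var 2)"

definition "body_maxw = Cond (IsCell (Var 0))
  (Call F_pick [Call F_wt [First (Var 0), Var 1], Call F_maxw [Second (Var 0), Var 1, Var 2, Var 3],
    Var 2, Var 3])
  (Const 0)"

definition "body_wt = Cond (Op Equal (e_u (Var 0)) (Var 1)) (e_a (Var 0))
  (Cond (Op Equal (e_v (Var 0)) (Var 1)) (e_b (Var 0)) (Const 0))"

definition "body_pick = Cond (Op Less (Op Times (Var 0) (Var 2)) (Var 3))
  (Cond (Op Less (Var 1) (Var 0)) (Var 0) (Var 1)) (Var 1)"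

definition "body_chain = Cond (Op Less (Var 4) (Op Times (Var 3) (Var 0)))
  (Cons2 (Var 0) (Call F_chain [Call F_maxw [Var 2, Var 1, Var 5, Op Times (Var 6) (Var 0)],
    Var 1, Var 2, Var 3, Var 4, Var 5, Var 6]))
  (Cons2 (Var 0) (Const 0))"

definition "body_doms = Cond (Var 0)
  (Bind (Op Minus (Var 0) (Const 1))
    (Cons2
      (Cons2 (Var 0) (Call F_chain [Call F_maxw [Var 2, Var 0, Const 1, Var 7], Var 0,
        Var 2, Var 3, Var 4, Var 5, Var 6]))
      (Call F_doms [Var 0, Var 2, Var 3, Var 4, Var 5, Var 6, Var 7])))
  (Const 0)"

definition "body_solve = Call F_solve2 [Var 0, Var 1, Var 2, Var 3, Var 4, Call F_cred [Var 1]]"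

definition "body_solve2 = Call F_out [Var 0,
  Cond (Op Less (Var 3) (Var 4))
    (Second (Call F_dp [Call F_forgets [Call F_bag [Var 2], Var 2], Var 1,
      Call F_doms [Var 0, Var 1, Op Times (Op Times (Const 4) (Var 0)) (Var 4),
        Op Times (Var 3) (First (Var 5)),
        Op Plus (Op Times (Const 2) (Var 4)) (Var 3), Op Times (Const 2) (Var 4),
        Op Plus (First (Var 5)) (Const 1)]]))
    (Second (Var 5)),
  Const 0]"

locale prog_solve = prog_dp +
  assumes length_solve: "32 < length P"
    and body_solve: "P ! F_dp = body_dp_root" "P ! F_forgets = body_forgets"
      "P ! F_introduces = body_introduces" "P ! F_cred = body_cred" "P ! F_step = body_step"
      "P ! F_min2 = body_min2" "P ! F_out = body_out" "P ! F_maxw = body_maxw" "P ! F_wt = body_wt"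
      "P ! F_pick = body_pick" "P ! F_chain = body_chain" "P ! F_doms = body_doms"
      "P ! F_solve = body_solve" "P ! F_solve2 = body_solve2"
    and W_ge_4: "4 \<le> W"
begin

lemma index_solve [simp]: "k \<le> 32 \<Longrightarrow> k < length P"
  using length_solve by simp

lemma const_4_le_W [simp]: "4 \<le> W"
  using W_ge_4 .

lemma ret_forgets: "ret F_forgets [enc_list Num vs, enc_ntd T] (enc_ntd (foldr Forget vs T)) (length vs + 1)"
proof (induction vs)
  case Nil
  show ?case
    by (rule retI) (simp_all add: body_solve body_forgets_def)
next
  case (Cons v vs)
  show ?case
    by (rule retI, simp) (auto simp: body_solve body_forgets_def intro!: callI[OF Cons.IH])
qed

lemma ret_introduces: "ret F_introduces [enc_list Num vs, enc_ntd T] (enc_ntd (foldr Introduce vs T)) (length vs + 1)"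
proof (induction vs)
  case Nil
  show ?case
    by (rule retI) (simp_all add: body_solve body_introduces_def)
next
  case (Cons v vs)
  show ?case
    by (rule retI, simp) (auto simp: body_solve body_introduces_def intro!: callI[OF Cons.IH])
qed

lemma ret_out:
  "k \<le> W \<Longrightarrow> length \<sigma> \<le> L \<Longrightarrow> ret F_out [Num k, enc_assoc Num \<sigma>, enc_list Num xs]
    (enc_list Num (map (look \<sigma>) [0..<k] @ xs)) (k * (L + 2) + 1)"
proof (induction k arbitrary: xs)
  case 0
  show ?case
    by (rule retI) (simp_all add: body_solve body_out_def)
next
  case (Suc k)
  then show ?case
    using Suc.IH[of "look \<sigma> k # xs"]
    by (intro retI, simp) (auto simp: body_solve body_out_def
      intro!: callI[OF ret_look] callI[OF Suc.IH[of "look \<sigma> k # xs", simplified]])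
qed

lemma ret_min2: "ret F_min2 [Num x, Num y] (Num (min x y)) 1"
  by (rule retI) (auto simp: body_solve body_min2_def)

lemma ret_wt: "ret F_wt [enc_edge e, Num v] (Num (weight_at e v)) 1"
  by (cases e, rule retI) (auto simp: body_solve body_wt_def)

lemma ret_pick:
  "m * p \<le> W \<Longrightarrow> ret F_pick [Num m, Num r, Num p, Num q] (Num (if m * p < q then if r < m then m else r else r)) 1"
  by (rule retI) (auto simp: body_solve body_pick_def)

lemma ret_maxw:
  "(\<And>e. e \<in> set es \<Longrightarrow> weight_at e v * p \<le> W) \<Longrightarrow>
   ret F_maxw [enc_list enc_edge es, Num v, Num p, Num q] (Num (max_weight es v p q)) (3 * length es + 1)"
proof (induction es)
  case Nil
  show ?case
    by (rule retI) (simp_all add: body_solve body_maxw_def)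
next
  case (Cons e es)
  have IH: "ret F_maxw [enc_list enc_edge es, Num v, Num p, Num q] (Num (max_weight es v p q)) (3 * length es + 1)"
    using Cons.prems by (intro Cons.IH) simp
  have "weight_at e v * p \<le> W"
    using Cons.prems[of e] by simp
  then show ?case
    by (intro retI, simp) (auto simp: body_solve body_maxw_def Let_def
      intro!: callI[OF IH] callI[OF ret_wt] callI[OF ret_pick])
qed

lemma ret_chain:
  assumes "0 < q" "q < p" and le: "\<And>e. e \<in> set es \<Longrightarrow> weight_at e v * p \<le> W"
  shows "K1 * x \<le> W \<Longrightarrow> q * x \<le> W \<Longrightarrow>
    ret F_chain [Num x, Num v, enc_list enc_edge es, Num K1, Num K2, Num p, Num q]
      (enc_list Num (chain es v K1 K2 p q x)) (length (chain es v K1 K2 p q x) * (3 * length es + 2) + 1)"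
proof (induction x rule: less_induct)
  case (less x)
  show ?case
  proof (cases "K2 < K1 * x")
    case True
    let ?y = "max_weight es v p (q * x)"
    have y: "?y < x"
      using max_weight_decr[OF assms(1,2) True] .
    then have "K1 * ?y \<le> W" "q * ?y \<le> W"
      using less.prems by (meson less_imp_le mult_le_mono2 order.trans)+
    note IH = less.IH[OF y this]
    have m: "ret F_maxw [enc_list enc_edge es, Num v, Num p, Num (q * x)] (Num ?y) (3 * length es + 1)"
      using le by (rule ret_maxw)
    show ?thesis
      using True less.prems
      by (intro retI, simp) (auto simp: body_solve body_chain_def chain_simps[OF assms(1,2), of _ _ _ _ x]
        intro!: callI[OF m] callI[OF IH])
  next
    case False
    then show ?thesis
      using less.prems
      by (intro retI, simp) (auto simp: body_solve body_chain_def chain_simps[OF assms(1,2), of _ _ _ _ x])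
  qed
qed

lemma length_credits: "length (snd (credits es)) = 2 * length es"
  by (induction es rule: credits.induct) (auto simp: Let_def)

text \<open>The bound on the total is carried through the induction because the additions have a
  result only within the word length. It comes from the bound \<open>M\<close> on each single
  credit, not from the number of edges.\<close>

lemma ret_cred:
  assumes "edges_ok n es" "\<And>u v a b. (u, v, a, b) \<in> set es \<Longrightarrow> a \<le> M \<and> b \<le> M" "n * M \<le> W"
  shows "ret F_cred [enc_list enc_edge es] (Cell (Num (fst (credits es))) (enc_assoc Num (snd (credits es))))
    (length es * (4 * length es + 8) + 1) \<and> fst (credits es) \<le> n * M"
  using assms(1,2)
proof (induction es)
  case Nil
  show ?case
    by (auto intro!: retI simp: body_solve body_cred_def)
next
  case (Cons e es)
  obtain u v a b where e: "e = (u, v, a, b)"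
    by (cases e)
  obtain A c where c: "credits es = (A, c)"
    by (cases "credits es")
  have len: "length c = 2 * length es"
    using length_credits[of es] c by simp
  have IH: "ret F_cred [enc_list enc_edge es] (Cell (Num A) (enc_assoc Num c))
    (length es * (4 * length es + 8) + 1)" 
    using Cons by (auto simp: e c)
  have bound: "fst (credits (e # es)) \<le> n * M"
  proof -
    have "real (fst (credits (e # es))) = (\<Sum>i<n. real (credit (e # es) i))"
      using sum_credit[OF Cons.prems(1)] by simp
    also have "\<dots> \<le> (\<Sum>i<n. real M)"
      using credit_le[of "e # es" M] Cons.prems(2) by (intro sum_mono) (auto simp del: of_nat_sum)
    also have "\<dots> = real (n * M)"
      by simp
    finally show ?thesis
      by (simp only: of_nat_le_iff)
  qed
  define d where "d = min (a - look c u) (b - look c v)"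
  have uv: "u \<noteq> v" "u < n"
    using Cons.prems(1) by (auto simp: e)
  have cr: "credits (e # es) = (A + (d + d), (u, look c u + d) # (v, look c v + d) # c)"
    by (simp add: e c Let_def d_def)
  have M: "M \<le> W"
    using uv(2) assms(3) order.trans[of M "n * M" W] by (cases n) auto
  have "credit (e # es) u = look c u + d" "credit (e # es) v = look c v + d"
    using uv by (simp_all add: credit_def cr)
  moreover have "credit (e # es) i \<le> M" for i
    using Cons.prems(2) by (rule credit_le)
  ultimately have x: "look c u + d \<le> W" "look c v + d \<le> W"
    using M by (metis order.trans)+
  have A: "A + (d + d) \<le> W"
    using bound assms(3) by (simp add: cr)
  have "a \<le> W" "b \<le> W"
    using Cons.prems(2)[of u v a b] M by (auto simp: e)
  then have ab: "a - z \<le> W" "b - z \<le> W" for z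
    by auto
  have st: "ret F_step [enc_edge e, Cell (Num A) (enc_assoc Num c)]
    (Cell (Num (A + (d + d))) (enc_assoc Num ((u, look c u + d) # (v, look c v + d) # c))) (4 * length es + 4)"
    using x A ab len unfolding e
    by (intro retI, simp) (auto simp: body_solve body_step_def d_def
      intro!: callI[OF ret_look] callI[OF ret_min2])
  have "ret F_cred [enc_list enc_edge (e # es)] (Cell (Num (fst (credits (e # es))))
    (enc_assoc Num (snd (credits (e # es))))) (length (e # es) * (4 * length (e # es) + 8) + 1)"
    unfolding cr
    by (intro retI, simp) (auto simp: body_solve body_cred_def algebra_simps intro!: callI[OF IH] callI[OF st, simplified])
  with bound show ?case
    by blast
qed

end

text \<open>All tests are cleared of denominators for \<epsilon> = a/b: the ratio 1 + \<epsilon>/2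
  is (2b + a)/(2b), the cutoff x \<le> \<epsilon>A/(4n) becomes 4nbx \<le> aA, and the start is the
  largest weight below A + 1.\<close>

definition domain :: "edge_entry list \<Rightarrow> nat \<Rightarrow> nat \<Rightarrow> nat \<Rightarrow> nat \<Rightarrow> nat list" where
  "domain es n a b v = (let A = fst (credits es) in
     chain es v (4 * n * b) (a * A) (2 * b + a) (2 * b) (max_weight es v 1 (A + 1)))"

definition domain_list :: "edge_entry list \<Rightarrow> nat \<Rightarrow> nat \<Rightarrow> nat \<Rightarrow> nat \<Rightarrow> (nat \<times> nat list) list" where
  "domain_list es n a b k = map (\<lambda>v. (v, domain es n a b v)) (rev [0..<k])"

lemma doms_domain_list: "doms (domain_list es n a b k) v = (if v < k then domain es n a b v else [])"
  unfolding doms_def domain_list_def by (induction k) auto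

definition comp_cost :: "nat \<Rightarrow> nat \<Rightarrow> nat \<Rightarrow> nat" where
  "comp_cost N \<Delta> w = N * node_cost N \<Delta> w + N * ent_cost N \<Delta> + 2"

definition solve_cost :: "nat \<Rightarrow> nat \<Rightarrow> nat \<Rightarrow> nat" where
  "solve_cost N \<Delta> w = comp_cost N \<Delta> w + N * (4 * N + 8) + N * (N + 2) + N + N * (3 * N + \<Delta> * (3 * N + 2) + 4) + N * (2 * N + 2) + 10"

lemma (in dp_run) ret_dp:
  assumes "prog_solve P W S" "w \<le> N" "\<forall>X\<in>bags T. card X \<le> w" "good T" "root_bag T = {}" "forg T \<subseteq> {..<n}" "nsize T \<le> N"
  shows "ret F_dp [enc_ntd T, enc_list enc_edge es, enc_assoc (enc_list Num) Dl]
    (enc_entry (ent es (doms Dl) T (look []))) (comp_cost N \<Delta> w)"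
proof -
  interpret prog_solve P W S
    by fact
  obtain r where r: "ret F_comp [enc_ntd T, enc_list enc_edge es, enc_assoc (enc_list Num) Dl] r
    (nsize T * c_comp w)" "table_ok r T"
    using ret_comp[OF assms(2-4)] assms(5-7) by auto
  have e: "ret F_ent [r, enc_assoc Num []] (enc_entry (ent es (doms Dl) T (look []))) (nsize T * c_ent)"
    using r(2)[unfolded table_ok_def, rule_format, of "[]"] assms(5) by simp
  have "nsize T * c_comp w \<le> N * c_comp w" "nsize T * c_ent \<le> N * c_ent"
    using assms(7) by (auto intro: mult_le_mono1)
  then have "nsize T * c_comp w + nsize T * c_ent < comp_cost N \<Delta> w"
    unfolding comp_cost_def by linarith
  then show ?thesis
    by (intro retI, simp) (auto simp: body_solve body_dp_root_def intro!: callI[OF r(1)] callI[OF e[simplified]])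
qed

context prog_solve
begin

lemma ret_doms:
  assumes b: "0 < a" "0 < b" and M: "\<And>e v. e \<in> set es \<Longrightarrow> weight_at e v \<le> M"
    and W: "M * (2 * b + a) \<le> W" "M \<le> W" "4 * n * b * M \<le> W" "2 * b * M \<le> W"
    and A: "A = fst (credits es)"
  shows "k \<le> W \<Longrightarrow> (\<And>v. v < k \<Longrightarrow> length (domain es n a b v) \<le> \<Delta>) \<Longrightarrow>
    ret F_doms [Num k, enc_list enc_edge es, Num (4 * n * b), Num (a * A), Num (2 * b + a), Num (2 * b), Num (A + 1)]
     (enc_assoc (enc_list Num) (domain_list es n a b k))
     (k * (3 * length es + \<Delta> * (3 * length es + 2) + 3) + 1)"
proof (induction k)
  case 0
  show ?case
    by (rule retI) (simp_all add: body_solve body_doms_def domain_list_def)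
next
  case (Suc k)
  let ?x = "max_weight es k 1 (A + 1)"
  have m: "ret F_maxw [enc_list enc_edge es, Num k, Num 1, Num (A + 1)] (Num ?x) (3 * length es + 1)"
    using M W(2) by (intro ret_maxw) (metis mult_1_right order.trans)
  have "?x \<le> M"
    using max_weight_in[of es k 1 "A + 1"] M by auto
  then have K: "4 * n * b * ?x \<le> W" "2 * b * ?x \<le> W"
    using W by (meson mult_le_mono2 order.trans)+
  have p: "0 < 2 * b" "2 * b < 2 * b + a"
    using b by auto
  have wt: "weight_at e k * (2 * b + a) \<le> W" if "e \<in> set es" for e
    using M[OF that, of k] W(1) by (meson mult_le_mono1 order.trans)
  have len: "length (domain es n a b k) * (3 * length es + 2) \<le> \<Delta> * (3 * length es + 2)"
    using Suc.prems(2)[of k] by (intro mult_le_mono1) simp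
  have dom_eq: "domain es n a b k = chain es k (4 * n * b) (a * A) (2 * b + a) (2 * b) ?x"
    by (simp add: domain_def A Let_def)
  have c: "ret F_chain [Num ?x, Num k, enc_list enc_edge es, Num (4 * n * b), Num (a * A), Num (2 * b + a), Num (2 * b)]
     (enc_list Num (domain es n a b k)) (\<Delta> * (3 * length es + 2) + 1)"
    unfolding dom_eq
    by (rule ret_mono, rule ret_chain[OF p wt K]) (assumption, use len[unfolded dom_eq] in linarith)
  have IH: "ret F_doms [Num k, enc_list enc_edge es, Num (4 * n * b), Num (a * A), Num (2 * b + a), Num (2 * b), Num (A + 1)]
     (enc_assoc (enc_list Num) (domain_list es n a b k))
     (k * (3 * length es + \<Delta> * (3 * length es + 2) + 3) + 1)"
    using Suc.prems by (intro Suc.IH) auto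
  show ?case
    using Suc.prems(1)
    by (intro retI, simp) (auto simp: body_solve body_doms_def domain_list_def
      intro!: callI[OF m[simplified]] callI[OF c[simplified]] callI[OF IH[simplified domain_list_def, simplified]])
qed

lemma ret_solve:
  assumes es: "edges_ok n es" "\<And>u v a b. (u, v, a, b) \<in> set es \<Longrightarrow> a \<le> M \<and> b \<le> M"
    and T: "good T" "root_bag T \<union> forg T = {..<n}" "covers T es" "\<forall>X\<in>bags T. card X \<le> w"
    and N: "w \<le> N" "length es \<le> N" "nsize T + n \<le> N"
    and ab: "0 < a" "0 < b"
    and \<Delta>: "1 \<le> \<Delta>" "\<And>v. a < b \<Longrightarrow> v < n \<Longrightarrow> length (domain es n a b v) \<le> \<Delta>"
    and W: "n \<le> W" "n * M + 1 \<le> W" "4 * n * b \<le> W" "4 * n * b * M \<le> W" "a * (n * M) \<le> W"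
      "M * (2 * b + a) \<le> W" "2 * b + a \<le> W" "2 * M \<le> W"
  shows "\<exists>s. ret F_solve [Num n, enc_list enc_edge es, enc_ntd T, Num a, Num b]
      (enc_list Num (map s [0..<n])) (solve_cost N \<Delta> w) \<and>
    feas n es (\<lambda>v. real (s v)) \<and>
    (\<forall>p. feas n es p \<longrightarrow> (\<Sum>v<n. real (s v)) \<le> (1 + real a / real b) * (\<Sum>v<n. p v))"
proof -
  obtain A c where Ac: "credits es = (A, c)"
    by (cases "credits es")
  have A: "A = fst (credits es)"
    by (simp add: Ac)
  have cred: "ret F_cred [enc_list enc_edge es] (Cell (Num A) (enc_assoc Num c)) (length es * (4 * length es + 8) + 1)"
    and A_le: "A \<le> n * M"
    using ret_cred[OF es] W(2) by (auto simp: Ac)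
  have len_c: "length c = 2 * length es"
    using length_credits[of es] Ac by simp
  have cred': "ret F_cred [enc_list enc_edge es] (Cell (Num A) (enc_assoc Num c)) (N * (4 * N + 8) + 1)"
    using N(2) by (intro ret_mono[OF cred] add_mono mult_le_mono) auto
  have step: "ret F_solve [Num n, enc_list enc_edge es, enc_ntd T, Num a, Num b] v (d + N * (4 * N + 8) + 2)"
    if "ret F_solve2 [Num n, enc_list enc_edge es, enc_ntd T, Num a, Num b, Cell (Num A) (enc_assoc Num c)] v d"
    for v d
    by (intro retI, simp) (auto simp: body_solve body_solve_def intro!: callI[OF cred'] callI[OF that])
  have feas_c: "feas n es (\<lambda>v. real (look c v))" "(\<Sum>v<n. real (look c v)) = real A"
    using credit_feas[OF es(1)] sum_credit[OF es(1)] by (simp_all add: credit_def Ac)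
  show ?thesis
  proof (cases "a < b")
    case False
    have o: "ret F_out [Num n, enc_assoc Num c, enc_list Num []] (enc_list Num (map (look c) [0..<n] @ [])) (n * (2 * N + 2) + 1)"
      using W(1) N(2) len_c by (intro ret_out) auto
    have "n * (2 * N + 2) \<le> N * (2 * N + 2)"
      using N(3) by (intro mult_le_mono1) simp
    then have "ret F_solve2 [Num n, enc_list enc_edge es, enc_ntd T, Num a, Num b, Cell (Num A) (enc_assoc Num c)]
      (enc_list Num (map (look c) [0..<n])) (N * (2 * N + 2) + 2)"
      using False by (intro retI, simp) (auto simp: body_solve body_solve2_def intro!: callI[OF o[simplified]])
    from ret_mono[OF step[OF this]] have "ret F_solve [Num n, enc_list enc_edge es, enc_ntd T, Num a, Num b]
      (enc_list Num (map (look c) [0..<n])) (solve_cost N \<Delta> w)"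
      by (simp add: solve_cost_def)
    moreover have "(\<Sum>v<n. real (look c v)) \<le> (1 + real a / real b) * (\<Sum>v<n. p v)" if p: "feas n es p" for p
    proof -
      have "0 \<le> (\<Sum>v<n. p v)"
        using p by (intro sum_nonneg) (auto simp: feas_def)
      then have "2 * (\<Sum>v<n. p v) \<le> (1 + real a / real b) * (\<Sum>v<n. p v)"
        using False ab by (intro mult_right_mono) (auto simp: field_simps)
      then show ?thesis
        using credits_2_approx[OF es(1) p] feas_c(2) A by linarith
    qed
    ultimately show ?thesis
      using feas_c(1) by blast
  next
    case True
    \<comment> \<open>Forgetting the whole root bag leaves a single entry, which contains the values
      of all vertices.\<close>
    define T' where "T' = foldr Forget (bag_list T) T"
    define Dl where "Dl = domain_list es n a b n"
    have T': "good T'" "root_bag T' = {}" "forg T' = {..<n}" "covers T' es" "\<forall>X\<in>bags T'. card X \<le> w"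
      "nsize T' \<le> N"
    proof -
      have len: "length (bag_list T) \<le> n"
        using length_bag_list_le[OF T(1), of n] T(2) by simp
      have w: "card X \<le> w" if "X \<subseteq> root_bag T" for X
        using card_mono[OF finite_root_bag that] T(4) root_bag_in_bags[of T] by (meson order.trans)
      note f = foldr_Forget[OF distinct_bag_list[OF T(1)] _ T(1), unfolded set_bag_list, OF order_refl, folded T'_def]
      show "good T'" "root_bag T' = {}" "forg T' = {..<n}"
        using f T(2) by (simp_all add: Un_commute)
      show "nsize T' \<le> N"
        using f len N(3) by linarith
      show "\<forall>X\<in>bags T'. card X \<le> w"
        using f T(4) w by metis
      have "bags T \<subseteq> bags T'"
        using f by simp
      then show "covers T' es"
        using T(3) unfolding covers_def by fast
    qed
    have doms: "doms Dl v = (if v < n then domain es n a b v else [])" for v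
      by (simp add: Dl_def doms_domain_list)
    have wt: "weight_at e v \<le> M" if "e \<in> set es" for e v
      using es(2) that by (cases e) force
    have mw: "max_weight es v p q \<le> M" for v p q
      using max_weight_in[of es v p q] wt by auto
    interpret dp_run P W S es Dl n N M \<Delta>
    proof
      show "x \<le> M" if "x \<in> set (doms Dl v)" for x v
        using that by (auto simp: doms domain_def Let_def split: if_splits dest!: chain_le intro: order.trans[OF _ mw])
      show "length Dl \<le> N"
        using N(3) by (simp add: Dl_def domain_list_def)
    qed (use N W \<Delta> True in \<open>auto simp: doms\<close>)
    obtain p0 where p0: "feas n es p0" "(\<Sum>v<n. p0 v) = real A"
      using feas_c by blast
    have opt: "\<exists>q. (\<forall>v<n. q v \<in> set (doms Dl v)) \<and> (\<forall>(u, v, a, b) \<in> set es. edge_ok a b (q u) (q v)) \<and>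
      (\<Sum>v<n. real (q v)) \<le> (1 + real a / real b) * (\<Sum>v<n. p v)"
      if p: "feas n es p" "(\<Sum>v<n. p v) \<le> real A" for p
    proof (cases "n = 0")
      case True
      then have "es = []"
        using es(1) by (cases es) (auto simp: edges_ok_def)
      with True show ?thesis
        by simp
    next
      case False
      then show ?thesis
        by (intro rounding[OF es(1) p(1) ab _ A p(2)]) (auto simp: doms domain_def A Let_def)
    qed
    define e where "e = ent es (doms Dl) T' (look [])"
    have ent_le: "\<exists>c s. e = Some (c, s) \<and> real c \<le> (1 + real a / real b) * (\<Sum>v<n. p v)"
      if p: "feas n es p" "(\<Sum>v<n. p v) \<le> real A" for p
    proof -
      obtain q where q: "\<forall>v<n. q v \<in> set (doms Dl v)" "\<forall>(u, v, a, b) \<in> set es. edge_ok a b (q u) (q v)"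
        "(\<Sum>v<n. real (q v)) \<le> (1 + real a / real b) * (\<Sum>v<n. p v)"
        using opt[OF p] by blast
      obtain c s where "e = Some (c, s)" "c \<le> (\<Sum>v<n. q v)"
        using ent_root_opt[OF T'(1,2,4), of q "doms Dl" "look []"] q T'(3) by (auto simp: e_def)
      moreover from this have "real c \<le> (\<Sum>v<n. real (q v))"
        by (metis of_nat_le_iff of_nat_sum)
      ultimately show ?thesis
        using q(3) by force
    qed
    then obtain k s where s: "e = Some (k, s)"
      using p0 by (metis order_refl)
    \<comment> \<open>\<open>rounding\<close> applies only to solutions of total at most
      \<open>A\<close>. A more expensive one is compared with the credits themselves, which are
      feasible and have total exactly \<open>A\<close>.\<close>
    have k: "real k \<le> (1 + real a / real b) * (\<Sum>v<n. p v)" if p: "feas n es p" for p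
    proof (cases "(\<Sum>v<n. p v) \<le> real A")
      case True
      then show ?thesis
        using ent_le[OF p] s by auto
    next
      case False
      have "real k \<le> (1 + real a / real b) * real A"
        using ent_le[OF p0(1)] p0(2) s by auto
      also have "\<dots> \<le> (1 + real a / real b) * (\<Sum>v<n. p v)"
        using False by (intro mult_left_mono) auto
      finally show ?thesis .
    qed
    note snd = ent_root_sound[OF T'(1,2,4) s[unfolded e_def], unfolded T'(3)]
    have feas_s: "feas n es (\<lambda>v. real (look s v))"
      using snd es(1) by (fastforce simp: feas_def edge_ok_def edges_ok_def)
    have ks: "real k = (\<Sum>v<n. real (look s v))"
      using snd by simp
    have len_s: "length s \<le> 2 * N"
      using snd N(3) by simp
    have bag: "ret F_bag [enc_ntd T] (enc_list Num (bag_list T)) (N * (N + 2))"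
    proof (rule ret_mono[OF ret_bag[OF T(1), of n]])
      show "nsize T * (n + 2) \<le> N * (N + 2)"
        using N(3) by (intro mult_le_mono) auto
    qed (use T(2) in auto)
    have fg: "ret F_forgets [enc_list Num (bag_list T), enc_ntd T] (enc_ntd T') (N + 1)"
      using ret_mono[OF ret_forgets[of "bag_list T" T], of "N + 1"] length_bag_list_le[OF T(1), of n] T(2) N(3)
      by (simp add: T'_def)
    have W2: "2 * b * M \<le> W" "M \<le> W"
      using W(6,8) by (auto simp: algebra_simps)
    have "ret F_doms [Num n, enc_list enc_edge es, Num (4 * n * b), Num (a * A), Num (2 * b + a), Num (2 * b), Num (A + 1)]
     (enc_assoc (enc_list Num) Dl) (n * (3 * length es + \<Delta> * (3 * length es + 2) + 3) + 1)"
      unfolding Dl_def using True \<Delta>(2) wt W W2 ab A by (intro ret_doms[where M = M]) auto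
    then have dms: "ret F_doms [Num n, enc_list enc_edge es, Num (4 * n * b), Num (a * A), Num (2 * b + a), Num (2 * b), Num (A + 1)]
     (enc_assoc (enc_list Num) Dl) (N * (3 * N + \<Delta> * (3 * N + 2) + 3) + 1)"
      by (rule ret_mono) (use N in \<open>auto intro!: add_mono mult_le_mono\<close>)
    have dp: "ret F_dp [enc_ntd T', enc_list enc_edge es, enc_assoc (enc_list Num) Dl] (enc_entry e) (comp_cost N \<Delta> w)"
      unfolding e_def using T' N prog_solve_axioms by (intro ret_dp) auto
    have "ret F_out [Num n, enc_assoc Num s, enc_list Num []] (enc_list Num (map (look s) [0..<n] @ [])) (n * (2 * N + 2) + 1)"
      using W(1) len_s by (intro ret_out) auto
    then have o: "ret F_out [Num n, enc_assoc Num s, enc_list Num []] (enc_list Num (map (look s) [0..<n] @ [])) (N * (2 * N + 2) + 1)"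
      by (rule ret_mono) (use N(3) in \<open>auto intro!: add_mono mult_le_mono\<close>)
    have Wa: "4 * n \<le> W" "a * A \<le> W" "A + 1 \<le> W" "2 * b \<le> W"
    proof -
      show "4 * n \<le> W"
        using W(3) ab(2) by (cases b) auto
      show "a * A \<le> W"
        using A_le W(5) by (meson mult_le_mono2 order.trans)
    qed (use A_le W in auto)
    have "ret F_solve2 [Num n, enc_list enc_edge es, enc_ntd T, Num a, Num b, Cell (Num A) (enc_assoc Num c)]
      (enc_list Num (map (look s) [0..<n]))
      (N * (N + 2) + (N + 1) + (N * (3 * N + \<Delta> * (3 * N + 2) + 3) + 1) + comp_cost N \<Delta> w + (N * (2 * N + 2) + 1) + 1)"
      using True Wa W s
      by (intro retI, simp) (auto simp: body_solve body_solve2_def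
        intro!: callI[OF bag[simplified]] callI[OF fg[simplified]] callI[OF dms[simplified]] callI[OF dp] callI[OF o[simplified]])
    from ret_mono[OF step[OF this]] have "ret F_solve [Num n, enc_list enc_edge es, enc_ntd T, Num a, Num b]
      (enc_list Num (map (look s) [0..<n])) (solve_cost N \<Delta> w)"
      by (simp add: solve_cost_def algebra_simps)
    then show ?thesis
      using feas_s k ks by auto
  qed
qed

end

section \<open>Tree decompositions\<close>

definition occ :: "ntd \<Rightarrow> nat \<Rightarrow> bool list set" where
  "occ T v = {q \<in> ntd_nodes T. v \<in> ntd_bag T q}"

text \<open>A connected set of tree nodes that meets both sides of an edge contains both its ends.\<close>

definition occ_connected :: "ntd \<Rightarrow> bool" where
  "occ_connected T \<longleftrightarrow> (\<forall>v p d x y. p @ d # x \<in> occ T v \<longrightarrow> y \<in> occ T v \<longrightarrow> (\<forall>z. y \<noteq> p @ d # z) \<longrightarrow>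
     p \<in> occ T v \<and> p @ [d] \<in> occ T v)"

text \<open>The nodes below \<open>p @ [d]\<close> are attached to the rest of the tree only through
  the edge from \<open>p\<close> to \<open>p @ [d]\<close>, so a walk that leaves them passes both
  ends of it.\<close>

lemma connected_on_crossing:
  assumes "connected_on (ntd_edges T) X" "p @ d # x \<in> X" "y \<in> X" "\<forall>z. y \<noteq> p @ d # z"
  shows "p \<in> X \<and> p @ [d] \<in> X"
proof -
  have "(p @ d # x, y) \<in> {(u, v). u \<in> X \<and> v \<in> X \<and> {u, v} \<in> ntd_edges T}\<^sup>*"
    using assms(1-3) by (auto simp: connected_on_def)
  then have "(\<exists>z. y = p @ d # z) \<or> p \<in> X \<and> p @ [d] \<in> X"
  proof induction
    case (step y z)
    then have yz: "y \<in> X" "z \<in> X" "{y, z} \<in> ntd_edges T"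
      by auto
    from yz(3) obtain q e where q: "{y, z} = {q, q @ [e]}"
      by (auto simp: ntd_edges_def)
    show ?case
    proof (cases "p \<in> X \<and> p @ [d] \<in> X")
      case False
      with step.IH obtain w where w: "y = p @ d # w"
        by blast
      from q consider "y = q" "z = q @ [e]" | "y = q @ [e]" "z = q"
        by (auto simp: doubleton_eq_iff)
      then show ?thesis
      proof cases
        case 1
        then have "z = p @ d # (w @ [e])"
          using w by simp
        then show ?thesis
          by blast
      next
        case 2
        show ?thesis
        proof (cases w rule: rev_cases)
          case Nil
          with 2 w have "z = p"
            by auto
          with yz w Nil show ?thesis
            by simp
        next
          case (snoc w' f)
          with 2 w show ?thesis
            by (auto simp: append_eq_append_conv2 Cons_eq_append_conv)
        qed
      qed
    qed blast
  qed auto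
  then show ?thesis
    using assms(4) by blast
qed

lemma occ_connected_sub:
  assumes "occ_connected T" "\<And>v q. d0 # q \<in> occ T v \<longleftrightarrow> q \<in> occ T' v"
  shows "occ_connected T'"
  unfolding occ_connected_def
proof (intro allI impI)
  fix v p d x y
  assume "p @ d # x \<in> occ T' v" "y \<in> occ T' v" "\<forall>z. y \<noteq> p @ d # z"
  then have "(d0 # p) @ d # x \<in> occ T v" "d0 # y \<in> occ T v" "\<forall>z. d0 # y \<noteq> (d0 # p) @ d # z"
    by (simp_all add: assms(2))
  then have "d0 # p \<in> occ T v \<and> (d0 # p) @ [d] \<in> occ T v"
    using assms(1) unfolding occ_connected_def by blast
  then show "p \<in> occ T' v \<and> p @ [d] \<in> occ T' v"
    by (simp add: assms(2))
qed

lemma Nil_in_nodes [simp]: "[] \<in> ntd_nodes T"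
  by (cases T) auto

lemma occ_Nil: "[] \<in> occ T v \<longleftrightarrow> v \<in> root_bag T"
  by (simp add: occ_def)

lemma bags_eq: "bags T = ntd_bag T ` ntd_nodes T"
proof (induction T)
  case (Join S T)
  have "root_bag S \<in> ntd_bag S ` ntd_nodes S"
    using Join.IH(1) root_bag_in_bags[of S] by simp
  then show ?case
    using Join.IH by (auto simp: image_Un image_image)
qed (auto simp: image_image)

lemma Union_bags: "nice T \<Longrightarrow> \<Union> (bags T) = root_bag T \<union> forg T"
proof (induction T)
  case (Introduce v T)
  then show ?case using root_bag_in_bags[of T] by auto
next
  case (Forget v T)
  then show ?case by auto
qed auto

lemma verts_occ: "nice T \<Longrightarrow> v \<in> root_bag T \<union> forg T \<Longrightarrow> \<exists>q. q \<in> occ T v"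
  using Union_bags[of T] by (auto simp: occ_def bags_eq)

text \<open>A violation means that a vertex occurs on both sides of a tree edge. By connectedness it
  is then in the bag at the lower end of this edge, contradicting that it was forgotten below or is
  about to be introduced.\<close>

lemma good_if_occ_connected: "nice T \<Longrightarrow> occ_connected T \<Longrightarrow> good T"
proof (induction T)
  case (Introduce v T)
  have occ: "False # q \<in> occ (Introduce v T) u \<longleftrightarrow> q \<in> occ T u" for q u
    by (auto simp: occ_def)
  have "v \<notin> root_bag T \<union> forg T"
  proof
    assume "v \<in> root_bag T \<union> forg T"
    then obtain q where q: "[] @ False # q \<in> occ (Introduce v T) v"
      using verts_occ[of T v] Introduce.prems(1) occ by auto
    moreover have "[] \<in> occ (Introduce v T) v"
      by (simp add: occ_Nil)
    ultimately have "[] @ [False] \<in> occ (Introduce v T) v"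
      using Introduce.prems(2) unfolding occ_connected_def by blast
    then show False
      using Introduce.prems(1) occ[of "[]" v] by (simp add: occ_Nil)
  qed
  then show ?case
    using Introduce.IH Introduce.prems(1) occ_connected_sub[OF Introduce.prems(2) occ] by auto
next
  case (Forget v T)
  have occ: "False # q \<in> occ (Forget v T) u \<longleftrightarrow> q \<in> occ T u" for q u
    by (auto simp: occ_def)
  show ?case
    using Forget.IH Forget.prems(1) occ_connected_sub[OF Forget.prems(2) occ] by auto
next
  case (Join S T)
  have occ: "False # q \<in> occ (Join S T) u \<longleftrightarrow> q \<in> occ S u" "True # q \<in> occ (Join S T) u \<longleftrightarrow> q \<in> occ T u" for q u
    by (auto simp: occ_def)
  have good: "good S" "good T"
    using Join.IH Join.prems(1) occ_connected_sub[OF Join.prems(2) occ(1)]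
      occ_connected_sub[OF Join.prems(2) occ(2)] by auto
  have "u \<notin> forg T" if u: "u \<in> forg S" for u
  proof
    assume "u \<in> forg T"
    then obtain q r where q: "[] @ False # q \<in> occ (Join S T) u" "True # r \<in> occ (Join S T) u"
      using verts_occ[of T u] verts_occ[of S u] u Join.prems(1) occ by auto
    moreover have "\<forall>z. True # r \<noteq> [] @ False # z"
      by simp
    ultimately have "[] @ [False] \<in> occ (Join S T) u"
      using Join.prems(2) unfolding occ_connected_def by blast
    then have "u \<in> root_bag S"
      using occ(1)[of "[]" u] by (simp add: occ_Nil)
    then show False
      using u good_disjoint[OF good(1)] by auto
  qed
  then show ?case
    using good Join.prems(1) by auto
qed auto

lemma finite_ntd_nodes [simp]: "finite (ntd_nodes T)"
  by (induction T) auto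

lemma card_ntd_nodes: "card (ntd_nodes T) = nsize T"
proof (induction T)
  case (Join S T)
  have "card (Cons False ` ntd_nodes S \<union> Cons True ` ntd_nodes T) = nsize S + nsize T"
    using Join by (subst card_Un_disjoint) (auto simp: card_image)
  then show ?case
    by (auto simp: card_insert_if)
qed (auto simp: card_insert_if card_image)

lemma nice_tree_decompositionD:
  assumes "nice_tree_decomposition V E T"
  shows "good T" "root_bag T \<union> forg T = V" "\<forall>e\<in>E. \<exists>X\<in>bags T. e \<subseteq> X"
    "\<forall>X\<in>bags T. card X \<le> ntd_width T + 1"
proof -
  have nice: "nice T" and td: "tree_decomposition V E (ntd_nodes T) (ntd_edges T) (ntd_bag T)"
    using assms by (auto simp: nice_tree_decomposition_def)
  have V: "(\<Union>q\<in>ntd_nodes T. ntd_bag T q) = V"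
    using td by (simp add: tree_decomposition_def)
  show "root_bag T \<union> forg T = V"
    using Union_bags[OF nice] V by (simp add: bags_eq)
  have conn: "connected_on (ntd_edges T) (occ T v)" for v
    using td V by (cases "v \<in> V") (auto simp: tree_decomposition_def occ_def connected_on_def)
  have "occ_connected T"
    unfolding occ_connected_def using connected_on_crossing[OF conn] by blast
  with nice show "good T"
    by (rule good_if_occ_connected)
  show "\<forall>e\<in>E. \<exists>X\<in>bags T. e \<subseteq> X"
    using td by (auto simp: tree_decomposition_def bags_eq)
  show "\<forall>X\<in>bags T. card X \<le> ntd_width T + 1"
  proof
    fix X assume "X \<in> bags T"
    then have "card X \<le> Max ((\<lambda>i. card (ntd_bag T i)) ` ntd_nodes T)"
      by (intro Max_ge) (auto simp: bags_eq)
    then show "card X \<le> ntd_width T + 1"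
      by (simp add: ntd_width_def td_width_def)
  qed
qed

section \<open>From arbitrary tree decompositions to good nice trees\<close>

lemma rtrancl_distinct_path:
  "(x, y) \<in> R\<^sup>* \<Longrightarrow> \<exists>xs. xs \<noteq> [] \<and> distinct xs \<and> hd xs = x \<and> last xs = y \<and>
     (\<forall>i. i + 1 < length xs \<longrightarrow> (xs ! i, xs ! (i + 1)) \<in> R)"
proof (induction rule: rtrancl_induct)
  case base
  then show ?case by (intro exI[of _ "[x]"]) auto
next
  case (step y z)
  then obtain xs where xs: "xs \<noteq> []" "distinct xs" "hd xs = x" "last xs = y"
    "\<forall>i. i + 1 < length xs \<longrightarrow> (xs ! i, xs ! (i + 1)) \<in> R"
    by blast
  show ?case
  proof (cases "z \<in> set xs")
    case True
    then obtain j where j: "j < length xs" "xs ! j = z"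
      by (auto simp: in_set_conv_nth)
    then show ?thesis
      \<comment> \<open>A walk that returns to a vertex of the path is cut back to the first visit
        there.\<close>
      using xs by (intro exI[of _ "take (Suc j) xs"]) (auto simp: last_conv_nth min_def intro: arg_cong[of _ _ "(!) xs"])
  next
    case False
    have "((xs @ [z]) ! i, (xs @ [z]) ! (i + 1)) \<in> R" if "i + 1 < length (xs @ [z])" for i
    proof (cases "i + 1 < length xs")
      case True
      then show ?thesis
        using xs(5) by (simp add: nth_append)
    next
      case False
      with that have "i = length xs - 1" "i + 1 = length xs"
        by auto
      then show ?thesis
        using xs(1,4) step.hyps(2) by (simp add: nth_append last_conv_nth)
    qed
    then show ?thesis
      using xs False by (intro exI[of _ "xs @ [z]"]) auto
  qed
qed

text \<open>A path between the ends that avoids the edge has at least three vertices and would close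
  with the edge to a cycle.\<close>

lemma acyclic_edge_separates:
  assumes "acyclic_graph F" "{r, m} \<in> F" "r \<noteq> m"
  shows "(r, m) \<notin> {(u, v). {u, v} \<in> F - {{r, m}}}\<^sup>*"
proof
  assume "(r, m) \<in> {(u, v). {u, v} \<in> F - {{r, m}}}\<^sup>*"
  from rtrancl_distinct_path[OF this]
  obtain xs where xs: "xs \<noteq> []" "distinct xs" "hd xs = r" "last xs = m"
    "\<forall>i. i + 1 < length xs \<longrightarrow> {xs ! i, xs ! (i + 1)} \<in> F - {{r, m}}"
    by auto
  have ends: "xs ! 0 = r" "xs ! (length xs - 1) = m"
    using xs by (simp_all add: hd_conv_nth last_conv_nth)
  have "length xs \<noteq> 1"
    using ends assms(3) by auto
  moreover have "length xs \<noteq> 2"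
    using ends xs(5) by (auto dest: spec[of _ 0])
  moreover have "length xs \<noteq> 0"
    using xs(1) by simp
  ultimately have len: "3 \<le> length xs"
    by linarith
  have "{xs ! i, xs ! ((i + 1) mod length xs)} \<in> F" if "i < length xs" for i
  proof (cases "i + 1 < length xs")
    case True
    then show ?thesis
      using xs(5) by auto
  next
    case False
    with that have i: "i + 1 = length xs" "i = length xs - 1"
      by auto
    then show ?thesis
      using ends assms(2) i(2) by (simp add: insert_commute)
  qed
  then show False
    using assms(1) len xs(2) unfolding acyclic_graph_def by blast
qed

text \<open>A walk can leave \<open>A\<close> only at \<open>a\<close> and return only at
  \<open>a\<close>, so excursions into \<open>C\<close> can be cut out. The induction remembers a
  walk inside \<open>A\<close> to the current vertex or, during an excursion, to
  \<open>a\<close>.\<close>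

lemma connected_on_split:
  assumes "A \<inter> C = {}" "X \<subseteq> A \<union> C"
    and cross: "\<And>z z'. {z, z'} \<in> F \<Longrightarrow> z \<in> A \<Longrightarrow> z' \<in> C \<Longrightarrow> z = a \<and> z' = c"
    and conn: "connected_on F X"
  shows "connected_on {e \<in> F. e \<subseteq> A} (X \<inter> A)"
    and "x \<in> X \<inter> A \<Longrightarrow> y \<in> X \<inter> C \<Longrightarrow> a \<in> X \<and> c \<in> X"
proof -
  let ?R = "{(u, v). u \<in> X \<inter> A \<and> v \<in> X \<inter> A \<and> {u, v} \<in> {e \<in> F. e \<subseteq> A}}"
  have *: "z \<in> A \<and> (x, z) \<in> ?R\<^sup>* \<or> z \<in> C \<and> a \<in> X \<and> c \<in> X \<and> (x, a) \<in> ?R\<^sup>*"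
    if "(x, z) \<in> {(u, v). u \<in> X \<and> v \<in> X \<and> {u, v} \<in> F}\<^sup>*" "x \<in> X \<inter> A" for x z
    using that(1)
  proof induction
    case base
    then show ?case using that(2) by auto
  next
    case (step y z)
    then have yz: "y \<in> X" "z \<in> X" "{y, z} \<in> F"
      by auto
    then have "z \<in> A \<union> C" "y \<in> A \<union> C"
      using assms(2) by auto
    then consider "y \<in> A" "z \<in> A" | "y \<in> A" "z \<in> C" | "y \<in> C" "z \<in> C" | "y \<in> C" "z \<in> A"
      by auto
    then show ?case
    proof cases
      case 1
      then have "(y, z) \<in> ?R"
        using yz by auto
      with 1 step.IH assms(1) show ?thesis
        by (auto intro: rtrancl_into_rtrancl)
    next
      case 2
      then have "y = a" "z = c"
        using cross[OF yz(3)] by auto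
      with 2 yz step.IH assms(1) show ?thesis
        by auto
    next
      case 3
      with step.IH assms(1) show ?thesis
        by auto
    next
      case 4
      then have "z = a"
        using cross[of z y] yz(3) by (simp add: insert_commute)
      with 4 step.IH assms(1) show ?thesis
        by auto
    qed
  qed
  show "connected_on {e \<in> F. e \<subseteq> A} (X \<inter> A)"
    unfolding connected_on_def
  proof (intro ballI)
    fix x y assume xy: "x \<in> X \<inter> A" "y \<in> X \<inter> A"
    then have "(x, y) \<in> {(u, v). u \<in> X \<and> v \<in> X \<and> {u, v} \<in> F}\<^sup>*"
      using conn by (auto simp: connected_on_def)
    from *[OF this xy(1)] xy(2) assms(1) show "(x, y) \<in> ?R\<^sup>*"
      by auto
  qed
  show "a \<in> X \<and> c \<in> X" if xy: "x \<in> X \<inter> A" "y \<in> X \<inter> C"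
  proof -
    have "(x, y) \<in> {(u, v). u \<in> X \<and> v \<in> X \<and> {u, v} \<in> F}\<^sup>*"
      using conn xy by (auto simp: connected_on_def)
    from *[OF this xy(1)] xy(2) assms(1) show ?thesis
      by auto
  qed
qed

text \<open>Removing an edge at the root splits a tree decomposition into two, which are rooted at the ends
  of this edge.\<close>

lemma ex_good_ntd:
  fixes B :: "'i \<Rightarrow> nat set"
  shows "simple_graph I F \<Longrightarrow> connected_on F I \<Longrightarrow> acyclic_graph F \<Longrightarrow>
    (\<And>v. connected_on F {i \<in> I. v \<in> B i}) \<Longrightarrow> (\<And>i. i \<in> I \<Longrightarrow> finite (B i)) \<Longrightarrow> r \<in> I \<Longrightarrow>
    \<exists>T. good T \<and> root_bag T = B r \<and> root_bag T \<union> forg T = (\<Union>i\<in>I. B i) \<and>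
      (\<forall>X\<in>bags T. \<exists>i\<in>I. X \<subseteq> B i) \<and> (\<forall>i\<in>I. \<exists>X\<in>bags T. B i \<subseteq> X)"
proof (induction "card I" arbitrary: I F r rule: less_induct)
  case less
  note sg = less.prems(1)
  have fin: "finite I" and FI: "\<And>u v. {u, v} \<in> F \<Longrightarrow> u \<in> I \<and> v \<in> I \<and> u \<noteq> v"
    using sg by (auto simp: simple_graph_def doubleton_eq_iff) 
  show ?case
  proof (cases "I = {r}")
    case True
    obtain xs where xs: "set xs = B r" "distinct xs"
      using less.prems(5,6) finite_distinct_list by blast
    then show ?thesis
      using True by (intro exI[of _ "Leaf xs"]) auto
  next
    case False
    then obtain x where x: "x \<in> I" "x \<noteq> r"
      using less.prems(6) by blast
    then have "(r, x) \<in> {(u, v). u \<in> I \<and> v \<in> I \<and> {u, v} \<in> F}\<^sup>*"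
      using less.prems(2,6) by (auto simp: connected_on_def)
    then obtain m where m: "{r, m} \<in> F"
      using x(2) by (cases rule: converse_rtranclE) auto
    have rm: "r \<noteq> m" "m \<in> I"
      using FI[OF m] by auto
    let ?R = "{(u, v). {u, v} \<in> F - {{r, m}}}"
    have sym: "(x, y) \<in> ?R\<^sup>* \<Longrightarrow> (y, x) \<in> ?R\<^sup>*" for x y
      by (rule symD[OF sym_rtrancl]) (auto simp: sym_def insert_commute)
    define A where "A = {x. (r, x) \<in> ?R\<^sup>*}"
    define C where "C = {x. (m, x) \<in> ?R\<^sup>*}"
    have nrm: "(r, m) \<notin> ?R\<^sup>*"
      using acyclic_edge_separates[OF less.prems(3) m rm(1)] .
    have AC: "A \<inter> C = {}"
      using nrm sym unfolding A_def C_def by (auto dest: rtrancl_trans)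
    have in_I: "y \<in> I" if "(x, y) \<in> ?R\<^sup>*" "x \<in> I" for x y
      using that FI by (induction) auto
    have I: "I = A \<union> C"
    proof
      show "A \<union> C \<subseteq> I"
        using in_I less.prems(6) rm(2) by (auto simp: A_def C_def)
      show "I \<subseteq> A \<union> C"
      proof
        fix x assume "x \<in> I"
        then have "(r, x) \<in> {(u, v). u \<in> I \<and> v \<in> I \<and> {u, v} \<in> F}\<^sup>*"
          using less.prems(2,6) by (auto simp: connected_on_def)
        then show "x \<in> A \<union> C"
        proof induction
          case (step y z)
          then have "{y, z} \<in> F"
            by auto
          show ?case
          proof (cases "{y, z} = {r, m}")
            case True
            then have "z = r \<or> z = m"
              by auto
            then show ?thesis
              by (auto simp: A_def C_def)
          next
            case False
            then have "(y, z) \<in> ?R"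
              using \<open>{y, z} \<in> F\<close> by auto
            then show ?thesis
              using step.IH by (auto simp: A_def C_def intro: rtrancl_into_rtrancl)
          qed
        qed (auto simp: A_def)
      qed
    qed
    have mem: "r \<in> A" "m \<in> C" "r \<notin> C" "m \<notin> A"
      using AC by (auto simp: A_def C_def)
    have cross: "z = r \<and> z' = m" if "{z, z'} \<in> F" "z \<in> A" "z' \<in> C" for z z'
    proof (cases "{z, z'} = {r, m}")
      case True
      then show ?thesis
        using that mem by (auto simp: doubleton_eq_iff)
    next
      case False
      then have "z' \<in> A"
        using that(1,2) by (auto simp: A_def intro: rtrancl_into_rtrancl)
      then show ?thesis
        using AC that(3) by auto
    qed
    have cross': "z = m \<and> z' = r" if "{z, z'} \<in> F" "z \<in> C" "z' \<in> A" for z z'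
      using cross[of z' z] that by (simp add: insert_commute)
    have CA: "C \<inter> A = {}" "I = C \<union> A"
      using AC I by auto
    have sub: "simple_graph Y {e \<in> F. e \<subseteq> Y}" "acyclic_graph {e \<in> F. e \<subseteq> Y}" if "Y \<subseteq> I" for Y
    proof -
      have "finite Y"
        using fin that finite_subset by blast
      then show "simple_graph Y {e \<in> F. e \<subseteq> Y}"
        using sg unfolding simple_graph_def by fastforce
      show "acyclic_graph {e \<in> F. e \<subseteq> Y}"
        using less.prems(3) unfolding acyclic_graph_def by blast
    qed
    have "A \<subset> I" "C \<subset> I"
      using I mem by auto
    then have card: "card A < card I" "card C < card I"
      using fin by (auto intro: psubset_card_mono)
    have conn: "connected_on {e \<in> F. e \<subseteq> A} A" "connected_on {e \<in> F. e \<subseteq> C} C"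
      "\<And>v. connected_on {e \<in> F. e \<subseteq> A} {i \<in> A. v \<in> B i}" "\<And>v. connected_on {e \<in> F. e \<subseteq> C} {i \<in> C. v \<in> B i}"
    proof -
      have e: "A = I \<inter> A" "C = I \<inter> C"
        using I by auto
      show "connected_on {e \<in> F. e \<subseteq> A} A"
        by (subst (2) e(1), rule connected_on_split(1)[OF AC _ cross less.prems(2)]) (use I in auto)
      show "connected_on {e \<in> F. e \<subseteq> C} C"
        by (subst (2) e(2), rule connected_on_split(1)[OF CA(1) _ cross' less.prems(2)]) (use I in auto)
      fix v
      have e: "{i \<in> A. v \<in> B i} = {i \<in> I. v \<in> B i} \<inter> A" "{i \<in> C. v \<in> B i} = {i \<in> I. v \<in> B i} \<inter> C"
        using I by auto
      show "connected_on {e \<in> F. e \<subseteq> A} {i \<in> A. v \<in> B i}"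
        by (subst e, rule connected_on_split(1)[OF AC _ cross less.prems(4)]) (use I in auto)
      show "connected_on {e \<in> F. e \<subseteq> C} {i \<in> C. v \<in> B i}"
        by (subst e, rule connected_on_split(1)[OF CA(1) _ cross' less.prems(4)]) (use I in auto)
    qed
    obtain S where S: "good S" "root_bag S = B r" "root_bag S \<union> forg S = (\<Union>i\<in>A. B i)"
      "\<forall>X\<in>bags S. \<exists>i\<in>A. X \<subseteq> B i" "\<forall>i\<in>A. \<exists>X\<in>bags S. B i \<subseteq> X"
      using less.hyps[OF card(1) sub(1) conn(1) sub(2) conn(3) less.prems(5) mem(1)] I by blast
    obtain U where U: "good U" "root_bag U = B m" "root_bag U \<union> forg U = (\<Union>i\<in>C. B i)"
      "\<forall>X\<in>bags U. \<exists>i\<in>C. X \<subseteq> B i" "\<forall>i\<in>C. \<exists>X\<in>bags U. B i \<subseteq> X"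
      using less.hyps[OF card(2) sub(1) conn(2) sub(2) conn(4) less.prems(5) mem(2)] I by blast
    \<comment> \<open>A vertex on both sides occurs at both ends of the removed edge. This makes the
      forgotten sets disjoint and allows the vertices of \<open>B r - B m\<close> to be introduced
      above \<open>U\<close>.\<close>
    have common: "v \<in> B r \<and> v \<in> B m" if v: "v \<in> root_bag S \<union> forg S" "v \<in> root_bag U \<union> forg U" for v
    proof -
      obtain i j where ij: "i \<in> A" "v \<in> B i" "j \<in> C" "v \<in> B j"
        using v unfolding S(3) U(3) by auto
      have "r \<in> {i \<in> I. v \<in> B i} \<and> m \<in> {i \<in> I. v \<in> B i}"
        by (rule connected_on_split(2)[OF AC _ cross less.prems(4), where x = i and y = j]) (use I ij in auto)
      then show ?thesis
        by simp
    qed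
    have finB: "finite (B r)" "finite (B m)"
      using less.prems(5,6) rm by auto
    \<comment> \<open>Forgetting \<open>B m - B r\<close> and then introducing
      \<open>B r - B m\<close> turns the root bag of \<open>U\<close> into that of \<open>S\<close>,
      so that the two can be joined.\<close>
    obtain fs where fs: "set fs = B m - B r" "distinct fs"
      using finite_distinct_list[of "B m - B r"] finB by blast
    obtain ns where ns: "set ns = B r - B m" "distinct ns"
      using finite_distinct_list[of "B r - B m"] finB by blast
    define U1 where "U1 = foldr Forget fs U"
    have "set fs \<subseteq> root_bag U"
      using fs U(2) by auto
    from foldr_Forget[OF fs(2) this U(1), folded U1_def]
    have U1: "good U1" "root_bag U1 = B m \<inter> B r" "forg U1 = forg U \<union> (B m - B r)"
      "\<forall>X\<in>bags U1. X \<in> bags U \<or> X \<subseteq> B m" "bags U \<subseteq> bags U1"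
      using fs U(2) by auto
    define U2 where "U2 = foldr Introduce ns U1"
    have "set ns \<inter> (root_bag U1 \<union> forg U1) = {}"
      using common ns U1 S(2) U(2) by auto
    from foldr_Introduce[OF ns(2) this U1(1), folded U2_def]
    have U2: "good U2" "root_bag U2 = B r" "forg U2 = forg U \<union> (B m - B r)"
      "\<forall>X\<in>bags U2. X \<in> bags U1 \<or> X \<subseteq> B r" "bags U \<subseteq> bags U2"
      using ns U1 by auto
    have "forg S \<inter> forg U2 = {}"
    proof -
      have "v \<notin> forg U2" if "v \<in> forg S" for v
        using common[of v] that good_disjoint[OF S(1)] S(2) U(2) U2(3) by blast
      then show ?thesis
        by blast
    qed
    then have "good (Join S U2)"
      using S(1,2) U2 by simp
    moreover have "root_bag (Join S U2) \<union> forg (Join S U2) = (\<Union>i\<in>I. B i)"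
      using S(2,3) U(2,3) U2(3) I mem(1) by auto
    moreover have "\<forall>X\<in>bags (Join S U2). \<exists>i\<in>I. X \<subseteq> B i"
      using S(4) U(4) U1(4) U2(4) I mem by simp (metis Un_iff)
    moreover have "\<forall>i\<in>I. \<exists>X\<in>bags (Join S U2). B i \<subseteq> X"
    proof
      fix i assume "i \<in> I"
      then show "\<exists>X\<in>bags (Join S U2). B i \<subseteq> X"
        using S(5) U(5) U2(5) unfolding I bags.simps by blast
    qed
    ultimately show ?thesis
      using S(2) by (intro exI[of _ "Join S U2"]) simp
  qed
qed

text \<open>Guarantees that the minimum in the definition of \<open>treewidth\<close> is attained,
  and later that it is at most n.\<close>

lemma trivial_tree_decomposition:
  assumes "simple_graph V E"
  shows "tree_decomposition V E {0} {} (\<lambda>_::nat. V)"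
proof -
  have "acyclic_graph {}"
    unfolding acyclic_graph_def by (force intro: exI[of _ 0])
  moreover have "e \<subseteq> V" if "e \<in> E" for e
    using assms that by (auto simp: simple_graph_def)
  ultimately show ?thesis
    by (auto simp: tree_decomposition_def tree_graph_def simple_graph_def connected_on_def)
qed

lemma ex_good_ntd_treewidth:
  assumes "simple_graph {..<n} E"
  shows "\<exists>T. good T \<and> root_bag T = {} \<and> forg T = {..<n} \<and> (\<forall>e\<in>E. \<exists>X\<in>bags T. e \<subseteq> X) \<and>
    (\<forall>X\<in>bags T. card X \<le> treewidth {..<n} E + 1)"
proof -
  let ?P = "\<lambda>t. \<exists>(I :: nat set) F B. tree_decomposition {..<n} E I F B \<and> td_width I B = t"
  have "tree_decomposition {..<n} E {0} {} (\<lambda>_::nat. {..<n})"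
    using assms by (rule trivial_tree_decomposition)
  then have "\<exists>t. ?P t"
    by blast
  from LeastI_ex[OF this] obtain I :: "nat set" and F B where td: "tree_decomposition {..<n} E I F B"
    and width: "td_width I B = treewidth {..<n} E"
    unfolding treewidth_def by blast
  have tree: "simple_graph I F" "connected_on F I" "acyclic_graph F" "I \<noteq> {}"
    and V: "(\<Union>i\<in>I. B i) = {..<n}"
    using td by (auto simp: tree_decomposition_def tree_graph_def)
  have conn: "connected_on F {i \<in> I. v \<in> B i}" for v
    using td V by (cases "v < n") (auto simp: tree_decomposition_def connected_on_def)
  have fin: "finite (B i)" if "i \<in> I" for i
    using V that by (metis UN_upper finite_lessThan finite_subset)
  obtain r where "r \<in> I"
    using tree(4) by blast
  then obtain T where T: "good T" "root_bag T \<union> forg T = {..<n}" "\<forall>X\<in>bags T. \<exists>i\<in>I. X \<subseteq> B i"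
    "\<forall>i\<in>I. \<exists>X\<in>bags T. B i \<subseteq> X"
    using ex_good_ntd[of I F B r] tree conn fin V by auto
  have "finite I"
    using tree(1) by (simp add: simple_graph_def)
  have "card (B i) \<le> treewidth {..<n} E + 1" if "i \<in> I" for i
  proof -
    have "card (B i) \<le> Max ((\<lambda>i. card (B i)) ` I)"
      using \<open>finite I\<close> that by (intro Max_ge) auto
    then show ?thesis
      using width unfolding td_width_def by linarith
  qed
  then have w: "card X \<le> treewidth {..<n} E + 1" if "X \<in> bags T" for X
    using T(3) that card_mono[OF fin] by (meson order.trans)
  note f = foldr_Forget[OF distinct_bag_list[OF T(1)] _ T(1), unfolded set_bag_list, OF order_refl]
  have "card X \<le> treewidth {..<n} E + 1" if "X \<in> bags (foldr Forget (bag_list T) T)" for X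
    using f that w card_mono[OF finite_root_bag, of X T] root_bag_in_bags[of T] by (meson order.trans)
  moreover have "\<exists>X\<in>bags (foldr Forget (bag_list T) T). e \<subseteq> X" if e: "e \<in> E" for e
  proof -
    obtain i where "i \<in> I" "e \<subseteq> B i"
      using td e unfolding tree_decomposition_def by blast
    then obtain X where "X \<in> bags T" "e \<subseteq> X"
      using T(4) by blast
    then show ?thesis
      using f by blast
  qed
  ultimately show ?thesis
    using f T(2) by (intro exI[of _ "foldr Forget (bag_list T) T"]) (simp add: Un_commute)
qed

text \<open>\<open>A\<close> is the set forgotten in a suitable subtree and \<open>S\<close> a bag
  that separates it from the rest. Descending into a side of a join that forgets more than
  \<open>k\<close> vertices of \<open>W\<close> loses too much never, and forget nodes change the
  count by at most one, so the range from \<open>k\<close> to \<open>2 * k\<close> cannot be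
  skipped.\<close>

lemma balanced_part:
  assumes "finite W"
  shows "good T \<Longrightarrow> 2 * k < card (W \<inter> forg T) \<Longrightarrow> \<exists>A S. k \<le> card (W \<inter> A) \<and> card (W \<inter> A) \<le> 2 * k \<and>
    S \<in> bags T \<and> A \<subseteq> forg T \<and> A \<inter> S = {} \<and> (\<forall>X\<in>bags T. X \<subseteq> A \<union> S \<or> X \<inter> A = {})"
proof (induction T)
  case (Introduce v T)
  then obtain A S where A: "k \<le> card (W \<inter> A)" "card (W \<inter> A) \<le> 2 * k"
    "S \<in> bags T" "A \<subseteq> forg T" "A \<inter> S = {}" "\<forall>X\<in>bags T. X \<subseteq> A \<union> S \<or> X \<inter> A = {}"
    by auto
  then show ?case
    using Introduce.prems(1) good_disjoint[of T] by (intro exI[of _ A] exI[of _ S]) auto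
next
  case (Forget v T)
  show ?case
  proof (cases "2 * k < card (W \<inter> forg T)")
    case True
    with Forget obtain A S where A: "k \<le> card (W \<inter> A)" "card (W \<inter> A) \<le> 2 * k"
      "S \<in> bags T" "A \<subseteq> forg T" "A \<inter> S = {}" "\<forall>X\<in>bags T. X \<subseteq> A \<union> S \<or> X \<inter> A = {}"
      by auto
    then show ?thesis
      using Forget.prems(1) good_disjoint[of T] by (intro exI[of _ A] exI[of _ S]) auto
  next
    case False
    \<comment> \<open>If the count exceeds \<open>2 * k\<close> only after forgetting
      \<open>v\<close>, it is exactly \<open>2 * k\<close> before.\<close>
    have "card (W \<inter> insert v (forg T)) \<le> Suc (card (W \<inter> forg T))"
      by (simp add: Int_insert_right card_insert_if)
    then have "k \<le> card (W \<inter> forg T)" "card (W \<inter> forg T) \<le> 2 * k"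
      using Forget.prems(2) False by auto
    then show ?thesis
      using Forget.prems(1) good_disjoint[of T] bags_subset[of T] root_bag_in_bags[of T]
      by (intro exI[of _ "forg T"] exI[of _ "root_bag T"]) auto
  qed
next
  case (Join S T)
  have g: "good S" "good T" "root_bag S = root_bag T" "forg S \<inter> forg T = {}"
    using Join.prems(1) by auto
  have "card (W \<inter> (forg S \<union> forg T)) = card (W \<inter> forg S) + card (W \<inter> forg T)"
    unfolding Int_Un_distrib using g(4) assms by (intro card_Un_disjoint) auto
  then have or: "k < card (W \<inter> forg S) \<or> k < card (W \<inter> forg T)"
    using Join.prems(2) by auto
  have side: ?case if k: "k < card (W \<inter> forg U)" and U: "good U" "bags (Join S T) = bags U \<union> bags U'"
    "forg (Join S T) = forg U \<union> forg U'" "forg U \<inter> forg U' = {}" "root_bag U = root_bag U'" "good U'"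
    and IH: "2 * k < card (W \<inter> forg U) \<Longrightarrow> \<exists>A S. k \<le> card (W \<inter> A) \<and> card (W \<inter> A) \<le> 2 * k \<and>
    S \<in> bags U \<and> A \<subseteq> forg U \<and> A \<inter> S = {} \<and> (\<forall>X\<in>bags U. X \<subseteq> A \<union> S \<or> X \<inter> A = {})" for U U'
  proof -
    have "\<exists>A S. k \<le> card (W \<inter> A) \<and> card (W \<inter> A) \<le> 2 * k \<and>
      S \<in> bags U \<and> A \<subseteq> forg U \<and> A \<inter> S = {} \<and> (\<forall>X\<in>bags U. X \<subseteq> A \<union> S \<or> X \<inter> A = {})"
    proof (cases "2 * k < card (W \<inter> forg U)")
      case True
      then show ?thesis
        by (rule IH)
    next
      case False
      then show ?thesis
        using k bags_subset[OF U(1)] good_disjoint[OF U(1)] root_bag_in_bags[of U]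
        by (intro exI[of _ "forg U"] exI[of _ "root_bag U"]) auto
    qed
    then obtain A Z where A: "k \<le> card (W \<inter> A)" "card (W \<inter> A) \<le> 2 * k"
      "Z \<in> bags U" "A \<subseteq> forg U" "A \<inter> Z = {}" "\<forall>X\<in>bags U. X \<subseteq> A \<union> Z \<or> X \<inter> A = {}"
      by blast
    have "X \<inter> A = {}" if "X \<in> bags U'" for X
      using bags_subset[OF U(6) that] A(4) U(4,5) good_disjoint[OF U(1)] by blast
    then show ?thesis
      using A U(2,3) by (intro exI[of _ A] exI[of _ Z]) auto
  qed
  from or show ?case
  proof
    assume "k < card (W \<inter> forg S)"
    from side[OF this, of T] g Join.IH(1) show ?thesis
      by simp
  next
    assume "k < card (W \<inter> forg T)"
    from side[OF this, of S] g Join.IH(2) show ?thesis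
      by (simp add: Un_commute Int_commute)
  qed
qed simp

text \<open>Since \<open>W\<close> has at most \<open>3 * k\<close> vertices, a part with at least
  \<open>k\<close> of them leaves at most \<open>2 * k\<close> outside. If only few vertices of
  \<open>W\<close> are involved at all, the empty separation does.\<close>

lemma balanced_separation:
  assumes T: "good T" "\<forall>X\<in>bags T. card X \<le> s" and W: "W \<subseteq> forg T" "card W \<le> 3 * k"
  shows "\<exists>A S. A \<inter> S = {} \<and> card S \<le> s \<and> finite S \<and> card (W \<inter> A) \<le> 2 * k \<and> card (W - A) \<le> 2 * k \<and>
    (\<forall>X\<in>bags T. X \<subseteq> A \<union> S \<or> X \<inter> A = {})"
proof (cases "2 * k < card (W \<inter> forg T)")
  case True
  have fin: "finite W"
    by (rule finite_subset[OF W(1)]) simp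
  obtain A S where A: "k \<le> card (W \<inter> A)" "card (W \<inter> A) \<le> 2 * k"
    "S \<in> bags T" "A \<inter> S = {}" "\<forall>X\<in>bags T. X \<subseteq> A \<union> S \<or> X \<inter> A = {}"
    using balanced_part[OF fin T(1) True] by blast
  have "card (W - A) = card W - card (W \<inter> A)"
    using fin by (simp add: card_Diff_subset_Int)
  moreover have "finite S"
    using bags_subset[OF T(1) A(3)] finite_subset by fastforce
  ultimately show ?thesis
    using A T(2) W(2) by (intro exI[of _ A] exI[of _ S]) auto
next
  case False
  then have "card (W - {}) \<le> 2 * k"
    using W(1) by (simp add: Int_absorb2)
  then show ?thesis
    by (intro exI[of _ "{}"]) auto
qed

section \<open>Computing a tree decomposition\<close>

abbreviation filter_label :: "nat list \<Rightarrow> (nat \<times> nat) list \<Rightarrow> nat \<Rightarrow> nat list" where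
  "filter_label vs s x \<equiv> filter (\<lambda>v. look s v = x) vs"

text \<open>First weight 0 marks a cut constraint for \<open>edge_ok\<close>. Edges leaving
  \<open>X\<close> are dropped, so vertices outside \<open>X\<close> may be labelled freely.\<close>

definition cut_edges :: "edge_entry list \<Rightarrow> nat set \<Rightarrow> edge_entry list" where
  "cut_edges es X = map (\<lambda>(u, v, a, b). (u, v, 0, 0)) (filter (\<lambda>(u, v, a, b). u \<in> X \<and> v \<in> X) es)"

lemma cut_edges_simps [simp]:
  "cut_edges [] X = []"
  "cut_edges ((u, v, a, b) # es) X = (if u \<in> X \<and> v \<in> X then (u, v, 0, 0) # cut_edges es X else cut_edges es X)"
  by (auto simp: cut_edges_def)

lemma mem_cut_edges:
  "(u, v, a, b) \<in> set (cut_edges es X) \<longleftrightarrow> a = 0 \<and> b = 0 \<and> u \<in> X \<and> v \<in> X \<and> (\<exists>a b. (u, v, a, b) \<in> set es)"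
proof (induction es)
  case (Cons e es)
  obtain u' v' a' b' where "e = (u', v', a', b')"
    by (cases e)
  with Cons show ?case
    by (simp split: if_splits) blast
qed simp

lemma length_cut_edges: "length (cut_edges es X) \<le> length es"
  by (simp add: cut_edges_def)

text \<open>Changing the leaves is enough: a vertex that is never forgotten stays in all bags above
  them.\<close>

fun add_vertex :: "nat \<Rightarrow> ntd \<Rightarrow> ntd" where
  "add_vertex i (Leaf xs) = Leaf (i # xs)"
| "add_vertex i (Introduce v T) = Introduce v (add_vertex i T)"
| "add_vertex i (Forget v T) = Forget v (add_vertex i T)"
| "add_vertex i (Join S T) = Join (add_vertex i S) (add_vertex i T)"

lemma add_vertex:
  assumes "i \<notin> root_bag T \<union> forg T" "good T"
  shows "root_bag (add_vertex i T) = insert i (root_bag T)" "forg (add_vertex i T) = forg T"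
    "good (add_vertex i T)" "bags (add_vertex i T) = insert i ` bags T"
proof -
  have "i \<notin> root_bag T \<union> forg T \<Longrightarrow> good T \<Longrightarrow> root_bag (add_vertex i T) = insert i (root_bag T) \<and>
    forg (add_vertex i T) = forg T \<and> good (add_vertex i T) \<and> bags (add_vertex i T) = insert i ` bags T"
  proof (induction T)
    case (Forget v T)
    then have "v \<noteq> i" "i \<notin> root_bag T \<union> forg T"
      by auto
    then show ?case
      using Forget by auto
  next
    case (Introduce v T)
    then show ?case by (auto simp: insert_commute)
  qed (auto simp: image_Un)
  with assms show "root_bag (add_vertex i T) = insert i (root_bag T)" "forg (add_vertex i T) = forg T"
    "good (add_vertex i T)" "bags (add_vertex i T) = insert i ` bags T"
    by auto
qed

lemma nsize_add_vertex [simp]: "nsize (add_vertex i T) = nsize T"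
  by (induction T) auto

fun or_entry :: "entry \<Rightarrow> entry \<Rightarrow> entry" where
  "or_entry (Some e) f = Some e"
| "or_entry None f = f"

text \<open>Each list is the interface of one recursive call: the vertices of \<open>ws\<close> on
  that side together with the cut vertices.\<close>

definition fits :: "(nat \<times> nat) list \<Rightarrow> nat list \<Rightarrow> nat list \<Rightarrow> nat \<Rightarrow> nat \<Rightarrow> bool" where
  "fits s ws X M B \<longleftrightarrow> length (filter_label ws s 0 @ filter_label X s M) \<le> B \<and>
     length (filter_label ws s 1 @ filter_label X s M) \<le> B"

fun test_entry :: "entry \<Rightarrow> nat list \<Rightarrow> nat list \<Rightarrow> nat \<Rightarrow> nat \<Rightarrow> entry" where
  "test_entry None ws X M B = None"
| "test_entry (Some (c, s)) ws X M B = (if fits s ws X M B then Some (c, s) else None)"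

text \<open>A singleton domain put in front shadows the full domain of the same vertex, so labels
  are prescribed to the dynamic program without any special code.\<close>

fun try_labels :: "((nat \<times> nat list) list \<Rightarrow> entry) \<Rightarrow> nat \<Rightarrow> nat list \<Rightarrow> (nat \<times> nat list) list \<Rightarrow> entry" where
  "try_labels f M [] D = f D"
| "try_labels f M (w # ws) D = or_entry (try_labels f M ws ((w, [0]) # D))
     (or_entry (try_labels f M ws ((w, [1]) # D)) (try_labels f M ws ((w, [M]) # D)))"

section \<open>The program that builds decompositions\<close>

abbreviation "F_filt \<equiv> 33 :: nat"
abbreviation "F_cuts \<equiv> 34 :: nat"
abbreviation "F_addv \<equiv> 35 :: nat"
abbreviation "F_len \<equiv> 36 :: nat"
abbreviation "F_test \<equiv> 37 :: nat"
abbreviation "F_fits \<equiv> 38 :: nat"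
abbreviation "F_or \<equiv> 39 :: nat"
abbreviation "F_tryl \<equiv> 40 :: nat"
abbreviation "F_down \<equiv> 41 :: nat"
abbreviation "F_dom0 \<equiv> 42 :: nat"
abbreviation "F_decomp \<equiv> 43 :: nat"
abbreviation "F_dec1 \<equiv> 44 :: nat"
abbreviation "F_dec2 \<equiv> 45 :: nat"
abbreviation "F_dec3 \<equiv> 46 :: nat"
abbreviation "F_iter \<equiv> 47 :: nat"
abbreviation "F_iter2 \<equiv> 48 :: nat"
abbreviation "F_search \<equiv> 49 :: nat"
abbreviation "F_search2 \<equiv> 50 :: nat"

definition "body_filt = Cond (IsCell (Var 0))
  (Cond (Op Equal (Call F_look [Var 1, First (Var 0)]) (Var 2))
    (Cons2 (First (Var 0)) (Call F_filt [Second (Var 0), Var 1, Var 2]))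
    (Call F_filt [Second (Var 0), Var 1, Var 2]))
  (Const 0)"

definition "body_cuts = Cond (IsCell (Var 0))
  (Cond (Call F_mem [Var 1, e_u (First (Var 0))])
    (Cond (Call F_mem [Var 1, e_v (First (Var 0))])
      (Cons2 (Cons2 (e_u (First (Var 0))) (Cons2 (e_v (First (Var 0))) (Cons2 (Const 0) (Const 0))))
        (Call F_cuts [Second (Var 0), Var 1]))
      (Call F_cuts [Second (Var 0), Var 1]))
    (Call F_cuts [Second (Var 0), Var 1]))
  (Const 0)"

definition "body_addv = tag_cases (Var 0)
  (Cons2 (Const 0) (Cons2 (Var 1) (Second (Var 0))))
  (Cons2 (Const 1) (Cons2 (First (Second (Var 0))) (Call F_addv [Second (Second (Var 0)), Var 1])))
  (Cons2 (Const 2) (Cons2 (First (Second (Var 0))) (Call F_addv [Second (Second (Var 0)), Var 1])))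
  (Cons2 (Const 3) (Cons2 (Call F_addv [First (Second (Var 0)), Var 1])
    (Call F_addv [Second (Second (Var 0)), Var 1])))"

definition "body_len = Cond (IsCell (Var 0)) (Op Plus (Const 1) (Call F_len [Second (Var 0)])) (Const 0)"

definition "body_fits = Cond (Op Less (Var 1) (Call F_len [Var 0])) (Const 0) (Const 1)"

definition "body_test = Cond (IsCell (Var 0))
  (Bind (Call F_filt [Var 2, Second (Var 0), Var 3])
    (Cond (Call F_fits [Call F_append [Call F_filt [Var 2, Second (Var 1), Const 0], Var 0], Var 5])
      (Cond (Call F_fits [Call F_append [Call F_filt [Var 2, Second (Var 1), Const 1], Var 0], Var 5])
        (Var 1) (Const 0))
      (Const 0)))
  (Const 0)"

definition "body_or = Cond (IsCell (Var 0)) (Var 0) (Var 1)"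

definition "body_tryl = Cond (IsCell (Var 0))
  (Call F_or
    [Call F_tryl [Second (Var 0), Cons2 (Cons2 (First (Var 0)) (Cons2 (Const 0) (Const 0))) (Var 1),
       Var 2, Var 3, Var 4, Var 5, Var 6, Var 7],
     Call F_or
     [Call F_tryl [Second (Var 0), Cons2 (Cons2 (First (Var 0)) (Cons2 (Const 1) (Const 0))) (Var 1),
       Var 2, Var 3, Var 4, Var 5, Var 6, Var 7],
      Call F_tryl [Second (Var 0), Cons2 (Cons2 (First (Var 0)) (Cons2 (Var 6) (Const 0))) (Var 1),
       Var 2, Var 3, Var 4, Var 5, Var 6, Var 7]]])
  (Call F_test [Call F_dp [Var 2, Var 3, Var 1], Var 4, Var 5, Var 6, Var 7])"

definition "body_down = Cond (Var 0)
  (Bind (Op Minus (Var 0) (Const 1)) (Cons2 (Var 0) (Call F_down [Var 0]))) (Const 0)"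

definition "body_dom0 = Cond (Var 0)
  (Bind (Op Minus (Var 0) (Const 1))
    (Cons2 (Cons2 (Var 0) (Cons2 (Const 0) (Cons2 (Const 1) (Cons2 (Var 2) (Const 0)))))
      (Call F_dom0 [Var 0, Var 2])))
  (Const 0)"

text \<open>The first argument lists the vertices still to be decomposed, the second the interface
  that has to become the root bag; without vertices to decompose, the result is a leaf with this
  bag.\<close>

definition "body_decomp = Cond (IsCell (Var 0))
  (Call F_dec1 [First (Var 0), Second (Var 0), Var 1, Call F_append [Var 0, Var 1],
    Var 2, Var 3, Var 4, Var 5, Var 6])
  (Cons2 (Const 0) (Var 1))"

definition "body_dec1 = Call F_dec2 [Var 0, Var 1, Var 2, Var 3, Var 4, Var 5, Var 6, Var 7, Var 8,
  Call F_tryl [Cons2 (Var 0) (Var 2), Var 6, Var 4, Call F_cuts [Var 5, Var 3], Cons2 (Var 0) (Var 2),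
    Var 3, Var 7, Var 8]]"

definition "body_dec2 = Cond (IsCell (Var 9))
  (Bind (Second (Var 9))
    (Bind (Call F_filt [Var 4, Var 0, Var 8])
      (Bind (Call F_filt [Cons2 (Var 2) (Var 4), Var 1, Const 0])
        (Bind (Call F_filt [Cons2 (Var 3) (Var 5), Var 2, Const 1])
          (Call F_dec3 [Var 1, Var 0, Cons2 (Var 4) (Call F_filt [Var 5, Var 3, Var 11]),
            Call F_decomp [Call F_filt [Var 5, Var 3, Const 0], Call F_append [Var 1, Var 2],
              Var 8, Var 9, Var 10, Var 11, Var 12],
            Call F_decomp [Call F_filt [Var 5, Var 3, Const 1], Call F_append [Var 0, Var 2],
              Var 8, Var 9, Var 10, Var 11, Var 12]])))))
  (Const 0)"

definition "body_dec3 = Cond (IsCell (Var 3))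
  (Cond (IsCell (Var 4))
    (Call F_forgets [Var 2, Cons2 (Const 3)
      (Cons2 (Call F_introduces [Var 1, Var 3]) (Call F_introduces [Var 0, Var 4]))])
    (Const 0))
  (Const 0)"

definition "body_iter = Cond (Var 0)
  (Bind (Op Minus (Var 0) (Const 1))
    (Call F_iter2 [Call F_iter [Var 0, Var 2, Var 3, Var 4], Var 0, Var 1, Var 2, Var 3, Var 4]))
  (Cons2 (Const 0) (Const 0))"

definition "body_iter2 = Cond (IsCell (Var 0))
  (Call F_decomp [Call F_down [Var 2], Const 0,
    Cons2 (Const 2) (Cons2 (Var 1) (Call F_addv [Var 0, Var 1])), Var 3,
    Call F_dom0 [Var 2, Var 4], Var 4, Var 5])
  (Const 0)"

definition "body_search = Call F_search2
  [Call F_iter [Var 1, Var 2, Op Plus (Var 1) (Const 1),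
     Op Plus (Op Times (Const 3) (Var 0)) (Const 2)], Var 0, Var 1, Var 2]"

definition "body_search2 = Cond (IsCell (Var 0)) (Var 0)
  (Call F_search [Op Plus (Var 1) (Const 1), Var 2, Var 3])"

definition test_cost :: "nat \<Rightarrow> nat" where
  "test_cost L = (3 * L) * (L + 2) + 6 * L + 10"

locale prog_td = prog_solve +
  assumes length_td: "50 < length P"
    and body_td: "P ! F_filt = body_filt" "P ! F_cuts = body_cuts" "P ! F_addv = body_addv"
      "P ! F_len = body_len" "P ! F_test = body_test" "P ! F_fits = body_fits" "P ! F_or = body_or"
      "P ! F_tryl = body_tryl" "P ! F_down = body_down" "P ! F_dom0 = body_dom0"
      "P ! F_decomp = body_decomp" "P ! F_dec1 = body_dec1" "P ! F_dec2 = body_dec2"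
      "P ! F_dec3 = body_dec3" "P ! F_iter = body_iter" "P ! F_iter2 = body_iter2"
      "P ! F_search = body_search" "P ! F_search2 = body_search2"
begin

lemma index_td [simp]: "k \<le> 50 \<Longrightarrow> k < length P"
  using length_td by simp

lemma ret_filt:
  assumes "length s \<le> L"
  shows "ret F_filt [enc_list Num vs, enc_assoc Num s, Num x] (enc_list Num (filter_label vs s x))
    (length vs * (L + 2) + 1)"
proof (induction vs arbitrary: x)
  case Nil
  show ?case
    by (rule retI) (simp_all add: body_td body_filt_def)
next
  case (Cons v vs)
  show ?case
    using assms
    by (intro retI, simp) (auto simp: body_td body_filt_def intro!: callI[OF ret_look] callI[OF Cons.IH])
qed

lemma ret_cuts:
  assumes "length X \<le> L"
  shows "ret F_cuts [enc_list enc_edge es, enc_list Num X] (enc_list enc_edge (cut_edges es (set X)))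
    (length es * (2 * L + 3) + 1)"
proof (induction es)
  case Nil
  show ?case
    by (rule retI) (simp_all add: body_td body_cuts_def)
next
  case (Cons e es)
  obtain u v a b where e: "e = (u, v, a, b)"
    by (cases e)
  show ?case
    using assms unfolding e
    by (cases "u \<in> set X"; cases "v \<in> set X"; intro retI, simp)
      (auto simp: body_td body_cuts_def intro!: callI[OF ret_mem] callI[OF Cons.IH])
qed

lemma ret_addv: "ret F_addv [enc_ntd T, Num i] (enc_ntd (add_vertex i T)) (nsize T)"
proof (induction T)
  case (Leaf xs)
  show ?case
    by (rule retI) (simp_all add: body_td body_addv_def tag_cases_def)
next
  case (Introduce v T)
  show ?case
    by (rule retI, simp) (auto simp: body_td body_addv_def tag_cases_def intro!: callI[OF Introduce.IH])
next
  case (Forget v T)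
  show ?case
    by (rule retI, simp) (auto simp: body_td body_addv_def tag_cases_def intro!: callI[OF Forget.IH])
next
  case (Join S T)
  show ?case
    by (rule retI, simp) (auto simp: body_td body_addv_def tag_cases_def intro!: callI[OF Join.IH(1)] callI[OF Join.IH(2)])
qed

lemma ret_len: "length xs \<le> W \<Longrightarrow> ret F_len [enc_list f xs] (Num (length xs)) (length xs + 1)"
proof (induction xs)
  case Nil
  show ?case
    by (rule retI) (simp_all add: body_td body_len_def)
next
  case (Cons x xs)
  then show ?case
    by (intro retI, simp) (auto simp: body_td body_len_def intro!: callI[OF Cons.IH])
qed

lemma ret_fits:
  "length xs \<le> W \<Longrightarrow> ret F_fits [enc_list f xs, Num B] (Num (of_bool (length xs \<le> B))) (length xs + 2)"
  by (intro retI, simp) (auto simp: body_td body_fits_def intro!: callI[OF ret_len])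

lemma ret_or: "ret F_or [enc_entry e, enc_entry f] (enc_entry (or_entry e f)) 1"
  by (rule retI, simp, cases e) (auto simp: body_td body_or_def)

lemma ret_test:
  assumes "\<And>c s. e = Some (c, s) \<Longrightarrow> length s \<le> L" "length ws + length X \<le> W" "length X \<le> L" "length ws \<le> L"
  shows "ret F_test [enc_entry e, enc_list Num ws, enc_list Num X, Num M, Num B]
    (enc_entry (test_entry e ws X M B)) (test_cost L)"
proof (cases e)
  case None
  show ?thesis
    unfolding None by (rule retI) (simp_all add: body_td body_test_def test_cost_def)
next
  case (Some cs)
  obtain c s where cs: "cs = (c, s)"
    by (cases cs)
  let ?S = "filter_label X s M"
  have s: "length s \<le> L"
    using assms(1) Some cs by simp
  have f: "ret F_filt [enc_list Num vs, enc_assoc Num s, Num x] (enc_list Num (filter_label vs s x)) (L * (L + 2) + 1)"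
    if "length vs \<le> L" for vs x
    by (rule ret_mono[OF ret_filt[OF s]]) (use that in \<open>intro add_mono mult_le_mono, auto\<close>)
  have len: "length ?S \<le> L" "length (filter_label ws s x) \<le> L" "length (filter_label ws s x @ ?S) \<le> W"
    "length (filter_label ws s x @ ?S) \<le> 2 * L" for x
  proof -
    have "length ?S \<le> length X" "length (filter_label ws s x) \<le> length ws"
      by (rule length_filter_le)+
    then show "length ?S \<le> L" "length (filter_label ws s x) \<le> L" "length (filter_label ws s x @ ?S) \<le> W"
      "length (filter_label ws s x @ ?S) \<le> 2 * L"
      unfolding length_append using assms by linarith+
  qed
  have ap: "ret F_append [enc_list Num (filter_label ws s x), enc_list Num ?S] (enc_list Num (filter_label ws s x @ ?S)) (L + 1)" for x
    using len by (intro ret_mono[OF ret_append]) simp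
  have fi: "ret F_fits [enc_list Num (filter_label ws s x @ ?S), Num B] (Num (of_bool (length (filter_label ws s x @ ?S) \<le> B))) (2 * L + 2)" for x
    using len(3,4)[of x] by (intro ret_mono[OF ret_fits]) auto
  note fit = fits_def[of s ws X M B]
  show ?thesis
    unfolding Some cs test_entry.simps fit
    by (cases "length (filter_label ws s 0 @ ?S) \<le> B"; cases "length (filter_label ws s 1 @ ?S) \<le> B"; intro retI, simp)
      (auto simp: body_td body_test_def test_cost_def simp del: length_append
        intro!: callI[OF f[OF assms(3)]] callI[OF f[OF assms(4)]] callI[OF ap] callI[OF fi])
qed

text \<open>\<open>Q\<close> is an invariant of the domain list indexed by the number of labels
  still to be chosen. Subtracting 2 from the bound makes it inductive: three branches then leave
  room for the two calls of \<open>F_or\<close>.\<close>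

lemma ret_tryl:
  fixes cd :: nat
  assumes dp: "\<And>D. Q 0 D \<Longrightarrow> ret F_dp [enc_ntd T, enc_list enc_edge es, enc_assoc (enc_list Num) D] (enc_entry (g D)) cd"
    and len: "\<And>D c s. Q 0 D \<Longrightarrow> g D = Some (c, s) \<Longrightarrow> length s \<le> L"
    and Q: "\<And>k D w x. Q (Suc k) D \<Longrightarrow> x \<in> {0, 1, M} \<Longrightarrow> Q k ((w, [x]) # D)"
    and L: "length ws' + length X \<le> W" "length X \<le> L" "length ws' \<le> L"
  shows "Q (length ws) D \<Longrightarrow> ret F_tryl [enc_list Num ws, enc_assoc (enc_list Num) D, enc_ntd T, enc_list enc_edge es,
      enc_list Num ws', enc_list Num X, Num M, Num B]
    (enc_entry (try_labels (\<lambda>D. test_entry (g D) ws' X M B) M ws D)) (3 ^ length ws * (cd + test_cost L + 3) - 2)"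
proof (induction ws arbitrary: D)
  case Nil
  then have Q: "Q 0 D"
    by simp
  have t: "ret F_test [enc_entry (g D), enc_list Num ws', enc_list Num X, Num M, Num B]
    (enc_entry (test_entry (g D) ws' X M B)) (test_cost L)"
    using len[OF Q] L by (intro ret_test) auto
  show ?case
    by (intro retI, simp) (auto simp: body_td body_tryl_def intro!: callI[OF dp[OF Q]] callI[OF t])
next
  case (Cons w ws)
  let ?c = "3 ^ length ws * (cd + test_cost L + 3)"
  have IH: "ret F_tryl [enc_list Num ws, enc_assoc (enc_list Num) ((w, [x]) # D), enc_ntd T, enc_list enc_edge es,
      enc_list Num ws', enc_list Num X, Num M, Num B]
    (enc_entry (try_labels (\<lambda>D. test_entry (g D) ws' X M B) M ws ((w, [x]) # D))) (?c - 2)"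
    if "x \<in> {0, 1, M}" for x
    using Q[of "length ws" D x w] Cons.prems that by (intro Cons.IH) auto
  \<comment> \<open>Makes the truncated subtraction of 2 exact.\<close>
  have "1 * 3 \<le> ?c"
    by (intro mult_le_mono) auto
  then show ?case
    by (intro retI, simp) (auto simp: body_td body_tryl_def algebra_simps
      intro!: callI[OF IH[of 0, simplified]] callI[OF IH[of 1, simplified]] callI[OF IH[of M, simplified]] callI[OF ret_or])
qed

end

section \<open>Separators and the recursive construction\<close>

fun enc_opt :: "ntd option \<Rightarrow> val" where
  "enc_opt None = Num 0"
| "enc_opt (Some T) = enc_ntd T"

lemma is_cell_enc_ntd [simp]: "is_cell (enc_ntd T) = Suc 0"
  by (cases T) auto

fun combine :: "nat list \<Rightarrow> nat list \<Rightarrow> nat list \<Rightarrow> ntd option \<Rightarrow> ntd option \<Rightarrow> ntd option" where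
  "combine wa wc ns (Some S) (Some T) = Some (foldr Forget ns (Join (foldr Introduce wc S) (foldr Introduce wa T)))"
| "combine wa wc ns _ _ = None"

text \<open>\<open>k\<close> is the number of vertices whose labels are still to be chosen.\<close>

definition valid :: "nat \<Rightarrow> nat \<Rightarrow> nat \<Rightarrow> (nat \<times> nat list) list \<Rightarrow> bool" where
  "valid M m k D \<longleftrightarrow> length D + k \<le> m \<and> (\<forall>v. set (doms D v) \<subseteq> {0, 1, M} \<and> length (doms D v) \<le> 3)"

lemma doms_Cons: "doms ((w, xs) # D) v = (if v = w then xs else doms D v)"
  by (auto simp: doms_def)

lemma valid_Cons: "valid M m (Suc k) D \<Longrightarrow> x \<in> {0, 1, M} \<Longrightarrow> valid M m k ((w, [x]) # D)"
  by (auto simp: valid_def doms_Cons)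

definition label_domains :: "nat \<Rightarrow> nat \<Rightarrow> (nat \<times> nat list) list" where
  "label_domains i M = map (\<lambda>v. (v, [0, 1, M])) (rev [0..<i])"

lemma doms_label_domains: "doms (label_domains i M) v = (if v < i then [0, 1, M] else [])"
  unfolding doms_def label_domains_def by (induction i) auto

lemma try_labels_sound:
  "valid M m (length ws) D \<Longrightarrow> try_labels f M ws D = Some e \<Longrightarrow> \<exists>D'. valid M m 0 D' \<and> f D' = Some e"
proof (induction ws arbitrary: D)
  case (Cons w ws)
  have v: "valid M m (length ws) ((w, [x]) # D)" if "x \<in> {0, 1, M}" for x
    using Cons.prems(1) that by (intro valid_Cons) auto
  have "\<exists>x\<in>{0, 1, M}. try_labels f M ws ((w, [x]) # D) = Some e"
    using Cons.prems(2)
    by (cases "try_labels f M ws ((w, [0]) # D)"; cases "try_labels f M ws ((w, [1]) # D)") auto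
  then show ?case
    using Cons.IH v by blast
qed auto

text \<open>Only success is claimed, since another labelling may be found before
  \<open>l\<close>.\<close>

lemma try_labels_complete:
  "(\<And>w. w \<in> set ws \<Longrightarrow> l w \<in> {0, 1, M}) \<Longrightarrow> f (rev (map (\<lambda>w. (w, [l w])) ws) @ D) \<noteq> None \<Longrightarrow>
   try_labels f M ws D \<noteq> None"
proof (induction ws arbitrary: D)
  case (Cons w ws)
  have IH: "try_labels f M ws ((w, [l w]) # D) \<noteq> None"
    using Cons.prems by (intro Cons.IH) auto
  have "l w \<in> {0, 1, M}"
    using Cons.prems(1) by simp
  then show ?case
    using IH
    by (cases "try_labels f M ws ((w, [0]) # D)"; cases "try_labels f M ws ((w, [1]) # D)") auto
qed simp

lemma doms_append_labels:
  "doms (rev (map (\<lambda>w. (w, [l w])) ws) @ D) v = (if v \<in> set ws then [l v] else doms D v)"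
  by (induction ws arbitrary: D) (auto simp: doms_Cons)

definition dec_cost :: "nat \<Rightarrow> nat \<Rightarrow> nat \<Rightarrow> nat \<Rightarrow> nat" where
  "dec_cost N n w B = 3 ^ (B + 1) * (comp_cost N 3 w + test_cost n + 3) + N * (2 * n + 3) +
     6 * (n * (n + 2)) + 10 * n + 40"

locale decomp_run = prog_td +
  fixes es :: "edge_entry list" and T :: ntd and n i N M B s w :: nat
  assumes M: "M = n + 1" and i: "i \<le> n"
    and T: "good T" "root_bag T = {}" "forg T = {..<i}" "nsize T \<le> N" "\<forall>X\<in>bags T. card X \<le> w"
    and cov: "\<And>u v a b. (u, v, a, b) \<in> set es \<Longrightarrow> u < i \<Longrightarrow> v < i \<Longrightarrow> \<exists>X\<in>bags T. u \<in> X \<and> v \<in> X"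
    and N: "w \<le> N" "length es \<le> N" "2 * n \<le> N"
    and B: "B = 3 * s + 2"
    and W: "2 * M \<le> W" "n * M \<le> W" "2 * n \<le> W"
begin

abbreviation "min_cut X D \<equiv> ent (cut_edges es (set X)) (doms D) T (look [])"
abbreviation "attempt ws X D \<equiv> test_entry (min_cut X D) ws X M B"

lemma covers_cut: "set X \<subseteq> {..<i} \<Longrightarrow> covers T (cut_edges es (set X))"
  unfolding covers_def
proof clarify
  fix u v a b assume "set X \<subseteq> {..<i}" "(u, v, a, b) \<in> set (cut_edges es (set X))"
  then obtain a' b' where "(u, v, a', b') \<in> set es" "u < i" "v < i"
    by (auto simp: mem_cut_edges)
  then show "\<exists>X\<in>bags T. u \<in> X \<and> v \<in> X"
    by (rule cov)
qed

lemma cut_sound: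
  assumes "set X \<subseteq> {..<i}" "min_cut X D = Some (c, t)"
  shows "\<forall>v<i. look t v \<in> set (doms D v)" "c = (\<Sum>v<i. look t v)" "length t = i"
    "\<And>u v a b. (u, v, a, b) \<in> set es \<Longrightarrow> u \<in> set X \<Longrightarrow> v \<in> set X \<Longrightarrow> look t u + look t v \<noteq> 1"
proof -
  note * = ent_root_sound[OF T(1,2) covers_cut[OF assms(1)] assms(2), unfolded T(3)]
  show "\<forall>v<i. look t v \<in> set (doms D v)" "c = (\<Sum>v<i. look t v)" "length t = i"
    using * by auto
  fix u v a b assume "(u, v, a, b) \<in> set es" "u \<in> set X" "v \<in> set X"
  then have "(u, v, 0, 0) \<in> set (cut_edges es (set X))"
    by (auto simp: mem_cut_edges)
  then have "edge_ok 0 0 (look t u) (look t v)"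
    using * by blast
  then show "look t u + look t v \<noteq> 1"
    by (simp add: edge_ok_def)
qed

lemma ret_attempts:
  assumes "set X \<subseteq> {..<i}" "distinct X" "distinct ws" "set ws \<subseteq> {..<i}"
  shows "ret F_tryl [enc_list Num ws, enc_assoc (enc_list Num) (label_domains i M), enc_ntd T,
      enc_list enc_edge (cut_edges es (set X)), enc_list Num ws, enc_list Num X, Num M, Num B]
    (enc_entry (try_labels (attempt ws X) M ws (label_domains i M)))
    (3 ^ length ws * (comp_cost N 3 w + test_cost n + 3))"
proof -
  have len: "length X \<le> i" "length ws \<le> i"
    using assms distinct_card card_mono[of "{..<i}" "set X"] card_mono[of "{..<i}" "set ws"] by (metis card_lessThan finite_lessThan)+
  show ?thesis
  \<comment> \<open>The domain list has \<open>i\<close> entries for all vertices and one further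
    entry for each vertex of \<open>ws\<close>, hence at most \<open>2 * n\<close>.\<close>
  proof (rule ret_mono[OF ret_tryl[where Q = "valid M (2 * n)"]])
    fix D assume D: "valid M (2 * n) 0 D"
    interpret dp_run P W S "cut_edges es (set X)" D n N M 3
    proof
      show "length (cut_edges es (set X)) \<le> N"
        using length_cut_edges N(2) by (rule order.trans)
      show "x \<le> M" if "x \<in> set (doms D v)" for x v
      proof -
        have "x \<in> {0, 1, M}"
          using that D by (auto simp: valid_def)
        then show ?thesis
          by (auto simp: M)
      qed
    qed (use D N W in \<open>auto simp: valid_def\<close>)
    show "ret F_dp [enc_ntd T, enc_list enc_edge (cut_edges es (set X)), enc_assoc (enc_list Num) D]
      (enc_entry (min_cut X D)) (comp_cost N 3 w)"
      using T N i prog_solve_axioms by (intro ret_dp) auto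
    show "length t \<le> n" if "min_cut X D = Some (c, t)" for c t
      using cut_sound(3)[OF assms(1) that] i by simp
  next
    show "valid M (2 * n) (length ws) (label_domains i M)"
      using len i by (auto simp: valid_def doms_label_domains) (simp add: label_domains_def)
  qed (use valid_Cons len i W in auto)
qed

lemma attempts_sound:
  assumes "set X \<subseteq> {..<i}" "length ws \<le> i" "try_labels (attempt ws X) M ws (label_domains i M) = Some (c, t)"
  shows "\<forall>v<i. look t v \<in> {0, 1, M}" "length t = i" "fits t ws X M B"
    "\<And>u v a b. (u, v, a, b) \<in> set es \<Longrightarrow> u \<in> set X \<Longrightarrow> v \<in> set X \<Longrightarrow> look t u + look t v \<noteq> 1"
proof -
  have "valid M (2 * n) (length ws) (label_domains i M)"
    using assms(2) i by (auto simp: valid_def doms_label_domains) (simp add: label_domains_def)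
  then obtain D where D: "valid M (2 * n) 0 D" "attempt ws X D = Some (c, t)"
    using try_labels_sound assms(3) by blast
  then have cut: "min_cut X D = Some (c, t)" and "fits t ws X M B"
    by (cases "min_cut X D"; force split: if_splits)+
  then show "fits t ws X M B"
    by simp
  show "\<forall>v<i. look t v \<in> {0, 1, M}" "length t = i"
    using cut_sound(1,3)[OF assms(1) cut] D(1) unfolding valid_def by blast+
  show "\<And>u v a b. (u, v, a, b) \<in> set es \<Longrightarrow> u \<in> set X \<Longrightarrow> v \<in> set X \<Longrightarrow> look t u + look t v \<noteq> 1"
    using cut_sound(4)[OF assms(1) cut] .
qed

text \<open>An inclusion instead of an equality lets one decomposition of the whole graph serve for
  every prefix of the vertices.\<close>

definition opt :: bool where
  "opt \<longleftrightarrow> (\<exists>U. good U \<and> {..<i} \<subseteq> forg U \<and> (\<forall>X\<in>bags U. card X \<le> s) \<and> covers U es)"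

text \<open>A minimum cut that agrees with a balanced separation on \<open>ws\<close> is no larger than that separation,
  since a cut vertex costs more than all the others together.\<close>

lemma attempts_complete:
  assumes opt and X: "set X \<subseteq> {..<i}" "distinct X" and ws: "set ws \<subseteq> set X" "distinct ws" "length ws \<le> B + 1"
  shows "try_labels (attempt ws X) M ws (label_domains i M) \<noteq> None"
proof -
  obtain U where U: "good U" "{..<i} \<subseteq> forg U" "\<forall>X\<in>bags U. card X \<le> s" "covers U es"
    using assms(1) by (auto simp: opt_def)
  \<comment> \<open>Balanced separation is applied with \<open>k = s + 1\<close>, as
    \<open>B + 1 = 3 * (s + 1)\<close>.\<close>
  have "card (set ws) \<le> 3 * (s + 1)" "set ws \<subseteq> forg U"
    using ws X U(2) by (auto simp: distinct_card B)
  from balanced_separation[OF U(1,3) this(2,1)] obtain A S where AS: "A \<inter> S = {}" "card S \<le> s" "finite S"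
    "card (set ws \<inter> A) \<le> 2 * (s + 1)" "card (set ws - A) \<le> 2 * (s + 1)" "\<forall>X\<in>bags U. X \<subseteq> A \<union> S \<or> X \<inter> A = {}"
    by blast
  define l where "l = (\<lambda>v. if v \<in> S then M else if v \<in> A then 0 else 1)"
  \<comment> \<open>Outside \<open>X\<close> there are no constraints, and the label 0 is free of
    charge.\<close>
  define q where "q = (\<lambda>v. if v \<in> set X then l v else 0)"
  define D where "D = rev (map (\<lambda>w. (w, [l w])) ws) @ label_domains i M"
  have doms: "doms D v = (if v \<in> set ws then [l v] else if v < i then [0, 1, M] else [])" for v
    by (simp add: D_def doms_append_labels doms_label_domains)
  have "\<forall>v\<in>forg T. q v \<in> set (doms D v)"
    using ws(1) unfolding T(3) doms by (auto simp: q_def l_def)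
  moreover have "\<forall>(u, v, a, b) \<in> set (cut_edges es (set X)). edge_ok a b (q u) (q v)"
  proof clarify
    fix u v a b assume "(u, v, a, b) \<in> set (cut_edges es (set X))"
    then obtain a' b' where e: "a = 0" "b = 0" "u \<in> set X" "v \<in> set X" "(u, v, a', b') \<in> set es"
      by (auto simp: mem_cut_edges)
    then obtain Y where Y: "Y \<in> bags U" "u \<in> Y" "v \<in> Y"
      using U(4) by (fastforce simp: covers_def)
    have "0 < n"
      using e(3) X(1) i by auto
    then show "edge_ok a b (q u) (q v)"
      using AS(1,6) Y e by (auto simp: edge_ok_def q_def l_def M)
  qed
  ultimately obtain c t where ct: "min_cut X D = Some (c, t)" "c \<le> (\<Sum>v<i. q v)"
    using ent_root_opt[OF T(1,2) covers_cut[OF X(1)], of q "doms D" "look []"] T(3) by auto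
  note snd = cut_sound[OF X(1) ct(1)]
  have "(\<Sum>v<i. q v) \<le> (\<Sum>v<i. (if v \<in> S then M else 0) + 1)"
    by (intro sum_mono) (auto simp: q_def l_def)
  also have "\<dots> = M * card ({..<i} \<inter> S) + i"
    by (subst sum.distrib) (simp add: sum.If_cases)
  also have "\<dots> \<le> M * s + n"
    using AS(2,3) i card_mono[of S "{..<i} \<inter> S"] by (intro add_mono mult_le_mono2) auto
  finally have c: "c < M * (s + 1)"
    using ct(2) by (simp add: M algebra_simps)
  let ?S = "filter_label X t M"
  have "M * length ?S = (\<Sum>v\<in>set ?S. look t v)"
    using X(2) by (simp add: distinct_card[symmetric])
  also have "\<dots> \<le> (\<Sum>v<i. look t v)"
    using X(1) by (intro sum_mono2) auto
  finally have "M * length ?S < M * (s + 1)"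
    using c snd(2) by simp
  then have "length ?S < s + 1"
    by (metis mult_less_cancel1)
  then have S: "length ?S \<le> s"
    by simp
  \<comment> \<open>On \<open>ws\<close> the minimum cut has no choice, as the domains there are
    singletons; so it inherits the balance of the separation.\<close>
  have lt: "look t v = l v" if v: "v \<in> set ws" for v
  proof -
    have "v < i"
      using v ws(1) X(1) by auto
    then have "look t v \<in> set (doms D v)"
      using snd(1) by simp
    then show ?thesis
      using v doms[of v] by simp
  qed
  have "0 < n" if "ws \<noteq> []"
    using that ws(1) X(1) i by (cases ws) auto
  then have sub: "set (filter_label ws t 0) \<subseteq> set ws \<inter> A" "set (filter_label ws t 1) \<subseteq> set ws - A"
    using lt AS(1) by (auto simp: l_def M split: if_splits)
  have "length (filter_label ws t 0) \<le> 2 * (s + 1)" "length (filter_label ws t 1) \<le> 2 * (s + 1)"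
    using card_mono[OF _ sub(1)] card_mono[OF _ sub(2)] AS(4,5) ws(2)
    by (auto simp: distinct_card[symmetric] simp del: set_filter)
  then have "fits t ws X M B"
    using S by (simp add: fits_def B)
  then have "attempt ws X D \<noteq> None"
    using ct(1) by simp
  then show ?thesis
    unfolding D_def by (intro try_labels_complete) (auto simp: l_def)
qed

end

lemma (in prog_td) ret_dec3:
  assumes "length wa \<le> n" "length wc \<le> n" "length ns \<le> n"
  shows "ret F_dec3 [enc_list Num wa, enc_list Num wc, enc_list Num ns, enc_opt a, enc_opt c]
    (enc_opt (combine wa wc ns a c)) (3 * n + 4)"
proof (cases a)
  case None
  then show ?thesis
    by (intro retI, simp) (simp add: body_td body_dec3_def)
next
  case a: (Some S)
  show ?thesis
  proof (cases c)
    case None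
    then show ?thesis
      using a by (intro retI, simp) (simp add: body_td body_dec3_def)
  next
    case c: (Some T)
    note f = ret_forgets[of ns "Join (foldr Introduce wc S) (foldr Introduce wa T)", unfolded enc_ntd.simps]
    show ?thesis
      using assms
      by (intro retI, simp) (auto simp: a c body_td body_dec3_def
        intro!: callI[OF ret_introduces] callI[OF f])
  qed
qed

lemma length_filter_disjoint:
  "(\<And>x. \<not> (P x \<and> Q x)) \<Longrightarrow> length (filter P xs) + length (filter Q xs) \<le> length xs"
proof (induction xs)
  case (Cons x xs)
  then show ?case
    using Cons.prems[of x] by auto
qed simp

text \<open>Common induction step for the size of the tree and the running time. With the weight
  \<open>2 * length R + 1\<close>, two disjoint parts of \<open>R\<close> without its first vertex
  leave one unit for the current call.\<close>

lemma branch_bound: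
  fixes d :: nat
  assumes "x + y + 1 \<le> z" "a \<le> x * d" "b \<le> y * d" "c \<le> d"
  shows "a + b + c \<le> z * d"
proof -
  have "a + b + c \<le> (x + y + 1) * d"
    using assms(2-4) by (simp add: distrib_right)
  also have "\<dots> \<le> z * d"
    using assms(1) by (rule mult_le_mono1)
  finally show ?thesis .
qed

context decomp_run
begin

abbreviation "dec_args \<equiv> [enc_ntd T, enc_list enc_edge es, enc_assoc (enc_list Num) (label_domains i M), Num M, Num B]"

text \<open>The recursion has at most \<open>2 * length R + 1\<close> calls, and each of them
  contributes at most \<open>3 * n + 2\<close> tree nodes.\<close>

definition decomposes :: "nat list \<Rightarrow> nat list \<Rightarrow> ntd \<Rightarrow> bool" where
  "decomposes R ws U \<longleftrightarrow> good U \<and> root_bag U = set ws \<and> forg U = set R \<and> (\<forall>X\<in>bags U. card X \<le> 2 * B) \<and>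
     (\<forall>(u, v, a, b) \<in> set es. u \<in> set (R @ ws) \<longrightarrow> v \<in> set (R @ ws) \<longrightarrow> (\<exists>X\<in>bags U. u \<in> X \<and> v \<in> X)) \<and>
     nsize U \<le> (2 * length R + 1) * (3 * n + 2)"

text \<open>No edge joins the labels 0 and 1, so both its ends lie in the part of \<open>TA\<close>
  (labels 0 and M) or in that of \<open>TC\<close> (labels 1 and M). After the join,
  \<open>u\<close> and the cut vertices from \<open>R\<close> are forgotten, which leaves exactly
  \<open>ws\<close> as the root bag.\<close>

lemma decomposes_combine:
  assumes R: "R = u # R1" "distinct (R @ ws)"
    and lab: "\<And>v. v \<in> set (R @ ws) \<Longrightarrow> look t v \<in> {0, 1, M}" and M: "1 < M"
    and es: "\<And>u v a b. (u, v, a, b) \<in> set es \<Longrightarrow> u \<in> set (R @ ws) \<Longrightarrow> v \<in> set (R @ ws) \<Longrightarrow> look t u + look t v \<noteq> 1"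
    and fits: "fits t (u # ws) (R @ ws) M B" and n: "length (R @ ws) \<le> n"
    and wa: "wa = filter_label (u # ws) t 0" and wc: "wc = filter_label (u # ws) t 1"
    and sl: "sl = filter_label (R @ ws) t M"
    and TA: "decomposes (filter_label R1 t 0) (wa @ sl) TA"
    and TC: "decomposes (filter_label R1 t 1) (wc @ sl) TC"
  shows "decomposes R ws (foldr Forget (u # filter_label R1 t M) (Join (foldr Introduce wc TA) (foldr Introduce wa TC)))"
proof -
  let ?ra = "filter_label R1 t 0" and ?rc = "filter_label R1 t 1" and ?ws = "u # ws" and ?ns = "u # filter_label R1 t M"
  have A: "good TA" "root_bag TA = set wa \<union> set sl" "forg TA = set ?ra" "\<forall>X\<in>bags TA. card X \<le> 2 * B"
    and C: "good TC" "root_bag TC = set wc \<union> set sl" "forg TC = set ?rc" "\<forall>X\<in>bags TC. card X \<le> 2 * B"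
    using TA TC by (auto simp: decomposes_def)
  have dist: "distinct wa" "distinct wc" "distinct ?ns"
    using R by (auto simp: wa wc)
  have "set wc \<inter> (root_bag TA \<union> forg TA) = {}" "set wa \<inter> (root_bag TC \<union> forg TC) = {}"
    using A(2,3) C(2,3) M by (auto simp: wa wc sl)
  note IA = foldr_Introduce[OF dist(2) this(1) A(1)] and IC = foldr_Introduce[OF dist(1) this(2) C(1)]
  define J where "J = Join (foldr Introduce wc TA) (foldr Introduce wa TC)"
  have J: "good J" "root_bag J = set wa \<union> set sl \<union> set wc" "forg J = set ?ra \<union> set ?rc"
    "bags TA \<union> bags TC \<subseteq> bags J" "\<forall>X\<in>bags J. X \<in> bags TA \<or> X \<in> bags TC \<or> X \<subseteq> set wa \<union> set sl \<union> set wc"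
    "nsize J = nsize TA + nsize TC + length wa + length wc + 1"
    using IA IC A C by (auto simp: J_def)
  have "set ?ns \<subseteq> root_bag J"
    using lab[of u] by (auto simp: J(2) R(1) wa wc sl)
  note F = foldr_Forget[OF dist(3) this J(1)]
  define Z where "Z = foldr Forget ?ns J"
  have Z: "good Z" "root_bag Z = root_bag J - set ?ns" "forg Z = forg J \<union> set ?ns"
    "\<forall>X\<in>bags Z. X \<in> bags J \<or> X \<subseteq> root_bag J" "bags J \<subseteq> bags Z" "nsize Z = nsize J + length ?ns"
    using F unfolding Z_def by blast+
  have z1: "root_bag Z = set ws"
  proof (rule set_eqI)
    fix v
    show "v \<in> root_bag Z \<longleftrightarrow> v \<in> set ws"
      using R lab[of v] unfolding Z(2) J(2) by (auto simp: wa wc sl)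
  qed
  have z2: "forg Z = set R"
  proof (rule set_eqI)
    fix v
    show "v \<in> forg Z \<longleftrightarrow> v \<in> set R"
      using R lab[of v] unfolding Z(3) J(3) by auto
  qed
  have z3: "card X \<le> 2 * B" if "X \<in> bags Z" for X
  proof -
    \<comment> \<open>The cut vertices are counted with one side only, so the two bounds from
      \<open>fits\<close> give \<open>2 * B\<close>.\<close>
    have "card (set (wa @ sl)) \<le> B" "card (set wc) \<le> B"
      using fits card_length[of "wa @ sl"] card_length[of "wc"] by (auto simp: fits_def wa wc sl)
    then have "card (set (wa @ sl) \<union> set wc) \<le> 2 * B"
      using card_Un_le[of "set (wa @ sl)" "set wc"] by linarith
    moreover have "set (wa @ sl) \<union> set wc = set wa \<union> set sl \<union> set wc"
      by auto
    ultimately have "card Y \<le> 2 * B" if "Y \<subseteq> set wa \<union> set sl \<union> set wc" for Y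
      using that card_mono[of "set wa \<union> set sl \<union> set wc" Y] by simp
    then show ?thesis
      using that A(4) C(4) J(2,5) Z(4) by metis
  qed
  have z4: "\<exists>X\<in>bags Z. x \<in> X \<and> y \<in> X" if e: "(x, y, a, b) \<in> set es" "x \<in> set (R @ ws)" "y \<in> set (R @ ws)" for x y a b
  proof -
    have "look t x + look t y \<noteq> 1"
      using es e by blast
    then consider "look t x \<in> {0, M}" "look t y \<in> {0, M}" | "look t x \<in> {1, M}" "look t y \<in> {1, M}"
      using lab[OF e(2)] lab[OF e(3)] by auto
    then have "\<exists>X\<in>bags TA \<union> bags TC. x \<in> X \<and> y \<in> X"
    proof cases
      case 1
      then have "x \<in> set (?ra @ wa @ sl)" "y \<in> set (?ra @ wa @ sl)"
        using e(2,3) unfolding wa sl R(1) set_append set_filter list.set by blast+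
      then show ?thesis
        using TA e(1) unfolding decomposes_def by blast
    next
      case 2
      then have "x \<in> set (?rc @ wc @ sl)" "y \<in> set (?rc @ wc @ sl)"
        using e(2,3) unfolding wc sl R(1) set_append set_filter list.set by blast+
      then show ?thesis
        using TC e(1) unfolding decomposes_def by blast
    qed
    then show ?thesis
      using J(4) Z(5) by blast
  qed
  have z5: "nsize Z \<le> (2 * length R + 1) * (3 * n + 2)"
  proof -
    have le: "length ?ws \<le> n" "Suc (length R1) \<le> n"
      using n R(1) by auto
    have len: "length wa \<le> n" "length wc \<le> n"
      unfolding wa wc by (rule order.trans[OF length_filter_le le(1)])+
    have "length ?ns \<le> n"
      using le(2) length_filter_le[of "\<lambda>v. look t v = M" R1] unfolding list.size by linarith
    note len = len this
    have "length ?ra + length ?rc \<le> length R1"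
      by (rule length_filter_disjoint) linarith
    then have "2 * length ?ra + 1 + (2 * length ?rc + 1) + 1 \<le> 2 * length R + 1"
      by (simp add: R(1))
    moreover have "nsize TA \<le> (2 * length ?ra + 1) * (3 * n + 2)" "nsize TC \<le> (2 * length ?rc + 1) * (3 * n + 2)"
      using TA TC by (auto simp: decomposes_def)
    moreover have "length wa + length wc + 1 + length ?ns \<le> 3 * n + 2"
      using len by linarith
    ultimately have "nsize TA + nsize TC + (length wa + length wc + 1 + length ?ns) \<le> (2 * length R + 1) * (3 * n + 2)"
      by (rule branch_bound)
    then show ?thesis
      unfolding Z(6) J(6) by linarith
  qed
  have "decomposes R ws Z"
    unfolding decomposes_def
  proof (intro conjI)
    show "\<forall>(u, v, a, b) \<in> set es. u \<in> set (R @ ws) \<longrightarrow> v \<in> set (R @ ws) \<longrightarrow> (\<exists>X\<in>bags Z. u \<in> X \<and> v \<in> X)"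
      using z4 by blast
  qed (use Z(1) z1 z2 z3 z5 in blast)+
  then show ?thesis
    unfolding Z_def J_def .
qed

text \<open>Moving a vertex \<open>u\<close> from \<open>R\<close> to the interface guarantees
  progress even if the separation puts all other vertices on one side. A failure of any attempt
  refutes \<open>opt\<close>.\<close>

lemma ret_decomp:
  "distinct (R @ ws) \<Longrightarrow> set (R @ ws) \<subseteq> {..<i} \<Longrightarrow> length ws \<le> B \<Longrightarrow>
   \<exists>r. ret F_decomp (enc_list Num R # enc_list Num ws # dec_args) (enc_opt r) ((2 * length R + 1) * dec_cost N n w B) \<and>
     (\<forall>U. r = Some U \<longrightarrow> decomposes R ws U) \<and> (opt \<longrightarrow> r \<noteq> None)"
proof (induction "length R" arbitrary: R ws rule: less_induct)
  case less
  have cost_pos: "40 \<le> dec_cost N n w B"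
    by (simp add: dec_cost_def)
  have nX: "length (R @ ws) \<le> n"
    using card_mono[OF _ less.prems(2)] i distinct_card[OF less.prems(1)] by simp
  show ?case
  proof (cases R)
    case Nil
    have "ret F_decomp (enc_list Num R # enc_list Num ws # dec_args) (enc_opt (Some (Leaf ws))) (dec_cost N n w B)"
      using cost_pos by (intro retI, simp) (simp add: body_td body_decomp_def Nil)
    moreover have "decomposes R ws (Leaf ws)"
      using less.prems Nil card_length[of ws] by (auto simp: decomposes_def)
    ultimately show ?thesis
      using Nil by (intro exI[of _ "Some (Leaf ws)"]) simp
  next
    case (Cons u R1)
    let ?X = "R @ ws" and ?ws = "u # ws"
    have M1: "1 < M"
      using nX Cons M by simp
    have ws: "set ?ws \<subseteq> set ?X" "distinct ?ws" "length ?ws \<le> B + 1" "length ?ws \<le> n" "set ?ws \<subseteq> {..<i}" "length ?ws \<le> i"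
      using less.prems Cons nX card_mono[of "{..<i}" "set ?ws"] distinct_card[of ?ws] by auto
    define e where "e = try_labels (attempt ?ws ?X) M ?ws (label_domains i M)"
    let ?ct = "3 ^ (B + 1) * (comp_cost N 3 w + test_cost n + 3)"
    have tryl: "ret F_tryl [enc_list Num ?ws, enc_assoc (enc_list Num) (label_domains i M), enc_ntd T,
      enc_list enc_edge (cut_edges es (set ?X)), enc_list Num ?ws, enc_list Num ?X, Num M, Num B] (enc_entry e) ?ct"
      unfolding e_def
      by (rule ret_mono[OF ret_attempts[OF less.prems(2,1) ws(2,5)]], intro mult_le_mono1 power_increasing) (use ws(3) in auto)
    have cuts: "ret F_cuts [enc_list enc_edge es, enc_list Num ?X] (enc_list enc_edge (cut_edges es (set ?X))) (N * (2 * n + 3) + 1)"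
      by (rule ret_mono[OF ret_cuts[OF nX]]) (use N(2) in \<open>auto intro!: mult_le_mono1\<close>)
    have app: "ret F_append [enc_list Num R, enc_list Num ws] (enc_list Num ?X) (n + 1)"
      by (rule ret_mono[OF ret_append]) (use nX in auto)
    have dec: "ret F_decomp (enc_list Num R # enc_list Num ws # dec_args) v (?ct + N * (2 * n + 3) + n + 4 + d)"
      if d2: "ret F_dec2 (Num u # enc_list Num R1 # enc_list Num ws # enc_list Num ?X # dec_args @ [enc_entry e]) v d" for v d
    proof -
      have d1: "ret F_dec1 (Num u # enc_list Num R1 # enc_list Num ws # enc_list Num ?X # dec_args) v
        (?ct + N * (2 * n + 3) + 2 + d)"
        by (intro retI, simp) (auto simp: body_td body_dec1_def
          intro!: callI[OF cuts] callI[OF tryl[simplified]] callI[OF d2[simplified]])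
      show ?thesis
        by (intro retI, simp) (use Cons in \<open>auto simp: body_td body_decomp_def
          intro!: callI[OF app[unfolded Cons enc_list.simps append_Cons]] callI[OF d1[unfolded Cons append_Cons enc_list.simps]]\<close>)
    qed
    show ?thesis
    proof (cases e)
      case None
      have "ret F_dec2 (Num u # enc_list Num R1 # enc_list Num ws # enc_list Num ?X # dec_args @ [enc_entry e]) (enc_opt None) 1"
        by (intro retI, simp) (simp add: body_td body_dec2_def None)
      from dec[OF this] have "ret F_decomp (enc_list Num R # enc_list Num ws # dec_args) (enc_opt None) ((2 * length R + 1) * dec_cost N n w B)"
        by (rule ret_mono) (simp add: dec_cost_def)
      moreover have "\<not> opt"
        using attempts_complete[OF _ less.prems(2,1) ws(1-3)] None by (auto simp: e_def)
      ultimately show ?thesis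
        by (intro exI[of _ None]) simp
    next
      case (Some ct)
      then obtain c t where e: "e = Some (c, t)"
        by (cases ct) auto
      note snd = attempts_sound[OF less.prems(2) ws(6) e[unfolded e_def]]
      define wa where "wa = filter_label ?ws t 0"
      define wc where "wc = filter_label ?ws t 1"
      define sl where "sl = filter_label ?X t M"
      define ra where "ra = filter_label R1 t 0"
      define rc where "rc = filter_label R1 t 1"
      define ns where "ns = u # filter_label R1 t M"
      have sub: "distinct (ra @ wa @ sl)" "set (ra @ wa @ sl) \<subseteq> {..<i}" "length (wa @ sl) \<le> B"
        "distinct (rc @ wc @ sl)" "set (rc @ wc @ sl) \<subseteq> {..<i}" "length (wc @ sl) \<le> B"
        using less.prems Cons M1 snd(3) by (auto simp: ra_def rc_def wa_def wc_def sl_def fits_def)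
      have len_sum: "length ra + length rc \<le> length R1"
        unfolding ra_def rc_def by (rule length_filter_disjoint) linarith
      then have len: "length ra < length R" "length rc < length R"
        by (auto simp: Cons)
      obtain a where a: "ret F_decomp (enc_list Num ra # enc_list Num (wa @ sl) # dec_args) (enc_opt a) ((2 * length ra + 1) * dec_cost N n w B)"
        "\<And>U. a = Some U \<Longrightarrow> decomposes ra (wa @ sl) U" "opt \<Longrightarrow> a \<noteq> None"
        using less.hyps[OF len(1) sub(1-3)] by blast
      obtain d where d: "ret F_decomp (enc_list Num rc # enc_list Num (wc @ sl) # dec_args) (enc_opt d) ((2 * length rc + 1) * dec_cost N n w B)"
        "\<And>U. d = Some U \<Longrightarrow> decomposes rc (wc @ sl) U" "opt \<Longrightarrow> d \<noteq> None"
        using less.hyps[OF len(2) sub(4-6)] by blast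
      let ?r = "combine wa wc ns a d"
      have tn: "length t \<le> n"
        using snd(2) i by simp
      have f: "ret F_filt [enc_list Num vs, enc_assoc Num t, Num x] (enc_list Num (filter_label vs t x)) (n * (n + 2) + 1)"
        if "length vs \<le> n" for vs x
        by (rule ret_mono[OF ret_filt[OF tn]]) (use that in \<open>intro add_mono mult_le_mono, auto\<close>)
      have R1n: "length R1 \<le> n"
        using nX Cons by simp
      have le: "Suc (length R1) \<le> n"
        using nX Cons by simp
      have lens: "length wa \<le> n" "length wc \<le> n" "length ns \<le> n"
      proof -
        show "length wa \<le> n" "length wc \<le> n"
          unfolding wa_def wc_def by (rule order.trans[OF length_filter_le ws(4)])+
        show "length ns \<le> n"
          using le length_filter_le[of "\<lambda>v. look t v = M" R1] unfolding ns_def list.size by linarith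
      qed
      have ap: "ret F_append [enc_list Num wa, enc_list Num sl] (enc_list Num (wa @ sl)) (n + 1)"
        "ret F_append [enc_list Num wc, enc_list Num sl] (enc_list Num (wc @ sl)) (n + 1)"
        using lens by (auto intro!: ret_mono[OF ret_append])
      let ?c = "n * (n + 2) + 1"
      have fS: "ret F_filt [enc_list Num ?X, enc_assoc Num t, Num M] (enc_list Num sl) ?c"
        using f[OF nX] by (simp add: sl_def)
      have fa: "ret F_filt [Cell (Num u) (enc_list Num ws), enc_assoc Num t, Num 0] (enc_list Num wa) ?c"
        and fc: "ret F_filt [Cell (Num u) (enc_list Num ws), enc_assoc Num t, Num (Suc 0)] (enc_list Num wc) ?c"
        using f[OF ws(4), of 0] f[OF ws(4), of "Suc 0"] unfolding wa_def wc_def enc_list.simps One_nat_def .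
      have fra: "ret F_filt [enc_list Num R1, enc_assoc Num t, Num 0] (enc_list Num ra) ?c"
        and frc: "ret F_filt [enc_list Num R1, enc_assoc Num t, Num (Suc 0)] (enc_list Num rc) ?c"
        and fns: "ret F_filt [enc_list Num R1, enc_assoc Num t, Num M] (enc_list Num (filter_label R1 t M)) ?c"
        using f[OF R1n, of 0] f[OF R1n, of "Suc 0"] f[OF R1n, of M] unfolding ra_def rc_def One_nat_def .
      have "ret F_dec2 (Num u # enc_list Num R1 # enc_list Num ws # enc_list Num ?X # dec_args @ [enc_entry e]) (enc_opt ?r)
        (6 * (n * (n + 2)) + 5 * n + 16 + (2 * length ra + 1) * dec_cost N n w B + (2 * length rc + 1) * dec_cost N n w B)"
        using a(1) d(1)
        by (intro retI, simp) (auto simp: body_td body_dec2_def e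
          intro!: callI[OF fS] callI[OF fa] callI[OF fc] callI[OF fra] callI[OF frc] callI[OF fns]
            callI[OF ap(1)] callI[OF ap(2)] callI[OF a(1)] callI[OF d(1)]
            callI[OF ret_dec3[OF lens, unfolded ns_def enc_list.simps]] simp: ns_def)
      from dec[OF this] have "ret F_decomp (enc_list Num R # enc_list Num ws # dec_args) (enc_opt ?r) ((2 * length R + 1) * dec_cost N n w B)"
      proof (rule ret_mono)
        let ?d = "dec_cost N n w B"
        have sum: "(2 * length ra + 1) + (2 * length rc + 1) + 1 \<le> 2 * length R + 1"
          using len_sum by (simp add: Cons)
        have "?ct + N * (2 * n + 3) + n + 4 + (6 * (n * (n + 2)) + 5 * n + 16) \<le> ?d"
          by (simp add: dec_cost_def)
        from branch_bound[OF sum order_refl order_refl this] have "(2 * length ra + 1) * ?d + (2 * length rc + 1) * ?d +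
          (?ct + N * (2 * n + 3) + n + 4 + (6 * (n * (n + 2)) + 5 * n + 16)) \<le> (2 * length R + 1) * ?d" .
        then show "?ct + N * (2 * n + 3) + n + 4 + (6 * (n * (n + 2)) + 5 * n + 16 +
            (2 * length ra + 1) * ?d + (2 * length rc + 1) * ?d) \<le> (2 * length R + 1) * ?d"
          by (simp only: add_ac)
      qed
      moreover have "decomposes R ws U" if r: "?r = Some U" for U
      proof -
        obtain TA TC where T: "a = Some TA" "d = Some TC"
          using r by (cases a; cases d) auto
        have U: "U = foldr Forget ns (Join (foldr Introduce wc TA) (foldr Introduce wa TC))"
          using r T by simp
        show ?thesis
          unfolding U ns_def
        proof (rule decomposes_combine[OF Cons less.prems(1) _ M1 _ snd(3) nX wa_def wc_def sl_def])
          show "look t v \<in> {0, 1, M}" if "v \<in> set ?X" for v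
            using snd(1) that less.prems(2) by blast
        qed (use a(2)[OF T(1)] d(2)[OF T(2)] snd(4) in \<open>auto simp: ra_def rc_def\<close>)
      qed
      moreover have "?r \<noteq> None" if opt
        using a(3) d(3) that by (cases a; cases d) auto
      ultimately show ?thesis
        by (intro exI[of _ ?r]) blast
    qed
  qed
qed

end

section \<open>Adding the vertices one at a time and searching for the width\<close>

lemma Union_bags_good: "good T \<Longrightarrow> \<Union> (bags T) = root_bag T \<union> forg T"
  using root_bag_in_bags by (induction T) auto

lemma comp_cost_mono: "w \<le> w' \<Longrightarrow> 1 \<le> \<Delta> \<Longrightarrow> comp_cost N \<Delta> w \<le> comp_cost N \<Delta> w'"
  unfolding comp_cost_def node_cost_def
  by (intro add_mono mult_le_mono power_increasing) auto

lemma dec_cost_mono: "w \<le> w' \<Longrightarrow> B \<le> B' \<Longrightarrow> dec_cost N n w B \<le> dec_cost N n w' B'"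
  unfolding dec_cost_def
  by (intro add_mono mult_le_mono power_increasing comp_cost_mono) auto

definition iter_cost :: "nat \<Rightarrow> nat \<Rightarrow> nat \<Rightarrow> nat" where
  "iter_cost N n s = (2 * n + 1) * dec_cost N n (6 * s + 5) (3 * s + 2) + N + 2 * n + 10"

lemma iter_cost_mono: "s \<le> s' \<Longrightarrow> iter_cost N n s \<le> iter_cost N n s'"
  unfolding iter_cost_def by (intro add_mono mult_le_mono2 dec_cost_mono) auto

definition tree_for :: "edge_entry list \<Rightarrow> nat \<Rightarrow> nat \<Rightarrow> nat \<Rightarrow> ntd \<Rightarrow> bool" where
  "tree_for es n s i U \<longleftrightarrow> good U \<and> root_bag U = {} \<and> forg U = {..<i} \<and> (\<forall>X\<in>bags U. card X \<le> 6 * s + 4) \<and>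
     (\<forall>(u, v, a, b) \<in> set es. u < i \<longrightarrow> v < i \<longrightarrow> (\<exists>X\<in>bags U. u \<in> X \<and> v \<in> X)) \<and>
     nsize U \<le> (2 * n + 1) * (3 * n + 2)"

definition narrow :: "nat \<Rightarrow> edge_entry list \<Rightarrow> nat \<Rightarrow> bool" where
  "narrow n es s \<longleftrightarrow> (\<exists>U. good U \<and> forg U = {..<n} \<and> (\<forall>X\<in>bags U. card X \<le> s) \<and> covers U es)"

text \<open>Every old vertex lies in some bag and the new one in all of them, so the edges at the
  new vertex are covered; the bags grow by one.\<close>

lemma tree_for_step:
  assumes U: "tree_for es n s i U" and es: "edges_ok n es"
  defines "T \<equiv> Forget i (add_vertex i U)"
  shows "good T" "root_bag T = {}" "forg T = {..<Suc i}" "nsize T = nsize U + 1" "\<forall>X\<in>bags T. card X \<le> 6 * s + 5"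
    "\<And>u v a b. (u, v, a, b) \<in> set es \<Longrightarrow> u < Suc i \<Longrightarrow> v < Suc i \<Longrightarrow> \<exists>X\<in>bags T. u \<in> X \<and> v \<in> X"
proof -
  have U': "good U" "root_bag U = {}" "forg U = {..<i}" "\<forall>X\<in>bags U. card X \<le> 6 * s + 4"
    using U by (auto simp: tree_for_def)
  then have "i \<notin> root_bag U \<union> forg U"
    by simp
  note a = add_vertex[OF this U'(1)]
  show "good T" "root_bag T = {}" "forg T = {..<Suc i}" "nsize T = nsize U + 1"
    using a U' by (auto simp: T_def)
  have bags: "bags T = insert {} (insert i ` bags U)"
    using a U' by (simp add: T_def)
  show "\<forall>X\<in>bags T. card X \<le> 6 * s + 5"
  proof
    fix X assume "X \<in> bags T"
    then consider "X = {}" | Y where "Y \<in> bags U" "X = insert i Y"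
      using bags by auto
    then show "card X \<le> 6 * s + 5"
    proof cases
      case 2
      have "card (insert i Y) \<le> Suc (card Y)"
        by (cases "finite Y") (auto simp: card_insert_if)
      then show ?thesis
        using 2 U'(4) by fastforce
    qed simp
  qed
  fix u v a b assume e: "(u, v, a, b) \<in> set es" "u < Suc i" "v < Suc i"
  have bag: "\<exists>X\<in>bags U. x \<in> X" if "x < i" for x
    using Union_bags_good[OF U'(1)] U'(2,3) that by blast
  have "u \<noteq> v"
    using es e(1) by (auto simp: edges_ok_def)
  then consider "u < i" "v < i" | "u = i" "v < i" | "v = i" "u < i"
    using e(2,3) by linarith
  then have "\<exists>X\<in>bags U. u \<in> insert i X \<and> v \<in> insert i X"
  proof cases
    case 1
    then show ?thesis
      using U e(1) unfolding tree_for_def by blast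
  qed (use bag in auto)
  then show "\<exists>X\<in>bags T. u \<in> X \<and> v \<in> X"
    unfolding bags by blast
qed

context prog_td
begin

lemma ret_down: "i \<le> W \<Longrightarrow> ret F_down [Num i] (enc_list Num (rev [0..<i])) (i + 1)"
proof (induction i)
  case 0
  show ?case
    by (rule retI) (simp_all add: body_td body_down_def)
next
  case (Suc i)
  then show ?case
    by (intro retI, simp) (auto simp: body_td body_down_def intro!: callI[OF Suc.IH])
qed

lemma ret_dom0: "i \<le> W \<Longrightarrow> ret F_dom0 [Num i, Num M] (enc_assoc (enc_list Num) (label_domains i M)) (i + 1)"
proof (induction i)
  case 0
  show ?case
    by (rule retI) (simp_all add: body_td body_dom0_def label_domains_def)
next
  case (Suc i)
  have IH: "ret F_dom0 [Num i, Num M] (enc_assoc (enc_list Num) (label_domains i M)) (i + 1)"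
    using Suc by simp
  have e: "label_domains (Suc i) M = (i, [0, 1, M]) # label_domains i M"
    by (simp add: label_domains_def)
  show ?case
    using Suc.prems unfolding e by (intro retI, simp) (auto simp: body_td body_dom0_def intro!: callI[OF IH])
qed

context
  fixes n N :: nat and es :: "edge_entry list"
  assumes es: "edges_ok n es" "length es \<le> N"
    and N: "(2 * n + 1) * (3 * n + 2) + 1 \<le> N"
    and W: "2 * (n + 1) \<le> W" "n * (n + 1) \<le> W"
begin

lemma N_ge: "2 * n \<le> N"
  using N by (simp add: algebra_simps)

text \<open>A decomposition of the whole graph witnesses \<open>opt\<close> for every prefix, so a
  failure at any prefix shows that the graph is not \<open>narrow\<close>.\<close>

lemma ret_iter:
  assumes s: "6 * s + 5 \<le> N"
  shows "i \<le> n \<Longrightarrow> \<exists>r. ret F_iter [Num i, enc_list enc_edge es, Num (n + 1), Num (3 * s + 2)] (enc_opt r) ((i + 1) * iter_cost N n s) \<and>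
    (\<forall>U. r = Some U \<longrightarrow> tree_for es n s i U) \<and> (narrow n es s \<longrightarrow> r \<noteq> None)"
proof (induction i)
  case 0
  have "ret F_iter [Num 0, enc_list enc_edge es, Num (n + 1), Num (3 * s + 2)] (enc_opt (Some (Leaf []))) ((0 + 1) * iter_cost N n s)"
    by (intro retI, simp) (simp add: body_td body_iter_def iter_cost_def)
  then show ?case
    by (intro exI[of _ "Some (Leaf [])"]) (auto simp: tree_for_def)
next
  case (Suc i)
  then obtain r where r: "ret F_iter [Num i, enc_list enc_edge es, Num (n + 1), Num (3 * s + 2)] (enc_opt r) ((i + 1) * iter_cost N n s)"
    "\<And>U. r = Some U \<Longrightarrow> tree_for es n s i U" "narrow n es s \<Longrightarrow> r \<noteq> None"
    by auto
  have iter: "ret F_iter [Num (Suc i), enc_list enc_edge es, Num (n + 1), Num (3 * s + 2)] v ((i + 1) * iter_cost N n s + d + 1)"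
    if "ret F_iter2 [enc_opt r, Num i, Num (Suc i), enc_list enc_edge es, Num (n + 1), Num (3 * s + 2)] v d" for v d
    by (intro retI, simp) (use Suc.prems W(1) in \<open>auto simp: body_td body_iter_def
      intro!: callI[OF r(1)[simplified]] callI[OF that[simplified]]\<close>)
  show ?case
  proof (cases r)
    case None
    have "ret F_iter2 [enc_opt r, Num i, Num (Suc i), enc_list enc_edge es, Num (n + 1), Num (3 * s + 2)] (enc_opt None) 1"
      by (intro retI, simp) (simp add: body_td body_iter2_def None)
    from ret_mono[OF iter[OF this]] show ?thesis
      using r(3) None by (intro exI[of _ None]) (auto simp: iter_cost_def)
  next
    case (Some U)
    note U = r(2)[OF Some]
    define T where "T = Forget i (add_vertex i U)"
    note T = tree_for_step[OF U es(1), folded T_def]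
    have nU: "nsize U + 1 \<le> N"
      using U N by (auto simp: tree_for_def)
    interpret decomp_run P W S es T n "Suc i" N "n + 1" "3 * s + 2" s "6 * s + 5"
      by standard (use T Suc.prems nU s es N_ge W in auto)
    have "distinct (rev [0..<Suc i] @ [])" "set (rev [0..<Suc i] @ []) \<subseteq> {..<Suc i}" "length ([] :: nat list) \<le> 3 * s + 2"
      by auto
    from ret_decomp[OF this] obtain q where q: "ret F_decomp (enc_list Num (rev [0..<Suc i]) # enc_list Num [] # dec_args) (enc_opt q)
        ((2 * length (rev [0..<Suc i]) + 1) * dec_cost N n (6 * s + 5) (3 * s + 2))"
      "\<And>U. q = Some U \<Longrightarrow> decomposes (rev [0..<Suc i]) [] U" "opt \<Longrightarrow> q \<noteq> None"
      by blast
    have opt if "narrow n es s"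
      using that Suc.prems unfolding narrow_def opt_def by (metis lessThan_subset_iff)
    have si: "Suc i \<le> W"
      using Suc.prems W(1) by simp
    have "(2 * length (rev [0..<Suc i]) + 1) * dec_cost N n (6 * s + 5) (3 * s + 2) \<le> (2 * n + 1) * dec_cost N n (6 * s + 5) (3 * s + 2)"
      using Suc.prems by (intro mult_le_mono1) simp
    note q' = ret_mono[OF q(1) this]
    have down: "ret F_down [Num (Suc i)] (enc_list Num (rev [0..<Suc i])) (n + 2)"
      using ret_mono[OF ret_down[OF si]] Suc.prems by simp
    have dom: "ret F_dom0 [Num (Suc i), Num (n + 1)] (enc_assoc (enc_list Num) (label_domains (Suc i) (n + 1))) (n + 2)"
      using ret_mono[OF ret_dom0[OF si]] Suc.prems by simp
    have addv: "ret F_addv [enc_ntd U, Num i] (enc_ntd (add_vertex i U)) N"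
      using ret_mono[OF ret_addv] nU by simp
    have "ret F_iter2 [enc_opt r, Num i, Num (Suc i), enc_list enc_edge es, Num (n + 1), Num (3 * s + 2)] (enc_opt q)
      ((2 * n + 1) * dec_cost N n (6 * s + 5) (3 * s + 2) + N + 2 * n + 6)"
      by (intro retI, simp) (auto simp: body_td body_iter2_def Some
        intro!: callI[OF down, simplified] callI[OF dom, simplified] callI[OF addv]
          callI[OF q'[unfolded T_def enc_ntd.simps], simplified])
    from ret_mono[OF iter[OF this], of "(Suc i + 1) * iter_cost N n s"]
    have "ret F_iter [Num (Suc i), enc_list enc_edge es, Num (n + 1), Num (3 * s + 2)] (enc_opt q) ((Suc i + 1) * iter_cost N n s)"
      by (simp add: iter_cost_def)
    moreover have "tree_for es n s (Suc i) Z" if "q = Some Z" for Z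
    proof -
      have Z: "decomposes (rev [0..<Suc i]) [] Z"
        using q(2)[OF that] .
      have "(2 * length (rev [0..<Suc i]) + 1) * (3 * n + 2) \<le> (2 * n + 1) * (3 * n + 2)"
        using Suc.prems by (intro mult_le_mono1) simp
      then have "nsize Z \<le> (2 * n + 1) * (3 * n + 2)"
        using Z unfolding decomposes_def by linarith
      moreover have "\<forall>X\<in>bags Z. card X \<le> 6 * s + 4"
      proof -
        have "2 * (3 * s + 2) = 6 * s + 4"
          by simp
        then show ?thesis
          using Z unfolding decomposes_def by metis
      qed
      moreover have "set (rev [0..<Suc i]) = {..<Suc i}"
        by auto
      ultimately show ?thesis
        using Z unfolding decomposes_def tree_for_def append_Nil2 by simp
    qed
    moreover have "q \<noteq> None" if "narrow n es s"
      using q(3) \<open>narrow n es s \<Longrightarrow> opt\<close>[OF that] by blast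
    ultimately show ?thesis
      by blast
  qed
qed

text \<open>Success at some \<open>s\<close> below \<open>k\<close> is welcome, since the bag bound
  \<open>6 * s + 4\<close> is then even smaller; at \<open>s = k\<close> the search cannot fail. All
  rounds are charged the cost for \<open>k\<close>.\<close>

lemma ret_search:
  assumes k: "narrow n es k" "6 * k + 5 \<le> N" "3 * k + 3 \<le> W"
  shows "s \<le> k \<Longrightarrow> \<exists>U. ret F_search [Num s, Num n, enc_list enc_edge es] (enc_ntd U)
    ((k + 1 - s) * ((n + 1) * iter_cost N n k + 2)) \<and> tree_for es n k n U"
proof (induction "k - s" arbitrary: s)
  case 0
  then have s: "s = k"
    by simp
  obtain r where r: "ret F_iter [Num n, enc_list enc_edge es, Num (n + 1), Num (3 * k + 2)] (enc_opt r) ((n + 1) * iter_cost N n k)"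
    "\<forall>U. r = Some U \<longrightarrow> tree_for es n k n U" "narrow n es k \<longrightarrow> r \<noteq> None"
    using ret_iter[of k n] k(2) by auto
  then obtain U where U: "r = Some U"
    using k(1) by auto
  have s2: "ret F_search2 [enc_ntd U, Num k, Num n, enc_list enc_edge es] (enc_ntd U) 1"
    by (intro retI, simp) (simp add: body_td body_search2_def)
  have "ret F_search [Num k, Num n, enc_list enc_edge es] (enc_ntd U) ((n + 1) * iter_cost N n k + 2)"
    using k(3) W
    by (intro retI, simp) (auto simp: body_td body_search_def
      intro!: callI[OF r(1)[unfolded U enc_opt.simps, simplified]] callI[OF s2])
  then show ?case
    using r(2) U s by auto
next
  case (Suc m)
  then have s: "s < k"
    by simp
  obtain r where r: "ret F_iter [Num n, enc_list enc_edge es, Num (n + 1), Num (3 * s + 2)] (enc_opt r) ((n + 1) * iter_cost N n s)"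
    "\<forall>U. r = Some U \<longrightarrow> tree_for es n s n U"
    using ret_iter[of s n] k(2) s by auto
  have r': "ret F_iter [Num n, enc_list enc_edge es, Num (n + 1), Num (3 * s + 2)] (enc_opt r) ((n + 1) * iter_cost N n k)"
    by (rule ret_mono[OF r(1)]) (use s in \<open>intro mult_le_mono2 iter_cost_mono, simp\<close>)
  let ?c = "(n + 1) * iter_cost N n k"
  have step: "ret F_search [Num s, Num n, enc_list enc_edge es] v (?c + d + 1)"
    if "ret F_search2 [enc_opt r, Num s, Num n, enc_list enc_edge es] v d" for v d
    by (intro retI, simp) (use k(3) W s in \<open>auto simp: body_td body_search_def
      intro!: callI[OF r'[simplified]] callI[OF that]\<close>)
  have ks: "k + 1 - s = Suc (k + 1 - Suc s)"
    using s by simp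
  show ?case
  proof (cases r)
    case None
    obtain U where U: "ret F_search [Num (Suc s), Num n, enc_list enc_edge es] (enc_ntd U)
      ((k + 1 - Suc s) * (?c + 2))" "tree_for es n k n U"
      using Suc.hyps(1)[OF _ Suc_leI[OF s]] Suc.hyps(2) by (metis Suc_diff_Suc Suc_inject s)
    have "ret F_search2 [enc_opt r, Num s, Num n, enc_list enc_edge es] (enc_ntd U) ((k + 1 - Suc s) * (?c + 2) + 1)"
      using k(3) s by (intro retI, simp) (auto simp: body_td body_search2_def None intro!: callI[OF U(1)])
    from step[OF this] U(2) show ?thesis
      unfolding ks by (intro exI[of _ U]) (auto elim!: ret_mono)
  next
    case (Some U)
    have "ret F_search2 [enc_opt r, Num s, Num n, enc_list enc_edge es] (enc_ntd U) 1"
      by (intro retI, simp) (simp add: body_td body_search2_def Some)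
    from ret_mono[OF step[OF this], of "(k + 1 - s) * (?c + 2)"]
    have "ret F_search [Num s, Num n, enc_list enc_edge es] (enc_ntd U) ((k + 1 - s) * (?c + 2))"
      unfolding ks by simp
    moreover have "tree_for es n k n U"
      using r(2) Some s unfolding tree_for_def by fastforce
    ultimately show ?thesis
      by blast
  qed
qed

end

end

section \<open>Running times\<close>

lemma edge_list_edges_ok:
  assumes "dpvc_instance {..<n} E w" "edge_list E w es"
  shows "edges_ok n es"
  unfolding edges_ok_def
proof clarify
  fix u v a b assume e: "(u, v, a, b) \<in> set es"
  then have E: "{u, v} \<in> E" and ab: "a = w u v" "b = w v u"
    using assms(2) by (auto simp: edge_list_def)
  from E have "{v, u} \<in> E"
    by (simp add: insert_commute)
  moreover obtain u' v' where "u' < n" "v' < n" "u' \<noteq> v'" "{u, v} = {u', v'}"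
    using E assms(1) by (auto simp: dpvc_instance_def simple_graph_def)
  ultimately show "u < n \<and> v < n \<and> u \<noteq> v \<and> 0 < a \<and> 0 < b"
    using E ab assms(1) by (auto simp: dpvc_instance_def doubleton_eq_iff)
qed

lemma feas_iff:
  assumes "edge_list E w es"
  shows "feas n es p \<longleftrightarrow> dpvc_feasible {..<n} E w p"
proof -
  have "(\<forall>(u, v, a, b) \<in> set es. real a \<le> p u \<or> real b \<le> p v) \<longleftrightarrow>
    (\<forall>u v. {u, v} \<in> E \<longrightarrow> p u \<ge> real (w u v) \<or> p v \<ge> real (w v u))" (is "?l \<longleftrightarrow> ?r")
  proof
    assume ?l
    show ?r
    proof (intro allI impI)
      fix u v assume "{u, v} \<in> E"
      then obtain u' v' a b where e: "(u', v', a, b) \<in> set es" "{u, v} = {u', v'}"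
        using assms by (auto simp: edge_list_def image_iff)
      then have "a = w u' v'" "b = w v' u'"
        using assms by (auto simp: edge_list_def)
      moreover have "real a \<le> p u' \<or> real b \<le> p v'"
        using \<open>?l\<close> e(1) by blast
      moreover have "u = u' \<and> v = v' \<or> u = v' \<and> v = u'"
        using e(2) by (simp add: doubleton_eq_iff)
      ultimately show "p u \<ge> real (w u v) \<or> p v \<ge> real (w v u)"
        by auto
    qed
  next
    assume r: ?r
    show ?l
    proof clarify
      fix u v a b assume e: "(u, v, a, b) \<in> set es" "\<not> real b \<le> p v"
      then have "{u, v} \<in> E" "a = w u v" "b = w v u"
        using assms by (auto simp: edge_list_def)
      then show "real a \<le> p u"
        using r e(2) by auto
    qed
  qed
  then show ?thesis
    by (auto simp: feas_def dpvc_feasible_def)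
qed

lemma length_edge_list:
  assumes "edges_ok n es" "edge_list E w es"
  shows "length es \<le> n * n"
proof -
  have d: "distinct es" "inj_on (\<lambda>(u, v, a, b). {u, v}) (set es)"
    using assms(2) by (auto simp: edge_list_def distinct_map)
  have "inj_on (\<lambda>(u, v, a, b). (u, v)) (set es)"
  proof (rule inj_onI)
    fix x y assume xy: "x \<in> set es" "y \<in> set es" "(\<lambda>(u, v, a, b). (u, v)) x = (\<lambda>(u, v, a, b). (u, v)) y"
    then have "(\<lambda>(u, v, a, b). {u, v}) x = (\<lambda>(u, v, a, b). {u, v}) y"
      by (cases x; cases y) auto
    from inj_onD[OF d(2) this xy(1,2)] show "x = y" .
  qed
  then have "card (set es) = card ((\<lambda>(u, v, a, b). (u, v)) ` set es)"
    by (simp add: card_image)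
  also have "\<dots> \<le> card ({..<n} \<times> {..<n})"
    using assms(1) by (intro card_mono) (auto simp: edges_ok_def)
  finally show ?thesis
    using d(1) by (simp add: distinct_card)
qed

text \<open>The optimum is an infimum over real-valued solutions. Dividing by \<open>r\<close> turns
  the comparison with each solution into a lower bound for this infimum, so it need not be shown to
  be attained.\<close>

lemma approx_outputI:
  assumes inst: "dpvc_instance {..<n} E w" "edge_list E w es"
    and s: "feas n es (\<lambda>v. real (s v))" "\<And>p. feas n es p \<Longrightarrow> (\<Sum>v<n. real (s v)) \<le> r * (\<Sum>v<n. p v)"
    and r: "0 < r"
  shows "approx_output n E w r (enc_list Num (map s [0..<n]))"
proof -
  let ?p = "\<lambda>v. real (map s [0..<n] ! v)"
  have "feas n es ?p"
    unfolding feas_def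
  proof (intro conjI)
    show "\<forall>(u, v, a, b) \<in> set es. real a \<le> ?p u \<or> real b \<le> ?p v"
    proof clarify
      fix u v a b assume e: "(u, v, a, b) \<in> set es" "\<not> real b \<le> ?p v"
      then have "u < n" "v < n"
        using edge_list_edges_ok[OF inst] by (auto simp: edges_ok_def)
      moreover have "real a \<le> real (s u) \<or> real b \<le> real (s v)"
        using s(1) e(1) by (auto simp: feas_def)
      ultimately show "real a \<le> ?p u"
        using e(2) by simp
    qed
  qed simp
  then have feas: "dpvc_feasible {..<n} E w ?p"
    using feas_iff[OF inst(2)] by blast
  have sum: "(\<Sum>v<n. ?p v) = (\<Sum>v<n. real (s v))"
    by (intro sum.cong) auto
  have "(\<Sum>v<n. real (s v)) / r \<le> dpvc_opt {..<n} E w"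
    unfolding dpvc_opt_def
  proof (rule cInf_greatest)
    show "{\<Sum>v<n. p v | p. dpvc_feasible {..<n} E w p} \<noteq> {}"
      using feas by blast
    fix x assume "x \<in> {\<Sum>v<n. p v | p. dpvc_feasible {..<n} E w p}"
    then obtain p where "x = (\<Sum>v<n. p v)" "feas n es p"
      using feas_iff[OF inst(2)] by blast
    then show "(\<Sum>v<n. real (s v)) / r \<le> x"
      using s(2) r by (simp add: field_simps)
  qed
  then have "dpvc_approx {..<n} E w r ?p"
    using feas sum r by (simp add: dpvc_approx_def field_simps)
  then show ?thesis
    unfolding approx_output_def by (intro exI[of _ "map s [0..<n]"]) simp
qed

lemma max_num_enc_edges:
  "(u, v, a, b) \<in> set es \<Longrightarrow> a \<le> max_num (enc_list enc_edge es) \<and> b \<le> max_num (enc_list enc_edge es)"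
  by (induction es) auto

text \<open>The start of the chain is at most \<open>A\<close> and the cutoff is proportional to
  \<open>A\<close>, so \<open>A\<close> cancels and the length depends on n and \<epsilon>
  only.\<close>

lemma length_domain_geometric:
  assumes "0 < a" "0 < b" "length (domain es n a b v) = Suc (Suc k)" "1 \<le> n"
  shows "real k * ln (1 + real a / real b / 2) \<le> ln (4 * real n / (real a / real b))"
proof -
  define A where "A = fst (credits es)"
  define x where "x = max_weight es v 1 (A + 1)"
  define r where "r = real a / real b"
  have r: "0 < r"
    using assms by (simp add: r_def)
  have x: "x \<le> A"
    using max_weight_less[of "A + 1" es v 1] by (simp add: x_def)
  have len: "length (chain es v (4 * n * b) (a * A) (2 * b + a) (2 * b) x) = Suc (Suc k)"
    using assms(3) by (simp add: domain_def A_def x_def Let_def)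
  have "A \<noteq> 0"
  proof
    assume "A = 0"
    then have "length (chain es v (4 * n * b) (a * A) (2 * b + a) (2 * b) x) = 1"
      using x by (subst chain.simps) simp
    with len show False
      by simp
  qed
  have "a * A * (2 * b + a) ^ k \<le> 4 * n * b * x * (2 * b) ^ k"
    using assms by (intro chain_length_geometric[OF _ _ len]) auto
  also have "\<dots> \<le> 4 * n * b * A * (2 * b) ^ k"
    using x by (intro mult_le_mono) auto
  finally have "a * (2 * b + a) ^ k * A \<le> 4 * n * b * (2 * b) ^ k * A"
    by (simp add: mult_ac)
  then have "a * (2 * b + a) ^ k \<le> 4 * n * b * (2 * b) ^ k"
    using \<open>A \<noteq> 0\<close> by simp
  then have "real (a * (2 * b + a) ^ k) \<le> real (4 * n * b * (2 * b) ^ k)"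
    by (simp only: of_nat_le_iff)
  then have *: "real a * (real (2 * b + a)) ^ k \<le> 4 * real n * real b * (real (2 * b)) ^ k"
    by simp
  have "real (2 * b + a) = real (2 * b) * (1 + r / 2)"
    using assms by (simp add: r_def field_simps)
  then have "real a * (1 + r / 2) ^ k * real (2 * b) ^ k \<le> 4 * real n * real b * real (2 * b) ^ k"
    using * by (simp only: power_mult_distrib mult_ac)
  then have "real a * (1 + r / 2) ^ k \<le> 4 * real n * real b"
    using assms by (subst (asm) mult_le_cancel_right) auto
  then have "(1 + r / 2) ^ k \<le> 4 * real n / r"
    using assms by (simp add: r_def field_simps)
  moreover have "0 < (1 + r / 2) ^ k"
    using r by simp
  ultimately have "ln ((1 + r / 2) ^ k) \<le> ln (4 * real n / r)"
    by (subst ln_le_cancel_iff) auto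
  then show ?thesis
    using r by (simp add: r_def ln_realpow)
qed

lemma length_domain_le:
  assumes es: "edges_ok n es" "length es \<le> n * n" and ab: "0 < a" "a < b" and v: "v < n"
  shows "real (length (domain es n a b v)) \<le> 22 * max 1 (log 2 (real n) / (real a / real b))"
proof -
  define r where "r = real a / real b"
  define m where "m = max 1 (log 2 (real n) / r)"
  have r: "0 < r" "r < 1"
    using ab by (auto simp: r_def)
  have m: "1 \<le> m" "log 2 (real n) / r \<le> m"
    by (auto simp: m_def)
  show ?thesis
  proof (cases "length (domain es n a b v) \<le> 2")
    case True
    then show ?thesis
      using m unfolding m_def r_def by linarith
  next
    case False
    then obtain k where k: "length (domain es n a b v) = Suc (Suc k)"
      by (metis Suc_1 add_2_eq_Suc le_Suc_ex nat_le_linear)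
    have n2: "2 \<le> n"
    proof (rule ccontr)
      assume "\<not> 2 \<le> n"
      then have "es = []"
        using es(1) by (cases es) (auto simp: edges_ok_def)
      moreover have "length (domain es n a b v) \<le> length es + 2"
        unfolding domain_def Let_def by (rule chain_length_le)
      ultimately show False
        using False by simp
    qed
    have ln_log: "ln (real n) \<le> log 2 (real n)"
    proof -
      have "ln 2 \<le> (1 :: real)"
        using ln_2_less_1 by simp
      moreover have "0 \<le> ln (real n)"
        using n2 by simp
      ultimately have "ln (real n) * ln 2 \<le> ln (real n)"
        by (intro mult_right_le_one_le) auto
      then show ?thesis
        by (simp add: log_def field_simps)
    qed
    have log1: "1 \<le> log 2 (real n)"
      using n2 by (subst le_log_iff) auto
    show ?thesis
    \<comment> \<open>For \<epsilon> at least 1/n^2 the geometric bound applies: 4n/\<epsilon> is at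
      most n^5 and ln(1 + \<epsilon>/2) at least \<epsilon>/4, so k is at most 20 log n /
      \<epsilon>, and the two uncounted elements make 22. For smaller \<epsilon> the bound n^2 + 2
      suffices, since n^2 is below 1/\<epsilon>.\<close>
    proof (cases "1 / (real n)\<^sup>2 \<le> r")
      case True
      have "r / 4 \<le> ln (1 + r / 2)"
      proof -
        have "r / 2 - (r / 2)\<^sup>2 \<le> ln (1 + r / 2)"
          using r by (intro ln_one_plus_pos_lower_bound) auto
        moreover have "(r / 2)\<^sup>2 \<le> r / 4"
          using r by (simp add: power2_eq_square field_simps)
        ultimately show ?thesis
          by linarith
      qed
      then have "real k * (r / 4) \<le> real k * ln (1 + r / 2)"
        by (intro mult_left_mono) auto
      also have "\<dots> \<le> ln (4 * real n / r)"
        using length_domain_geometric[OF _ _ k] ab n2 by (simp add: r_def)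
      also have "\<dots> \<le> ln (real n ^ 5)"
      proof (subst ln_le_cancel_iff)
        have "4 \<le> (real n)\<^sup>2"
          using power_mono[of 2 "real n" 2] n2 by simp
        then have "4 * real n * (real n)\<^sup>2 \<le> (real n)\<^sup>2 * real n * (real n)\<^sup>2"
          by (intro mult_right_mono) auto
        moreover have "1 / r \<le> (real n)\<^sup>2"
          using True r n2 by (simp add: field_simps)
        then have "4 * real n * (1 / r) \<le> 4 * real n * (real n)\<^sup>2"
          by (intro mult_left_mono) auto
        ultimately show "4 * real n / r \<le> real n ^ 5"
          by (simp add: power2_eq_square eval_nat_numeral mult_ac)
      qed (use r n2 in auto)
      also have "\<dots> = 5 * ln (real n)"
        using n2 by (simp add: ln_realpow)
      also have "\<dots> \<le> 5 * log 2 (real n)"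
        using ln_log by simp
      finally have "real k * r \<le> 20 * log 2 (real n)"
        by simp
      then have "real k \<le> 20 * (log 2 (real n) / r)"
        using r by (simp add: field_simps)
      then show ?thesis
        using m k unfolding m_def r_def by (simp del: max_less_iff_conj)
    next
      case False
      have "length (domain es n a b v) \<le> length es + 2"
        unfolding domain_def Let_def by (rule chain_length_le)
      then have "real (length (domain es n a b v)) \<le> real (n * n) + 2"
        using es(2) by linarith
      also have "real (n * n) \<le> 1 / r"
        using False r n2 by (simp add: field_simps power2_eq_square)
      also have "1 / r \<le> log 2 (real n) / r"
        using log1 r by (simp add: divide_right_mono)
      finally show ?thesis
        using m unfolding m_def r_def by linarith
    qed
  qed
qed

text \<open>The constants are generous: lower powers of \<open>N\<close> are raised to the sixth,
  and terms without the exponential factor are multiplied by it, as it is at least 1.\<close>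

lemma solve_cost_le:
  assumes "1 \<le> \<Delta>" "\<Delta> \<le> N"
  shows "comp_cost N \<Delta> w \<le> \<Delta> ^ (w - 1) * (50 * N ^ 6)" "solve_cost N \<Delta> w \<le> \<Delta> ^ (w - 1) * (200 * N ^ 6)"
proof -
  define X where "X = \<Delta> ^ (w - 1)"
  have X: "1 \<le> X"
    using assms(1) by (simp add: X_def)
  have N: "1 \<le> N"
    using assms by simp
  have pow: "N ^ j \<le> N ^ k" if "j \<le> k" for j k
    using that N by (intro power_increasing) auto
  have up: "y \<le> X * y" for y
    using X by simp
  have p: "1 \<le> N" "N \<le> N ^ 2" "N ^ 2 \<le> N ^ 3" "N ^ 3 \<le> N ^ 4" "N ^ 4 \<le> N ^ 5" "N ^ 5 \<le> N ^ 6"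
    using N pow[of 1 2] pow[of 2 3] pow[of 3 4] pow[of 4 5] pow[of 5 6] by simp_all
  have s: "N * N ^ 2 = N ^ 3" "N * N ^ 3 = N ^ 4" "N * N ^ 4 = N ^ 5" "N * N ^ 5 = N ^ 6"
    by (simp_all flip: power_Suc)
  have "check_cost N = 4 * N ^ 2 + 6 * N + 1"
    by (simp add: check_cost_def algebra_simps power2_eq_square)
  with p have check: "check_cost N \<le> 11 * N ^ 2"
    by linarith
  have "ent_cost N \<Delta> \<le> N * (N + N + 3) + N + 3"
    unfolding ent_cost_def using assms by (intro add_mono mult_le_mono) auto
  also have "\<dots> = 2 * N ^ 2 + 4 * N + 3"
    by (simp add: algebra_simps power2_eq_square)
  also have "\<dots> \<le> 9 * N ^ 2"
    using p by linarith
  finally have ent: "ent_cost N \<Delta> \<le> 9 * N ^ 2" .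
  have "N * ent_cost N \<Delta> \<le> N * (9 * N ^ 2)"
    using ent by (rule mult_le_mono2)
  also have "\<dots> = 9 * N ^ 3"
    by (simp add: s[symmetric] mult_ac)
  finally have Nent: "N * ent_cost N \<Delta> \<le> 9 * N ^ 3" .
  then have cand: "cand_cost N \<Delta> \<le> 25 * N ^ 3"
    unfolding cand_cost_def using check p by linarith
  have "\<Delta> * cand_cost N \<Delta> \<le> N * (25 * N ^ 3)"
    using assms(2) cand by (rule mult_le_mono)
  also have "\<dots> = 25 * N ^ 4"
    by (simp add: s[symmetric] mult_ac)
  finally have leaf: "leaf_cost N \<Delta> \<le> 31 * N ^ 4"
    unfolding leaf_cost_def using p by linarith
  have "X * N * leaf_cost N \<Delta> \<le> X * N * (31 * N ^ 4)"
    using leaf by (rule mult_le_mono2)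
  also have "\<dots> = X * (31 * N ^ 5)"
    by (simp add: s[symmetric] mult_ac)
  finally have "node_cost N \<Delta> w \<le> N + 2 + N * (N + 2) + X * (31 * N ^ 5)"
    by (simp add: node_cost_def X_def)
  moreover have "N + 2 + N * (N + 2) = N ^ 2 + 3 * N + 2"
    by (simp add: algebra_simps power2_eq_square)
  with p have "N + 2 + N * (N + 2) \<le> 6 * N ^ 5"
    by linarith
  moreover note up[of "6 * N ^ 5"]
  ultimately have "node_cost N \<Delta> w \<le> X * (37 * N ^ 5)"
    by linarith
  then have "N * node_cost N \<Delta> w \<le> N * (X * (37 * N ^ 5))"
    by (rule mult_le_mono2)
  also have "\<dots> = X * (37 * N ^ 6)"
    by (simp add: s[symmetric] mult_ac)
  finally have node: "N * node_cost N \<Delta> w \<le> X * (37 * N ^ 6)" .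
  have "N * ent_cost N \<Delta> + 2 \<le> 11 * N ^ 6"
    using Nent p by linarith
  with node up[of "11 * N ^ 6"] have comp: "comp_cost N \<Delta> w \<le> X * (50 * N ^ 6)"
    unfolding comp_cost_def by linarith
  then show "comp_cost N \<Delta> w \<le> \<Delta> ^ (w - 1) * (50 * N ^ 6)"
    by (simp add: X_def)
  have d: "N * (3 * N + \<Delta> * (3 * N + 2) + 4) \<le> N * (3 * N + N * (3 * N + 2) + 4)"
    using assms(2) by (intro mult_le_mono2 add_mono mult_le_mono1) auto
  have "N * (4 * N + 8) + N * (N + 2) + N + N * (3 * N + N * (3 * N + 2) + 4) + N * (2 * N + 2) + 10 =
    3 * N ^ 3 + 12 * N ^ 2 + 17 * N + 10"
    by (simp add: algebra_simps power2_eq_square power3_eq_cube)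
  with p have "N * (4 * N + 8) + N * (N + 2) + N + N * (3 * N + N * (3 * N + 2) + 4) + N * (2 * N + 2) + 10 \<le> 100 * N ^ 6"
    by linarith
  with d comp up[of "100 * N ^ 6"] show "solve_cost N \<Delta> w \<le> \<Delta> ^ (w - 1) * (200 * N ^ 6)"
    unfolding solve_cost_def X_def[symmetric] by linarith
qed

text \<open>The exponent 9k + 7 is the sum of 3k + 3, from the labellings of an interface of B + 1
  vertices, and 6k + 4, from the dynamic program with three labels on bags of size 6k + 5.\<close>

lemma search_cost_le:
  assumes N: "3 \<le> N" "n \<le> N"
  shows "(k + 1) * ((n + 1) * iter_cost N n k + 2) \<le> (k + 1) * 3 ^ (9 * k + 7) * 1500 * N ^ 8"
proof -
  have pow: "N ^ i \<le> N ^ j" if "i \<le> j" for i j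
    using that N by (intro power_increasing) auto
  have p: "1 \<le> N" "N \<le> N ^ 2" "N ^ 2 \<le> N ^ 6" "N \<le> N ^ 7" "N \<le> N ^ 8"
    using N pow[of 1 2] pow[of 2 6] pow[of 1 7] pow[of 1 8] by simp_all
  have s: "N * N ^ 6 = N ^ 7" "N * N ^ 7 = N ^ 8"
    by (simp_all flip: power_Suc)
  define Y where "Y = (3 :: nat) ^ (9 * k + 7)"
  have Y: "Y = 3 ^ (3 * k + 3) * 3 ^ (6 * k + 4)" "1 \<le> Y"
    by (simp_all add: Y_def flip: power_add)
  have up: "y \<le> Y * y" "y \<le> 3 ^ (6 * k + 4) * y" for y
    using Y(2) by simp_all
  have "test_cost n \<le> 3 * N * (N + 2) + 6 * N + 10"
    unfolding test_cost_def using N(2) by (intro add_mono mult_le_mono) auto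
  also have "\<dots> = 3 * N ^ 2 + 12 * N + 10"
    by (simp add: algebra_simps power2_eq_square)
  finally have "test_cost n + 3 \<le> 28 * N ^ 6"
    using p by linarith
  moreover have "comp_cost N 3 (6 * k + 5) \<le> 3 ^ (6 * k + 4) * (50 * N ^ 6)"
    using solve_cost_le(1)[of 3 N "6 * k + 5"] N(1) by (simp add: add.commute[of _ 4])
  moreover note up(2)[of "28 * N ^ 6"]
  ultimately have "comp_cost N 3 (6 * k + 5) + test_cost n + 3 \<le> 3 ^ (6 * k + 4) * (78 * N ^ 6)"
    by linarith
  then have "3 ^ (3 * k + 3) * (comp_cost N 3 (6 * k + 5) + test_cost n + 3) \<le> 3 ^ (3 * k + 3) * (3 ^ (6 * k + 4) * (78 * N ^ 6))"
    by (rule mult_le_mono2)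
  also have "\<dots> = Y * (78 * N ^ 6)"
    by (simp add: Y(1))
  finally have 1: "3 ^ (3 * k + 3) * (comp_cost N 3 (6 * k + 5) + test_cost n + 3) \<le> Y * (78 * N ^ 6)" .
  have B: "3 * k + 2 + 1 = 3 * k + 3"
    by simp
  have "N * (2 * n + 3) + 6 * (n * (n + 2)) + 10 * n + 40 \<le> N * (2 * N + 3) + 6 * (N * (N + 2)) + 10 * N + 40"
    using N(2) by (intro add_mono mult_le_mono) auto
  also have "\<dots> = 8 * N ^ 2 + 25 * N + 40"
    by (simp add: algebra_simps power2_eq_square)
  finally have "N * (2 * n + 3) + 6 * (n * (n + 2)) + 10 * n + 40 \<le> 73 * N ^ 6"
    using p by linarith
  with 1 up(1)[of "73 * N ^ 6"] have dec: "dec_cost N n (6 * k + 5) (3 * k + 2) \<le> Y * (151 * N ^ 6)"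
    unfolding dec_cost_def B by linarith
  have "(2 * n + 1) * dec_cost N n (6 * k + 5) (3 * k + 2) \<le> (3 * N) * (Y * (151 * N ^ 6))"
    using N dec by (intro mult_le_mono) auto
  also have "\<dots> = Y * (453 * N ^ 7)"
    by (simp add: s[symmetric] mult_ac)
  finally have "iter_cost N n k \<le> Y * (500 * N ^ 7)"
    using N(2) p up(1)[of "13 * N ^ 7"] unfolding iter_cost_def by linarith
  then have "(n + 1) * iter_cost N n k \<le> (2 * N) * (Y * (500 * N ^ 7))"
    using N by (intro mult_le_mono) auto
  also have "\<dots> = Y * (1000 * N ^ 8)"
    by (simp add: s[symmetric] mult_ac)
  finally have "(n + 1) * iter_cost N n k + 2 \<le> Y * (1500 * N ^ 8)"
    using p up(1)[of "2 * N ^ 8"] by linarith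
  then have "(k + 1) * ((n + 1) * iter_cost N n k + 2) \<le> (k + 1) * (Y * (1500 * N ^ 8))"
    by (rule mult_le_mono2)
  then show ?thesis
    by (simp only: Y_def mult.assoc)
qed

text \<open>Taking the actual maximum of the lengths makes one number satisfy both the logarithmic
  bound and the bound by n^2 + 2. The value 1 is used if no domains are computed.\<close>

lemma ex_domain_bound:
  assumes es: "edges_ok n es" "length es \<le> n * n" and ab: "0 < a" "0 < b"
  shows "\<exists>\<Delta>. 1 \<le> \<Delta> \<and> \<Delta> \<le> n * n + 2 \<and> (\<forall>v<n. a < b \<longrightarrow> length (domain es n a b v) \<le> \<Delta>) \<and>
    real \<Delta> \<le> 22 * max 1 (log 2 (real n) / (real a / real b))"
proof (cases "a < b \<and> 0 < n")
  case False
  then show ?thesis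
    by (intro exI[of _ 1]) auto
next
  case True
  define \<Delta> where "\<Delta> = Max ((\<lambda>v. length (domain es n a b v)) ` {..<n})"
  have "\<Delta> \<in> (\<lambda>v. length (domain es n a b v)) ` {..<n}"
    unfolding \<Delta>_def using True by (intro Max_in) auto
  then have in_\<Delta>: "\<exists>v<n. \<Delta> = length (domain es n a b v)"
    by auto
  have len: "1 \<le> length (domain es n a b v) \<and> length (domain es n a b v) \<le> n * n + 2" for v
  proof -
    have "length (domain es n a b v) \<le> length es + 2"
      unfolding domain_def Let_def by (rule chain_length_le)
    moreover have "domain es n a b v \<noteq> []"
      unfolding domain_def Let_def by (subst chain.simps) simp
    ultimately show ?thesis
      using es(2) by (cases "domain es n a b v") auto
  qed
  have "\<forall>v<n. length (domain es n a b v) \<le> \<Delta>"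
    unfolding \<Delta>_def by (auto intro: Max_ge)
  then show ?thesis
    using in_\<Delta> len length_domain_le[OF es ab(1)] True by metis
qed

section \<open>Powers of the logarithm\<close>

lemma power_le_fact_exp:
  fixes y :: real
  assumes "0 \<le> y"
  shows "y ^ j \<le> fact j * exp y"
proof -
  have "(\<Sum>i\<in>{j}. y ^ i /\<^sub>R fact i) \<le> exp y"
    unfolding exp_def using assms by (intro sum_le_suminf summable_exp_generic) auto
  then show ?thesis
    by (simp add: field_simps)
qed

text \<open>With y = 1 + ln(n + 1), log n to the base 2 is at most 2y because ln 2 \<ge> 1/2, and
  y^j \<le> j! exp y with exp y \<le> 3(n + 1).\<close>

lemma log_power_le: "(max 1 (log 2 (real n))) ^ j \<le> 2 ^ j * (fact j * 3 * real (n + 1))"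
proof -
  define y where "y = 1 + ln (real (n + 1))"
  have y: "1 \<le> y"
    by (simp add: y_def)
  have "log 2 (real n) \<le> 2 * y"
  proof (cases "n = 0")
    case False
    have "1 \<le> ln (4 :: real)"
      using exp_le by (subst ln_ge_iff) auto
    then have ln2: "1 / 2 \<le> ln (2 :: real)"
      using ln_realpow[of 2 2] by simp
    have "log 2 (real n) = ln (real n) / ln 2"
      by (simp add: log_def)
    also have "\<dots> \<le> ln (real n) / (1 / 2)"
      using ln2 False by (intro divide_left_mono) auto
    also have "\<dots> \<le> 2 * y"
    proof -
      have "ln (real n) \<le> ln (real (n + 1))"
        using False by simp
      then have "ln (real n) \<le> y"
        unfolding y_def by (rule order.trans) simp
      then show ?thesis
        by simp
    qed
    finally show ?thesis .
  qed (use y in \<open>simp add: log_def\<close>)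
  then have "(max 1 (log 2 (real n))) ^ j \<le> (2 * y) ^ j"
    using y by (intro power_mono) auto
  also have "\<dots> = 2 ^ j * y ^ j"
    by (rule power_mult_distrib)
  also have "y ^ j \<le> fact j * exp y"
    using y by (intro power_le_fact_exp) auto
  also have "exp y = exp 1 * real (n + 1)"
    by (simp add: y_def exp_add)
  also have "exp 1 * real (n + 1) \<le> 3 * real (n + 1)"
    using exp_le by (intro mult_right_mono) auto
  finally show ?thesis
    by (simp add: mult_ac)
qed

lemma domain_bound_power:
  assumes "real \<Delta> \<le> 22 * max 1 (log 2 (real n) / \<epsilon>)" "0 < \<epsilon>"
  shows "real \<Delta> ^ j \<le> (44 * max 1 (1 / \<epsilon>)) ^ j * (fact j * 3 * real (n + 1))"
proof -
  define e where "e = max 1 (1 / \<epsilon>)"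
  define l where "l = max 1 (log 2 (real n))"
  have el: "1 \<le> e" "1 \<le> l" "1 / \<epsilon> \<le> e" "log 2 (real n) \<le> l"
    by (auto simp: e_def l_def)
  have "log 2 (real n) / \<epsilon> \<le> l * e"
  proof -
    have "log 2 (real n) * (1 / \<epsilon>) \<le> l * (1 / \<epsilon>)"
      using el assms(2) by (intro mult_right_mono) auto
    also have "\<dots> \<le> l * e"
      using el by (intro mult_left_mono) auto
    finally show ?thesis
      by simp
  qed
  moreover have "1 \<le> l * e"
    using el mult_mono[of 1 l 1 e] by simp
  ultimately have "real \<Delta> \<le> 22 * (l * e)"
    using assms(1) by linarith
  then have "real \<Delta> ^ j \<le> (22 * (l * e)) ^ j"
    by (intro power_mono) auto
  also have "\<dots> = (22 * e) ^ j * l ^ j"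
    by (simp add: power_mult_distrib)
  also have "\<dots> \<le> (22 * e) ^ j * (2 ^ j * (fact j * 3 * real (n + 1)))"
    using log_power_le[of n j] el by (intro mult_left_mono) (auto simp: l_def)
  also have "\<dots> = (44 * e) ^ j * (fact j * 3 * real (n + 1))"
  proof -
    have "22 * e * 2 = 44 * e"
      by simp
    then have "(22 * e) ^ j * 2 ^ j = (44 * e) ^ j"
      using power_mult_distrib[of "22 * e" 2 j] by metis
    then show ?thesis
      by (simp only: mult.assoc[symmetric])
  qed
  finally show ?thesis
    by (simp add: e_def)
qed

section \<open>The program\<close>

text \<open>One program serves both claims. The tested component is a tree, hence a cell, if a
  decomposition is supplied; otherwise it is the numerator of \<epsilon>, hence a number.\<close>

definition "body_main = Cond (IsCell (First (Second (Var 0))))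
  (Call F_solve [First (First (Var 0)), Second (First (Var 0)), First (Second (Var 0)),
    First (Second (Second (Var 0))), Second (Second (Second (Var 0)))])
  (Call F_solve [First (First (Var 0)), Second (First (Var 0)),
    Call F_search [Const 0, First (First (Var 0)), Second (First (Var 0))],
    First (Second (Var 0)), Second (Second (Var 0))])"

text \<open>The body with index 1 is never called: the simplifier would rewrite this index to \<open>Suc 0\<close>.\<close>

definition dpvc_prog :: prog where
  "dpvc_prog = [body_main, Const 0, body_look, body_mem, body_append, body_check, body_ok, body_walk,
    body_ent, body_join, body_best, body_cand, body_add, body_min, body_tab, body_rows, body_remove,
    body_bag, body_comp, body_dp_root, body_forgets, body_introduces, body_cred, body_step, body_min2,
    body_out, body_maxw, body_wt, body_pick, body_chain, body_doms, body_solve, body_solve2, body_filt,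
    body_cuts, body_addv, body_len, body_test, body_fits, body_or, body_tryl, body_down, body_dom0,
    body_decomp, body_dec1, body_dec2, body_dec3, body_iter, body_iter2, body_search, body_search2]"

definition body_size :: nat where
  "body_size = Suc (sum_list (map esize dpvc_prog))"

lemma dpvc_prog_nth:
  "dpvc_prog ! 0 = body_main" "dpvc_prog ! 2 = body_look" "dpvc_prog ! 3 = body_mem"
  "dpvc_prog ! 4 = body_append" "dpvc_prog ! 5 = body_check" "dpvc_prog ! 6 = body_ok"
  "dpvc_prog ! 7 = body_walk" "dpvc_prog ! 8 = body_ent" "dpvc_prog ! 9 = body_join"
  "dpvc_prog ! 10 = body_best" "dpvc_prog ! 11 = body_cand" "dpvc_prog ! 12 = body_add"
  "dpvc_prog ! 13 = body_min" "dpvc_prog ! 14 = body_tab" "dpvc_prog ! 15 = body_rows"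
  "dpvc_prog ! 16 = body_remove" "dpvc_prog ! 17 = body_bag" "dpvc_prog ! 18 = body_comp"
  "dpvc_prog ! 19 = body_dp_root" "dpvc_prog ! 20 = body_forgets" "dpvc_prog ! 21 = body_introduces"
  "dpvc_prog ! 22 = body_cred" "dpvc_prog ! 23 = body_step" "dpvc_prog ! 24 = body_min2"
  "dpvc_prog ! 25 = body_out" "dpvc_prog ! 26 = body_maxw" "dpvc_prog ! 27 = body_wt"
  "dpvc_prog ! 28 = body_pick" "dpvc_prog ! 29 = body_chain" "dpvc_prog ! 30 = body_doms"
  "dpvc_prog ! 31 = body_solve" "dpvc_prog ! 32 = body_solve2" "dpvc_prog ! 33 = body_filt"
  "dpvc_prog ! 34 = body_cuts" "dpvc_prog ! 35 = body_addv" "dpvc_prog ! 36 = body_len"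
  "dpvc_prog ! 37 = body_test" "dpvc_prog ! 38 = body_fits" "dpvc_prog ! 39 = body_or"
  "dpvc_prog ! 40 = body_tryl" "dpvc_prog ! 41 = body_down" "dpvc_prog ! 42 = body_dom0"
  "dpvc_prog ! 43 = body_decomp" "dpvc_prog ! 44 = body_dec1" "dpvc_prog ! 45 = body_dec2"
  "dpvc_prog ! 46 = body_dec3" "dpvc_prog ! 47 = body_iter" "dpvc_prog ! 48 = body_iter2"
  "dpvc_prog ! 49 = body_search" "dpvc_prog ! 50 = body_search2"
  by (simp_all add: dpvc_prog_def)

lemma length_dpvc_prog: "length dpvc_prog = 51"
  by (simp add: dpvc_prog_def)

lemma prog_td_dpvc_prog:
  assumes "4 \<le> W"
  shows "prog_td dpvc_prog W body_size"
proof -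
  have "esize (dpvc_prog ! f) < body_size" if "f < length dpvc_prog" for f
    using that member_le_sum_list[of "esize (dpvc_prog ! f)" "map esize dpvc_prog"] by (simp add: body_size_def)
  with assms show ?thesis
    by unfold_locales (simp_all add: dpvc_prog_nth length_dpvc_prog)
qed

section \<open>Word length and total running times\<close>

lemma (in prog_td) ret_main1:
  assumes "P ! 0 = body_main" "ret F_solve [Num n, enc_list enc_edge es, enc_ntd T, Num a, Num b] y c"
  shows "ret 0 [Cell (enc_instance n es) (Cell (enc_ntd T) (enc_ratio a b))] y (c + 1)"
proof -
  have "0 < length P"
    using length_td by linarith
  then show ?thesis
  by (rule retI) (auto simp: assms(1) body_main_def enc_instance_def enc_ratio_def intro!: callI[OF assms(2)])
qed

lemma (in prog_td) ret_main2:
  assumes "P ! 0 = body_main" "ret F_search [Num 0, Num n, enc_list enc_edge es] (enc_ntd T) d"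
    "ret F_solve [Num n, enc_list enc_edge es, enc_ntd T, Num a, Num b] y c"
  shows "ret 0 [Cell (enc_instance n es) (enc_ratio a b)] y (d + c + 1)"
proof -
  have "0 < length P"
    using length_td by linarith
  then show ?thesis
  by (rule retI) (auto simp: assms(1) body_main_def enc_instance_def enc_ratio_def
    intro!: callI[OF assms(2)] callI[OF assms(3)])
qed

lemma computes_withinI:
  assumes "machine dpvc_prog ((2 + max_num x) ^ k) body_size"
    and "machine.ret dpvc_prog ((2 + max_num x) ^ k) body_size 0 [x] y c" "real (body_size * (c + 1)) \<le> T"
  shows "computes_within dpvc_prog k x y T"
proof -
  let ?W = "(2 + max_num x) ^ k"
  interpret machine dpvc_prog ?W body_size
    by fact
  obtain t where t: "0 < length dpvc_prog" "eval dpvc_prog ?W [x] (dpvc_prog ! 0) y t" "t < body_size * c"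
    using assms(2) unfolding ret_def by blast
  have "evals dpvc_prog ?W [x] [Var 0] [x] (1 + 0)"
    using eval_evals.Var[of 0 "[x]"] by (intro eval_evals.Cons eval_evals.Nil) simp
  then have "eval dpvc_prog ?W [x] (Call 0 [Var 0]) y (1 + 0 + t + 1)"
    using t by (intro eval_evals.Call) auto
  moreover have "1 + 0 + t + 1 \<le> body_size * (c + 1)"
    using t(3) by (simp add: body_size_def)
  then have "real (1 + 0 + t + 1) \<le> T"
    using assms(3) by (meson of_nat_le_iff order.trans)
  ultimately show ?thesis
    unfolding computes_within_def by blast
qed

text \<open>Here \<open>m\<close> is the largest input number plus 2, so that
  \<open>4 \<le> m ^ 2\<close> absorbs the numerical factors. The largest product, 4nbM, is at most
  \<open>m ^ 5\<close>.\<close>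

lemma word_bounds:
  fixes n M a b k m :: nat
  assumes m: "n + 2 \<le> m" "M + 2 \<le> m" "a + 2 \<le> m" "b + 2 \<le> m" "k \<le> n + 1"
  shows "4 \<le> m ^ 7" "n \<le> m ^ 7" "n * M + 1 \<le> m ^ 7" "4 * n * b \<le> m ^ 7" "4 * n * b * M \<le> m ^ 7"
    "a * (n * M) \<le> m ^ 7" "M * (2 * b + a) \<le> m ^ 7" "2 * b + a \<le> m ^ 7" "2 * M \<le> m ^ 7"
    "2 * (n + 1) \<le> m ^ 7" "n * (n + 1) \<le> m ^ 7" "3 * k + 3 \<le> m ^ 7"
proof -
  have pow: "m ^ i \<le> m ^ 7" if "i \<le> 7" for i
    using that m by (intro power_increasing) auto
  have 4: "4 \<le> m ^ 2"
    using power_mono[of 2 m 2] m by simp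
  have le: "n \<le> m" "M \<le> m" "a \<le> m" "b \<le> m" "n + 1 \<le> m" "M + 1 \<le> m" "2 \<le> m"
    using m by auto
  have m3: "4 * m \<le> m ^ 3"
    using mult_le_mono1[OF 4, of m] by (simp add: power2_eq_square power3_eq_cube)
  have e: "m ^ 2 * m * m = m ^ 4" "m ^ 2 * m * m * m = m ^ 5" "m * (m * m) = m ^ 3" "m * m ^ 3 = m ^ 4" "m ^ 4 * m = m ^ 5"
    by (simp_all add: eval_nat_numeral mult_ac)
  show "4 \<le> m ^ 7"
    using 4 pow[of 2] by linarith
  show "n \<le> m ^ 7"
    using le(1) pow[of 1] by simp
  have "n * M + 1 \<le> (n + 1) * (M + 1)"
    by simp
  also have "\<dots> \<le> m * m"
    using le by (intro mult_le_mono) auto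
  finally show "n * M + 1 \<le> m ^ 7"
    using pow[of 2] by (simp add: power2_eq_square)
  have "4 * n * b \<le> m ^ 2 * m * m" "4 * n * b * M \<le> m ^ 2 * m * m * m"
    using 4 le by (auto intro!: mult_le_mono)
  then show "4 * n * b \<le> m ^ 7" "4 * n * b * M \<le> m ^ 7"
    unfolding e using pow[of 4] pow[of 5] by simp_all
  have "a * (n * M) \<le> m * (m * m)"
    using le by (intro mult_le_mono) auto
  then show "a * (n * M) \<le> m ^ 7"
    unfolding e using pow[of 3] by simp
  have ba: "2 * b + a \<le> m ^ 3"
    using le m3 by linarith
  then show "2 * b + a \<le> m ^ 7"
    using pow[of 3] by linarith
  have "M * (2 * b + a) \<le> m * m ^ 3"
    using le ba by (intro mult_le_mono) auto
  then show "M * (2 * b + a) \<le> m ^ 7"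
    unfolding e using pow[of 4] by linarith
  have "2 * M \<le> m * m" "2 * (n + 1) \<le> m * m" "n * (n + 1) \<le> m * m"
    by (intro mult_le_mono le)+
  then show "2 * M \<le> m ^ 7" "2 * (n + 1) \<le> m ^ 7" "n * (n + 1) \<le> m ^ 7"
    using pow[of 2] by (simp_all add: power2_eq_square)
  have "3 * k + 3 \<le> 4 * m"
    using m by linarith
  then show "3 * k + 3 \<le> m ^ 7"
    using m3 pow[of 3] by linarith
qed

lemma treewidth_le:
  assumes "simple_graph {..<n} E"
  shows "treewidth {..<n} E \<le> n"
proof -
  have "td_width {0} (\<lambda>_::nat. {..<n}) = n - 1"
    by (simp add: td_width_def)
  then have "treewidth {..<n} E \<le> n - 1"
    unfolding treewidth_def using trivial_tree_decomposition[OF assms] by (intro Least_le) blast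
  then show ?thesis
    by simp
qed

lemma ntd_width_le:
  assumes "nice_tree_decomposition {..<n} E T"
  shows "ntd_width T \<le> n"
proof -
  have "card X \<le> n" if "X \<in> bags T" for X
    using card_mono[of "{..<n}" X] bags_subset[OF _ that] nice_tree_decompositionD(1,2)[OF assms] by auto
  then have "Max ((\<lambda>i. card (ntd_bag T i)) ` ntd_nodes T) \<le> n"
    using Nil_in_nodes[of T] by (subst Max_le_iff) (auto simp: bags_eq simp del: Nil_in_nodes)
  then show ?thesis
    by (simp add: ntd_width_def td_width_def)
qed

lemma covers_bags:
  assumes "edge_list E w es" "\<forall>e\<in>E. \<exists>X\<in>bags T. e \<subseteq> X"
  shows "covers T es"
  unfolding covers_def
proof clarify
  fix u v a b assume "(u, v, a, b) \<in> set es"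
  then have "{u, v} \<in> E"
    using assms(1) by (auto simp: edge_list_def)
  from bspec[OF assms(2) this] show "\<exists>X\<in>bags T. u \<in> X \<and> v \<in> X"
    by auto
qed

lemma max_num_enc_instance:
  "n \<le> max_num (enc_instance n es)"
  "(u, v, a, b) \<in> set es \<Longrightarrow> a \<le> max_num (enc_instance n es) \<and> b \<le> max_num (enc_instance n es)"
  using max_num_enc_edges[of u v a b es] by (auto simp: enc_instance_def)

lemma approximation_given_decomposition:
  assumes inst: "dpvc_instance {..<n} E w" "edge_list E w es" and T: "nice_tree_decomposition {..<n} E T"
    and ab: "0 < a" "0 < b" and \<epsilon>: "\<epsilon> = real a / real b"
  shows "\<exists>y. computes_within dpvc_prog 7 (Cell (enc_instance n es) (Cell (enc_ntd T) (enc_ratio a b))) y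
      ((22 * max 1 (log 2 (real n) / \<epsilon>)) ^ ntd_width T *
       (real (body_size * 202 * 8 ^ 6) * real (n + card (ntd_nodes T)) ^ 12)) \<and>
    approx_output n E w (1 + \<epsilon>) y"
proof -
  let ?x = "Cell (enc_instance n es) (Cell (enc_ntd T) (enc_ratio a b))"
  let ?m = "2 + max_num ?x" and ?t = "ntd_width T"
  define q where "q = n + card (ntd_nodes T)"
  \<comment> \<open>A single bound for the tree size and for quantities quadratic in n, such as the
    number of edges and the domain sizes.\<close>
  define N where "N = 2 * (q + 1) ^ 2"
  note es = edge_list_edges_ok[OF inst]
  note len = length_edge_list[OF es inst(2)]
  note good = nice_tree_decompositionD[OF T]
  have t: "?t \<le> n"
    using ntd_width_le[OF T] .
  have q: "nsize T + n = q" "1 \<le> q" "n + 1 \<le> q"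
    using nsize_pos(1)[of T] unfolding q_def card_ntd_nodes by linarith+
  have nn: "n * n + 2 \<le> N" "q \<le> N" "?t + 1 \<le> N"
  proof -
    have N: "N = 2 * (q * q) + 4 * q + 2"
      by (simp add: N_def power2_eq_square algebra_simps)
    have "n * n \<le> q * q"
      using q(3) by (intro mult_le_mono) auto
    then show "n * n + 2 \<le> N" "q \<le> N" "?t + 1 \<le> N"
      using N q t by linarith+
  qed
  obtain \<Delta> where \<Delta>: "1 \<le> \<Delta>" "\<Delta> \<le> n * n + 2" "\<forall>v<n. a < b \<longrightarrow> length (domain es n a b v) \<le> \<Delta>"
    "real \<Delta> \<le> 22 * max 1 (log 2 (real n) / (real a / real b))"
    using ex_domain_bound[OF es len ab] by blast
  have \<Delta>N: "\<Delta> \<le> N"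
    using \<Delta>(2) nn(1) by linarith
  define M where "M = max_num ?x"
  have le: "n + 2 \<le> ?m" "M + 2 \<le> ?m" "a + 2 \<le> ?m" "b + 2 \<le> ?m"
    using max_num_enc_instance(1)[of n es] by (auto simp: M_def enc_ratio_def)
  have le0: "0 \<le> n + 1"
    by simp
  have wt: "x \<le> M \<and> y \<le> M" if "(u, v, x, y) \<in> set es" for u v x y
    using max_num_enc_instance(2)[OF that, of n] by (auto simp: M_def)
  note W = word_bounds[OF le le0]
  interpret prog_td dpvc_prog "?m ^ 7" body_size
    using W(1) by (rule prog_td_dpvc_prog)
  have "\<exists>s. ret F_solve [Num n, enc_list enc_edge es, enc_ntd T, Num a, Num b]
      (enc_list Num (map s [0..<n])) (solve_cost N \<Delta> (?t + 1)) \<and> feas n es (\<lambda>v. real (s v)) \<and>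
    (\<forall>p. feas n es p \<longrightarrow> (\<Sum>v<n. real (s v)) \<le> (1 + real a / real b) * (\<Sum>v<n. p v))"
    by (rule ret_solve[OF es _ good(1,2) covers_bags[OF inst(2) good(3)] good(4) nn(3) _ _ ab \<Delta>(1) _ W(2-9)])
      (use wt \<Delta>(3) len nn(1,2) q(1) in \<open>blast | linarith\<close>)+
  then obtain s where s: "ret F_solve [Num n, enc_list enc_edge es, enc_ntd T, Num a, Num b]
      (enc_list Num (map s [0..<n])) (solve_cost N \<Delta> (?t + 1))"
    "feas n es (\<lambda>v. real (s v))"
    "\<And>p. feas n es p \<Longrightarrow> (\<Sum>v<n. real (s v)) \<le> (1 + real a / real b) * (\<Sum>v<n. p v)"
    by blast
  have main: "ret 0 [?x] (enc_list Num (map s [0..<n])) (solve_cost N \<Delta> (?t + 1) + 1)"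
    by (rule ret_main1[OF dpvc_prog_nth(1) s(1)])
  have "real (body_size * (solve_cost N \<Delta> (?t + 1) + 1 + 1)) \<le>
    (22 * max 1 (log 2 (real n) / \<epsilon>)) ^ ?t * (real (body_size * 202 * 8 ^ 6) * real q ^ 12)"
  proof -
    have "1 * 1 \<le> \<Delta> ^ ?t * N ^ 6"
      using \<Delta>(1) nn(2) q(2) by (intro mult_le_mono) (auto simp: Suc_le_eq)
    moreover have "solve_cost N \<Delta> (?t + 1) \<le> \<Delta> ^ ?t * (200 * N ^ 6)"
      using solve_cost_le(2)[OF \<Delta>(1) \<Delta>N, of "?t + 1"] by simp
    moreover have "\<Delta> ^ ?t * (202 * N ^ 6) = \<Delta> ^ ?t * (200 * N ^ 6) + 2 * (\<Delta> ^ ?t * N ^ 6)"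
      by (simp add: algebra_simps)
    ultimately have "solve_cost N \<Delta> (?t + 1) + 1 + 1 \<le> \<Delta> ^ ?t * (202 * N ^ 6)"
      by linarith
    moreover have "N ^ 6 \<le> 8 ^ 6 * q ^ 12"
    proof -
      have "(q + 1) ^ 2 \<le> (2 * q) ^ 2"
        using q(2) by (intro power_mono) auto
      then have "N \<le> 8 * q ^ 2"
        by (simp add: N_def power_mult_distrib)
      then have "N ^ 6 \<le> (8 * q ^ 2) ^ 6"
        by (intro power_mono) auto
      also have "\<dots> = 8 ^ 6 * q ^ 12"
        by (simp only: power_mult_distrib power_mult[symmetric]) simp
      finally show ?thesis .
    qed
    then have "\<Delta> ^ ?t * (202 * N ^ 6) \<le> \<Delta> ^ ?t * (202 * (8 ^ 6 * q ^ 12))"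
      by (intro mult_le_mono2)
    ultimately have "body_size * (solve_cost N \<Delta> (?t + 1) + 1 + 1) \<le> body_size * (\<Delta> ^ ?t * (202 * (8 ^ 6 * q ^ 12)))"
      by (intro mult_le_mono2) linarith
    also have "\<dots> = \<Delta> ^ ?t * (body_size * 202 * 8 ^ 6 * q ^ 12)"
      by (simp only: mult_ac)
    finally have "real (body_size * (solve_cost N \<Delta> (?t + 1) + 1 + 1)) \<le> real (\<Delta> ^ ?t * (body_size * 202 * 8 ^ 6 * q ^ 12))"
      by (simp only: of_nat_le_iff)
    also have "\<dots> = real \<Delta> ^ ?t * (real (body_size * 202 * 8 ^ 6) * real q ^ 12)"
      by (simp only: of_nat_mult of_nat_power)
    also have "\<dots> \<le> (22 * max 1 (log 2 (real n) / \<epsilon>)) ^ ?t * (real (body_size * 202 * 8 ^ 6) * real q ^ 12)"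
      using \<Delta>(4) unfolding \<epsilon> by (intro mult_right_mono power_mono) auto
    finally show ?thesis .
  qed
  from computes_withinI[OF machine_axioms main this]
  have "computes_within dpvc_prog 7 ?x (enc_list Num (map s [0..<n]))
    ((22 * max 1 (log 2 (real n) / \<epsilon>)) ^ ?t * (real (body_size * 202 * 8 ^ 6) * real q ^ 12))" .
  moreover have "approx_output n E w (1 + \<epsilon>) (enc_list Num (map s [0..<n]))"
    using approx_outputI[OF inst s(2), of "1 + \<epsilon>"] s(3) by (simp add: \<epsilon> add_pos_nonneg)
  ultimately show ?thesis
    unfolding q_def by blast
qed

text \<open>The first summand is the search with k = t + 1, whence 9k + 7 = 9t + 16. The second is
  the dynamic program on bags of size 6k + 4, whence the exponent 6k + 3 = 6t + 9. The powers of 20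
  stem from the choice of \<open>N\<close> as 20(n + 1)^2.\<close>

definition fpt_factor :: "nat \<Rightarrow> real \<Rightarrow> real" where
  "fpt_factor t e = real body_size * (real (t + 2) * 3 ^ (9 * t + 16) * 1500 * 20 ^ 8 +
     (44 * max 1 e) ^ (6 * t + 9) * (fact (6 * t + 9) * 3) * 200 * 20 ^ 6 + 2)"

lemma approximation_scheme:
  assumes inst: "dpvc_instance {..<n} E w" "edge_list E w es"
    and ab: "0 < a" "0 < b" and \<epsilon>: "\<epsilon> = real a / real b"
  shows "\<exists>y. computes_within dpvc_prog 7 (Cell (enc_instance n es) (enc_ratio a b)) y
      (fpt_factor (treewidth {..<n} E) (1 / \<epsilon>) * real (n + 1) ^ 16) \<and> approx_output n E w (1 + \<epsilon>) y"
proof -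
  let ?x = "Cell (enc_instance n es) (enc_ratio a b)"
  let ?m = "2 + max_num ?x" and ?t = "treewidth {..<n} E"
  define N where "N = 20 * (n + 1) ^ 2"
  define k where "k = ?t + 1"
  note es = edge_list_edges_ok[OF inst]
  note len = length_edge_list[OF es inst(2)]
  have sg: "simple_graph {..<n} E"
    using inst(1) by (simp add: dpvc_instance_def)
  have k: "k \<le> n + 1"
    using treewidth_le[OF sg] by (simp add: k_def)
  obtain U0 where U0: "good U0" "forg U0 = {..<n}" "\<forall>e\<in>E. \<exists>X\<in>bags U0. e \<subseteq> X" "\<forall>X\<in>bags U0. card X \<le> ?t + 1"
    using ex_good_ntd_treewidth[OF sg] by blast
  then have narrow: "narrow n es k"
    unfolding narrow_def k_def using covers_bags[OF inst(2)] by blast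
  have N_eq: "N = 20 * (n * n) + 40 * n + 20"
    by (simp add: N_def power2_eq_square algebra_simps)
  have size: "(2 * n + 1) * (3 * n + 2) = 6 * (n * n) + 7 * n + 2"
    by (simp add: algebra_simps)
  have nn: "n * n + 2 \<le> N" "length es \<le> N" "(2 * n + 1) * (3 * n + 2) + 1 \<le> N" "6 * k + 5 \<le> N"
    "3 \<le> N" "n \<le> N" "(2 * n + 1) * (3 * n + 2) + n \<le> N"
    using len k unfolding N_eq size by linarith+
  obtain \<Delta> where \<Delta>: "1 \<le> \<Delta>" "\<Delta> \<le> n * n + 2" "\<forall>v<n. a < b \<longrightarrow> length (domain es n a b v) \<le> \<Delta>"
    "real \<Delta> \<le> 22 * max 1 (log 2 (real n) / (real a / real b))"
    using ex_domain_bound[OF es len ab] by blast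
  have \<Delta>N: "\<Delta> \<le> N"
    using \<Delta>(2) nn(1) by linarith
  define M where "M = max_num ?x"
  have le: "n + 2 \<le> ?m" "M + 2 \<le> ?m" "a + 2 \<le> ?m" "b + 2 \<le> ?m"
    using max_num_enc_instance(1)[of n es] by (auto simp: M_def enc_ratio_def)
  have wt: "x \<le> M \<and> y \<le> M" if "(u, v, x, y) \<in> set es" for u v x y
    using max_num_enc_instance(2)[OF that, of n] by (auto simp: M_def)
  note W = word_bounds[OF le k]
  interpret prog_td dpvc_prog "?m ^ 7" body_size
    using W(1) by (rule prog_td_dpvc_prog)
  obtain U where U: "ret F_search [Num 0, Num n, enc_list enc_edge es] (enc_ntd U)
      ((k + 1 - 0) * ((n + 1) * iter_cost N n k + 2))" "tree_for es n k n U"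
    using ret_search[OF es nn(2,3) W(10,11) narrow nn(4) W(12), of 0] by auto
  have U': "good U" "root_bag U \<union> forg U = {..<n}" "covers U es" "\<forall>X\<in>bags U. card X \<le> 6 * k + 4" "nsize U + n \<le> N"
  proof -
    show "covers U es"
      unfolding covers_def
    proof clarify
      fix u v x y assume e: "(u, v, x, y) \<in> set es"
      then have "u < n" "v < n"
        using es by (auto simp: edges_ok_def)
      with e U(2) show "\<exists>X\<in>bags U. u \<in> X \<and> v \<in> X"
        unfolding tree_for_def by blast
    qed
  qed (use U(2) nn(7) in \<open>auto simp: tree_for_def\<close>)
  have w: "6 * k + 4 \<le> N"
    using nn(4) by simp
  have "\<exists>s. ret F_solve [Num n, enc_list enc_edge es, enc_ntd U, Num a, Num b]
      (enc_list Num (map s [0..<n])) (solve_cost N \<Delta> (6 * k + 4)) \<and> feas n es (\<lambda>v. real (s v)) \<and>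
    (\<forall>p. feas n es p \<longrightarrow> (\<Sum>v<n. real (s v)) \<le> (1 + real a / real b) * (\<Sum>v<n. p v))"
    by (rule ret_solve[OF es _ U'(1-4) w nn(2) U'(5) ab \<Delta>(1) _ W(2-9)]) (use wt \<Delta>(3) in blast)+
  then obtain s where s: "ret F_solve [Num n, enc_list enc_edge es, enc_ntd U, Num a, Num b]
      (enc_list Num (map s [0..<n])) (solve_cost N \<Delta> (6 * k + 4))"
    "feas n es (\<lambda>v. real (s v))"
    "\<And>p. feas n es p \<Longrightarrow> (\<Sum>v<n. real (s v)) \<le> (1 + real a / real b) * (\<Sum>v<n. p v)"
    by blast
  let ?c = "(k + 1) * ((n + 1) * iter_cost N n k + 2) + solve_cost N \<Delta> (6 * k + 4) + 1"
  have main: "ret 0 [?x] (enc_list Num (map s [0..<n])) ?c"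
    using ret_main2[OF dpvc_prog_nth(1) U(1) s(1)] by simp
  have "real (body_size * (?c + 1)) \<le> fpt_factor ?t (1 / \<epsilon>) * real (n + 1) ^ 16"
  proof -
    let ?n = "real (n + 1)"
    have pow: "?n ^ i \<le> ?n ^ 16" if "i \<le> 16" for i
      using that by (intro power_increasing) auto
    have N8: "real N ^ 8 = 20 ^ 8 * ?n ^ 16" and N6: "real N ^ 6 = 20 ^ 6 * ?n ^ 12"
      by (simp_all only: N_def of_nat_mult of_nat_power power_mult_distrib power_mult[symmetric]) simp_all
    have e: "9 * k + 7 = 9 * ?t + 16" "6 * k + 4 - 1 = 6 * ?t + 9" "k + 1 = ?t + 2"
      by (simp_all add: k_def)
    have "real ((k + 1) * ((n + 1) * iter_cost N n k + 2)) \<le> real ((k + 1) * 3 ^ (9 * k + 7) * 1500 * N ^ 8)"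
      using search_cost_le[OF nn(5,6), of k] by (simp only: of_nat_le_iff)
    also have "\<dots> = real (?t + 2) * 3 ^ (9 * ?t + 16) * 1500 * real N ^ 8"
      unfolding e by (simp only: of_nat_mult of_nat_power of_nat_numeral)
    finally have 1: "real ((k + 1) * ((n + 1) * iter_cost N n k + 2)) \<le>
      real (?t + 2) * 3 ^ (9 * ?t + 16) * 1500 * 20 ^ 8 * ?n ^ 16"
      unfolding N8 by (simp only: mult.assoc)
    have "real (solve_cost N \<Delta> (6 * k + 4)) \<le> real (\<Delta> ^ (6 * ?t + 9) * (200 * N ^ 6))"
      using solve_cost_le(2)[OF \<Delta>(1) \<Delta>N, of "6 * k + 4"] unfolding e by (simp only: of_nat_le_iff)
    also have "\<dots> = real \<Delta> ^ (6 * ?t + 9) * (200 * real N ^ 6)"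
      by simp
    \<comment> \<open>Here the power of the logarithm is traded for a factorial and one more factor
      n + 1.\<close>
    also have "\<dots> \<le> (44 * max 1 (1 / \<epsilon>)) ^ (6 * ?t + 9) * (fact (6 * ?t + 9) * 3 * ?n) * (200 * real N ^ 6)"
      using domain_bound_power[of \<Delta> n \<epsilon> "6 * ?t + 9"] \<Delta>(4) ab by (intro mult_right_mono) (auto simp: \<epsilon>)
    also have "\<dots> = (44 * max 1 (1 / \<epsilon>)) ^ (6 * ?t + 9) * (fact (6 * ?t + 9) * 3) * 200 * 20 ^ 6 * (?n ^ 12 * ?n)"
      unfolding N6 by (simp only: mult_ac)
    also have "\<dots> \<le> (44 * max 1 (1 / \<epsilon>)) ^ (6 * ?t + 9) * (fact (6 * ?t + 9) * 3) * 200 * 20 ^ 6 * ?n ^ 16"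
    proof (rule mult_left_mono)
      show "?n ^ 12 * ?n \<le> ?n ^ 16"
        using pow[of 13] by (simp add: power_Suc2[of _ 12, simplified])
    qed auto
    finally have 2: "real (solve_cost N \<Delta> (6 * k + 4)) \<le>
      (44 * max 1 (1 / \<epsilon>)) ^ (6 * ?t + 9) * (fact (6 * ?t + 9) * 3) * 200 * 20 ^ 6 * ?n ^ 16" .
    have 3: "2 \<le> 2 * ?n ^ 16"
      using pow[of 0] by simp
    have "real (?c + 1) = real ((k + 1) * ((n + 1) * iter_cost N n k + 2)) + real (solve_cost N \<Delta> (6 * k + 4)) + 2"
      by (simp only: of_nat_add of_nat_1)
    also have "\<dots> \<le> real (?t + 2) * 3 ^ (9 * ?t + 16) * 1500 * 20 ^ 8 * ?n ^ 16 +
      (44 * max 1 (1 / \<epsilon>)) ^ (6 * ?t + 9) * (fact (6 * ?t + 9) * 3) * 200 * 20 ^ 6 * ?n ^ 16 + 2 * ?n ^ 16"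
      by (rule add_mono[OF add_mono[OF 1 2] 3])
    also have "\<dots> = (real (?t + 2) * 3 ^ (9 * ?t + 16) * 1500 * 20 ^ 8 +
      (44 * max 1 (1 / \<epsilon>)) ^ (6 * ?t + 9) * (fact (6 * ?t + 9) * 3) * 200 * 20 ^ 6 + 2) * ?n ^ 16"
      by (simp only: distrib_right)
    finally have "real body_size * real (?c + 1) \<le> fpt_factor ?t (1 / \<epsilon>) * ?n ^ 16"
      unfolding fpt_factor_def mult.assoc[of "real body_size"] by (intro mult_left_mono) auto
    then show ?thesis
      by (simp only: of_nat_mult)
  qed
  from computes_withinI[OF machine_axioms main this]
  have "computes_within dpvc_prog 7 ?x (enc_list Num (map s [0..<n]))
    (fpt_factor ?t (1 / \<epsilon>) * real (n + 1) ^ 16)" .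
  moreover have "approx_output n E w (1 + \<epsilon>) (enc_list Num (map s [0..<n]))"
    using approx_outputI[OF inst s(2), of "1 + \<epsilon>"] s(3) by (simp add: \<epsilon> add_pos_nonneg)
  ultimately show ?thesis
    by blast
qed

theorem theorem5:
  shows "(\<exists>(P :: prog) (C :: real) (K :: real) (c :: nat) (k :: nat).
            \<forall>n E w es T t a b \<epsilon>.
              dpvc_instance {..<n} E w \<longrightarrow> edge_list E w es \<longrightarrow>
              nice_tree_decomposition {..<n} E T \<longrightarrow> t = ntd_width T \<longrightarrow>
              0 < a \<longrightarrow> 0 < b \<longrightarrow> \<epsilon> = real a / real b \<longrightarrow>
              (\<exists>y. computes_within P k
                     (Cell (enc_instance n es) (Cell (enc_ntd T) (enc_ratio a b))) y
                     ((C * max 1 (log 2 (real n) / \<epsilon>)) ^ t *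
                      (K * real (n + card (ntd_nodes T)) ^ c)) \<and>
                   approx_output n E w (1 + \<epsilon>) y))
         \<and> (\<exists>P. dpvc_fpt_approximation_scheme_treewidth P)"
proof
  show "\<exists>(P :: prog) (C :: real) (K :: real) (c :: nat) (k :: nat).
            \<forall>n E w es T t a b \<epsilon>.
              dpvc_instance {..<n} E w \<longrightarrow> edge_list E w es \<longrightarrow>
              nice_tree_decomposition {..<n} E T \<longrightarrow> t = ntd_width T \<longrightarrow>
              0 < a \<longrightarrow> 0 < b \<longrightarrow> \<epsilon> = real a / real b \<longrightarrow>
              (\<exists>y. computes_within P k
                     (Cell (enc_instance n es) (Cell (enc_ntd T) (enc_ratio a b))) y
                     ((C * max 1 (log 2 (real n) / \<epsilon>)) ^ t *
                      (K * real (n + card (ntd_nodes T)) ^ c)) \<and>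
                   approx_output n E w (1 + \<epsilon>) y)"
    by (rule exI[of _ dpvc_prog], rule exI[of _ 22], rule exI[of _ "real (body_size * 202 * 8 ^ 6)"],
        rule exI[of _ 12], rule exI[of _ 7]) (use approximation_given_decomposition in blast)
  show "\<exists>P. dpvc_fpt_approximation_scheme_treewidth P"
    unfolding dpvc_fpt_approximation_scheme_treewidth_def
    by (rule exI[of _ dpvc_prog], rule exI[of _ fpt_factor], rule exI[of _ 16], rule exI[of _ 7])
      (use approximation_scheme in blast)
qed

end
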